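(* Let $\mu,\nu\in\mathcal M$ with $\mu(\mathbb R)=\nu(\mathbb R)$ and $\min\{p_{\mu,\nu},c_{\mu,\nu}\}>0$. Then for every $\pi^*\in\Pi^*(\mu,\nu)$, $$V(\mu,\nu)=\int_{\mathbb R}\Big|x-\int_{\mathbb R}y\,\pi^*_x(dy)\Big|\,\mu(dx)=(\overline{\chi^-}-\overline{\eta^-})+(\overline{\eta^+}-\overline{\chi^+})=V(\eta^-,\chi^-)+V(\eta^+,\chi^+).$$ Furthermore, any optimizer of $V(\mu,\nu)$ (i.e. any $\pi\in\Pi(\mu,\nu)$ attaining the infimum defining $V(\mu,\nu)$) belongs to $\Pi^*(\mu,\nu)$.
   Context: $\mathcal M$ is the set of Borel measures $\eta$ on $\mathbb R$ with $\eta(\mathbb R)<\infty$ and $\int|x|\,\eta(dx)<\infty$. For $\eta\in\mathcal M$: $\overline\eta=\int x\,\eta(dx)$ (not normalized), $P_\eta(k)=\int(k-x)^+\eta(dx)$, $C_\eta(k)=\int(x-k)^+\eta(dx)$. For $\eta,\chi\in\mathcal M$ of equal mass, $\Pi(\eta,\chi)$ is the set of measures on $\mathbb R^2$ with first marginal $\eta$ and second marginal $\chi$; each $\pi\in\Pi(\eta,\chi)$ is disintegrated as $\pi(dx,dy)=\pi_x(dy)\eta(dx)$ with $\pi_x$ probability measures. $\Pi_M(\eta,\chi)$, $\Pi_{Sub}(\eta,\chi)$, $\Pi_{Sup}(\eta,\chi)$ are the subsets of $\pi\in\Pi(\eta,\chi)$ with $\int y\,\pi_x(dy)=x$, $\ge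 x$, $\le x$, respectively, for $\eta$-a.e. $x$. Define $$V(\eta,\chi)=\inf_{\pi\in\Pi(\eta,\chi)}\int_{\mathbb R}\Big|x-\int y\,\pi_x(dy)\Big|\,\eta(dx).$$ Fix $\mu,\nu\in\mathcal M$ of equal mass. Let $p_{\mu,\nu}=\sup_k\{P_\mu(k)-P_\nu(k)\}$, $c_{\mu,\nu}=\sup_k\{C_\mu(k)-C_\nu(k)\}$ (finite and nonnegative). If both are $>0$, put $\tilde P=P_\nu+p_{\mu,\nu}$ and $$x^-=\inf\{k:\tilde P(k)=P_\mu(k)\},\qquad x^+=\sup\{k:\tilde P(k)=P_\mu(k)\},$$ which are real numbers with $x^-\le x^+$. With $f'(k\pm)$ the right/left derivatives, let $\Delta^-=P_\mu'(x^--)=\mu((-\infty,x^-))$ and $\Delta^+=P_\mu'(x^++)=\mu((-\infty,x^+])$. Define $$\eta^-=\mu|_{(-\infty,x^-)},\quad \eta^0=\mu|_{[x^-,x^+]},\quad \eta^+=\mu|_{(x^+,\infty)},$$ $$\chi^-=\nu|_{(-\infty,x^-)}+\big(\Delta^--\tilde P'(x^--)\big)\delta_{x^-},\quad \chi^+=\nu|_{(x^+,\infty)}+\big(\tilde P'(x^++)-\Delta^+\big)\delta_{x^+},\quad \chi^0=\nu-\chi^--\chi^+,$$ so that $\chi^\pm(\mathbb R)=\eta^\pm(\mathbb R)$ and $\chi^0(\mathbb R)=\eta^0(\mathbb R)$. $\Pi^*(\mu,\nu)$ is the set of $\pi\in\Pi(\mu,\nu)$ of the form $\pi=\pi^-+\pi^0+\pi^+$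 with $\pi^-\in\Pi_{Sub}(\eta^-,\chi^-)$, $\pi^0\in\Pi_M(\eta^0,\chi^0)$, $\pi^+\in\Pi_{Sup}(\eta^+,\chi^+)$. *)

theory Defs
  imports "HOL-Probability.Probability"
begin

definition fin_meas :: "real measure set" where
  "fin_meas = {\<eta>. sets \<eta> = sets borel \<and> finite_measure \<eta> \<and> integrable \<eta> (\<lambda>x. \<bar>x\<bar>)}"

text \<open>The first moment is not normalized by the mass.\<close>

definition bary :: "real measure \<Rightarrow> real" where
  "bary \<eta> = (\<integral>x. x \<partial>\<eta>)"

definition put_fun :: "real measure \<Rightarrow> real \<Rightarrow> real" where
  "put_fun \<eta> k = (\<integral>x. max (k - x) 0 \<partial>\<eta>)"

definition call_fun :: "real measure \<Rightarrow> real \<Rightarrow> real" where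
  "call_fun \<eta> k = (\<integral>x. max (x - k) 0 \<partial>\<eta>)"


definition add_measure :: "'a measure \<Rightarrow> 'a measure \<Rightarrow> 'a measure" where
  "add_measure M N = measure_of (space M) (sets M) (\<lambda>A. emeasure M A + emeasure N A)"

lemma space_add_measure [simp]: "space (add_measure M N) = space M"
  and sets_add_measure [simp]: "sets (add_measure M N) = sets M"
  by (auto simp: add_measure_def)

lemma emeasure_add_measure:
  assumes "sets N = sets M" "A \<in> sets M"
  shows "emeasure (add_measure M N) A = emeasure M A + emeasure N A"
  unfolding add_measure_def
proof (rule emeasure_measure_of_sigma)
  show "sigma_algebra (space M) (sets M)" ..
  show "positive (sets M) (\<lambda>A. emeasure M A + emeasure N A)"
    by (simp add: positive_def)
  show "countably_additive (sets M) (\<lambda>A. emeasure M A + emeasure N A)"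
    using assms(1) by (auto simp: countably_additive_def suminf_add [symmetric] suminf_emeasure)
qed fact

text \<open>The part of a measure carried by a set \<open>A\<close>, still regarded as a measure on the whole space
  (unlike \<^const>\<open>restrict_space\<close>, which shrinks the space).\<close>

definition restr :: "real measure \<Rightarrow> real set \<Rightarrow> real measure" where
  "restr \<eta> A = density \<eta> (indicator A)"

definition dirac :: "real \<Rightarrow> real \<Rightarrow> real measure" where
  "dirac c a = scale_measure (ennreal c) (return borel a)"


definition couplings :: "real measure \<Rightarrow> real measure \<Rightarrow> (real \<times> real) measure set" where
  "couplings \<eta> \<xi> = {\<pi>. sets \<pi> = sets borel \<and> distr \<pi> borel fst = \<eta> \<and> distr \<pi> borel snd = \<xi>}"

text \<open>\<open>disintegrates \<eta> \<pi> K\<close> says that \<open>\<pi>(dx,dy) = K x(dy) \<eta>(dx)\<close> for the Markov kernel \<open>K\<close>.\<close>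

definition disintegrates ::
    "real measure \<Rightarrow> (real \<times> real) measure \<Rightarrow> (real \<Rightarrow> real measure) \<Rightarrow> bool" where
  "disintegrates \<eta> \<pi> K \<longleftrightarrow>
     K \<in> borel \<rightarrow>\<^sub>M prob_algebra borel \<and>
     (\<forall>A \<in> sets borel. emeasure \<pi> A = (\<integral>\<^sup>+ x. emeasure (K x) {y. (x, y) \<in> A} \<partial>\<eta>))"

text \<open>For a finite measure \<open>\<pi>\<close> with first marginal \<open>\<eta>\<close> a disintegration exists and is unique up
  to an \<open>\<eta>\<close>-null set. \<open>disint \<eta> \<pi> x\<close> is one version of \<open>\<pi>\<^sub>x\<close>; the notions below do not depend on
  which version is chosen.\<close>

definition disint :: "real measure \<Rightarrow> (real \<times> real) measure \<Rightarrow> real \<Rightarrow> real measure" where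
  "disint \<eta> \<pi> = (SOME K. disintegrates \<eta> \<pi> K)"

definition couplings_M :: "real measure \<Rightarrow> real measure \<Rightarrow> (real \<times> real) measure set" where
  "couplings_M \<eta> \<xi> = {\<pi> \<in> couplings \<eta> \<xi>. AE x in \<eta>. (\<integral>y. y \<partial>disint \<eta> \<pi> x) = x}"

definition couplings_Sub :: "real measure \<Rightarrow> real measure \<Rightarrow> (real \<times> real) measure set" where
  "couplings_Sub \<eta> \<xi> = {\<pi> \<in> couplings \<eta> \<xi>. AE x in \<eta>. (\<integral>y. y \<partial>disint \<eta> \<pi> x) \<ge> x}"

definition couplings_Sup :: "real measure \<Rightarrow> real measure \<Rightarrow> (real \<times> real) measure set" where
  "couplings_Sup \<eta> \<xi> = {\<pi> \<in> couplings \<eta> \<xi>. AE x in \<eta>. (\<integral>y. y \<partial>disint \<eta> \<pi> x) \<le> x}"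

definition cost :: "real measure \<Rightarrow> (real \<times> real) measure \<Rightarrow> real" where
  "cost \<eta> \<pi> = (\<integral>x. \<bar>x - (\<integral>y. y \<partial>disint \<eta> \<pi> x)\<bar> \<partial>\<eta>)"

definition V :: "real measure \<Rightarrow> real measure \<Rightarrow> real" where
  "V \<eta> \<xi> = (INF \<pi> \<in> couplings \<eta> \<xi>. cost \<eta> \<pi>)"


definition p_gap :: "real measure \<Rightarrow> real measure \<Rightarrow> real" where
  "p_gap \<mu> \<nu> = (SUP k. put_fun \<mu> k - put_fun \<nu> k)"

definition c_gap :: "real measure \<Rightarrow> real measure \<Rightarrow> real" where
  "c_gap \<mu> \<nu> = (SUP k. call_fun \<mu> k - call_fun \<nu> k)"

definition Ptilde :: "real measure \<Rightarrow> real measure \<Rightarrow> real \<Rightarrow> real" where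
  "Ptilde \<mu> \<nu> k = put_fun \<nu> k + p_gap \<mu> \<nu>"

definition xm :: "real measure \<Rightarrow> real measure \<Rightarrow> real" where
  "xm \<mu> \<nu> = Inf {k. Ptilde \<mu> \<nu> k = put_fun \<mu> k}"

definition xp :: "real measure \<Rightarrow> real measure \<Rightarrow> real" where
  "xp \<mu> \<nu> = Sup {k. Ptilde \<mu> \<nu> k = put_fun \<mu> k}"

abbreviation left_deriv :: "(real \<Rightarrow> real) \<Rightarrow> real \<Rightarrow> real" where
  "left_deriv f k \<equiv> vector_derivative f (at_left k)"

abbreviation right_deriv :: "(real \<Rightarrow> real) \<Rightarrow> real \<Rightarrow> real" where
  "right_deriv f k \<equiv> vector_derivative f (at_right k)"

definition Delta_m :: "real measure \<Rightarrow> real measure \<Rightarrow> real" where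
  "Delta_m \<mu> \<nu> = left_deriv (put_fun \<mu>) (xm \<mu> \<nu>)"

definition Delta_p :: "real measure \<Rightarrow> real measure \<Rightarrow> real" where
  "Delta_p \<mu> \<nu> = right_deriv (put_fun \<mu>) (xp \<mu> \<nu>)"

definition eta_m :: "real measure \<Rightarrow> real measure \<Rightarrow> real measure" where
  "eta_m \<mu> \<nu> = restr \<mu> {..<xm \<mu> \<nu>}"

definition eta_0 :: "real measure \<Rightarrow> real measure \<Rightarrow> real measure" where
  "eta_0 \<mu> \<nu> = restr \<mu> {xm \<mu> \<nu>..xp \<mu> \<nu>}"

definition eta_p :: "real measure \<Rightarrow> real measure \<Rightarrow> real measure" where
  "eta_p \<mu> \<nu> = restr \<mu> {xp \<mu> \<nu><..}"

text \<open>The atoms added below have nonnegative mass, and \<open>chi_m + chi_p \<le> \<nu>\<close> setwise, because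
  \<open>Ptilde \<mu> \<nu>\<close> dominates \<open>put_fun \<mu>\<close> and touches it at \<open>xm \<mu> \<nu>\<close> and \<open>xp \<mu> \<nu>\<close>; hence neither
  \<^const>\<open>ennreal\<close> nor \<^const>\<open>diff_measure\<close> truncates.\<close>

definition chi_m :: "real measure \<Rightarrow> real measure \<Rightarrow> real measure" where
  "chi_m \<mu> \<nu> = add_measure (restr \<nu> {..<xm \<mu> \<nu>})
     (dirac (Delta_m \<mu> \<nu> - left_deriv (Ptilde \<mu> \<nu>) (xm \<mu> \<nu>)) (xm \<mu> \<nu>))"

definition chi_p :: "real measure \<Rightarrow> real measure \<Rightarrow> real measure" where
  "chi_p \<mu> \<nu> = add_measure (restr \<nu> {xp \<mu> \<nu><..})
     (dirac (right_deriv (Ptilde \<mu> \<nu>) (xp \<mu> \<nu>) - Delta_p \<mu> \<nu>) (xp \<mu> \<nu>))"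

definition chi_0 :: "real measure \<Rightarrow> real measure \<Rightarrow> real measure" where
  "chi_0 \<mu> \<nu> = diff_measure (diff_measure \<nu> (chi_m \<mu> \<nu>)) (chi_p \<mu> \<nu>)"

definition Pi_star :: "real measure \<Rightarrow> real measure \<Rightarrow> (real \<times> real) measure set" where
  "Pi_star \<mu> \<nu> = {\<pi> \<in> couplings \<mu> \<nu>.
     \<exists>\<pi>m \<in> couplings_Sub (eta_m \<mu> \<nu>) (chi_m \<mu> \<nu>).
     \<exists>\<pi>0 \<in> couplings_M (eta_0 \<mu> \<nu>) (chi_0 \<mu> \<nu>).
     \<exists>\<pi>p \<in> couplings_Sup (eta_p \<mu> \<nu>) (chi_p \<mu> \<nu>).
       \<pi> = add_measure (add_measure \<pi>m \<pi>0) \<pi>p}"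

end

theory Submission
  imports Defs
begin

text \<open>
  Let \<open>m x\<close> denote the mean of \<open>\<pi>\<^sub>x\<close>. A coupling costs the integral of \<open>\<bar>x - m x\<bar>\<close>, and since \<open>m\<close> has the same
  integral as \<open>\<nu>\<close>, the cost is twice the upward shift \<open>\<integral>max (m x - x) 0 \<partial>\<mu>\<close> plus the constant \<open>bary \<mu> - bary \<nu>\<close>
  (\<open>cost_eq\<close>). By put-call parity \<open>c_gap \<mu> \<nu> = p_gap \<mu> \<nu> + bary \<mu> - bary \<nu>\<close>. So everything reduces to comparing the upward
  shift with \<open>p_gap \<mu> \<nu>\<close>. For each strike \<open>k\<close> one has \<open>max (m - x) 0 \<ge> max (k - x) 0 - max (k - m) 0\<close>, and the
  conditional Jensen inequality bounds the integral of \<open>max (k - m) 0\<close> by \<open>put_fun \<nu> k\<close>. Hence every coupling costs at least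
  \<open>p_gap \<mu> \<nu> + c_gap \<mu> \<nu>\<close> (\<open>cost_ge\<close>).

  That this bound is the value of the problem (\<open>V_eq_gaps\<close>) is a minimax argument. The conditional means of
  couplings form a convex set. At a near minimiser of a smoothed cost, let \<open>w\<close> be the derivative, a function with values in
  \<open>[-1, 1]\<close>. Then no coupling is much better than the near minimiser for the linear functional \<open>\<integral>w x * (x - y) \<partial>\<pi>\<close>,
  whose value at the near minimiser is almost its cost. But a coupling in which \<open>w x\<close> and \<open>y\<close> are comonotone keeps
  this functional below \<open>p_gap \<mu> \<nu> + c_gap \<mu> \<nu>\<close> (\<open>best_response\<close>): it matches each level set \<open>{w \<ge> s}\<close> with an upper tail of \<open>\<nu>\<close>, where
  the gain is a difference of calls.

  The points \<open>xm\<close> and \<open>xp\<close> are strikes at which \<open>p_gap\<close> is attained (\<open>contact_points\<close>). Computing first moments relative to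
  them shows that the three pieces of a coupling in \<open>Pi_star\<close> cost \<open>p_gap\<close>, \<open>0\<close> and \<open>c_gap\<close> (\<open>Pi_star_optimal\<close>). Conversely, an optimal
  coupling has equality in the two inequalities above at both strikes; this forces \<open>m x\<close> to lie between \<open>x\<close> and the
  strike and forbids mass to cross the strike (\<open>optimal_cond_mean_contact\<close>), which is the decomposition.

  The means are defined through a disintegration, whose existence is proved first from Radon-Nikodym
  densities (\<open>disintegration_exists\<close>).
\<close>

section \<open>Sums and restrictions of measures\<close>

lemma space_eq_UNIV_if_borel: "sets M = sets (borel :: 'a::topological_space measure) \<Longrightarrow> space M = UNIV"
  using sets_eq_imp_space_eq by fastforce

lemma measurable_if_sets_borel:
  "sets M = sets borel \<Longrightarrow> f \<in> borel_measurable borel \<Longrightarrow> f \<in> borel_measurable M"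
  using measurable_cong_sets by blast

lemma integrable_bounded_times:
  fixes f h :: "'a \<Rightarrow> real"
  assumes f: "integrable M f" and h: "h \<in> borel_measurable M" and b: "\<And>x. \<bar>h x\<bar> \<le> 1"
  shows "integrable M (\<lambda>x. h x * f x)"
  using h b by (intro Bochner_Integration.integrable_bound[OF f]) (use f in \<open>auto simp: abs_mult mult_left_le_one_le\<close>)

text \<open>Testing on the set where the claim fails makes a nonnegative function have integral zero.\<close>

lemma AE_le_if_set_integral_le:
  fixes f g :: "'a \<Rightarrow> real"
  assumes f: "integrable M f" and g: "integrable M g"
    and le: "\<And>A. A \<in> sets M \<Longrightarrow> (\<integral>x. indicator A x * f x \<partial>M) \<le> (\<integral>x. indicator A x * g x \<partial>M)"
  shows "AE x in M. f x \<le> g x"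
proof -
  have [measurable]: "f \<in> borel_measurable M" "g \<in> borel_measurable M"
    using f g by auto
  define A where "A = {x \<in> space M. g x < f x}"
  have A: "A \<in> sets M" unfolding A_def by measurable
  have i: "integrable M (\<lambda>x. indicator A x * f x)" "integrable M (\<lambda>x. indicator A x * g x)"
    using f g A by (auto intro: integrable_real_mult_indicator simp: mult.commute)
  define h where "h = (\<lambda>x. indicator A x * f x - indicator A x * g x)"
  have h0: "0 \<le> h x" if "x \<in> space M" for x
    using that by (auto simp: h_def A_def indicator_def)
  have hi: "integrable M h" unfolding h_def using i by auto
  have "(\<integral>x. h x \<partial>M) \<le> 0"
    unfolding h_def using i le[OF A] by simp
  then have "(\<integral>x. h x \<partial>M) = 0"
    using h0 by (intro antisym) (auto intro!: integral_nonneg_AE)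
  then have "AE x in M. h x = 0"
    using integral_nonneg_eq_0_iff_AE[OF hi] h0 by auto
  then show ?thesis
    by (rule AE_mp) (auto intro!: AE_I2 simp: h_def A_def indicator_def split: if_splits)
qed

lemma AE_eq_if_integral_le:
  fixes f g :: "'a \<Rightarrow> real"
  assumes f: "integrable M f" and g: "integrable M g" and le: "AE x in M. f x \<le> g x"
    and int: "(\<integral>x. g x \<partial>M) \<le> (\<integral>x. f x \<partial>M)"
  shows "AE x in M. f x = g x"
proof -
  have i: "integrable M (\<lambda>x. g x - f x)" using f g by simp
  have nn: "AE x in M. 0 \<le> g x - f x" using le by eventually_elim simp
  have "(\<integral>x. g x - f x \<partial>M) \<le> 0" using f g int by simp
  then have "(\<integral>x. g x - f x \<partial>M) = 0" using integral_nonneg_AE[OF nn] by simp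
  then have "AE x in M. g x - f x = 0" using integral_nonneg_eq_0_iff_AE[OF i nn] by simp
  then show ?thesis by eventually_elim simp
qed

lemma
  fixes f :: "'a \<Rightarrow> real"
  assumes A: "A \<in> sets M" and f: "f \<in> borel_measurable M"
  shows integrable_density_indicator:
      "integrable (density M (indicator A)) f \<longleftrightarrow> integrable M (\<lambda>x. indicator A x * f x)"
    and integral_density_indicator:
      "(\<integral>x. f x \<partial>density M (indicator A)) = (\<integral>x. indicator A x * f x \<partial>M)"
proof -
  have eq: "(indicator A :: 'a \<Rightarrow> ennreal) = (\<lambda>x. ennreal (indicator A x))"
    by (simp add: fun_eq_iff ennreal_indicator)
  have i: "(indicator A :: 'a \<Rightarrow> real) \<in> borel_measurable M" using A by simp
  show "integrable (density M (indicator A)) f \<longleftrightarrow> integrable M (\<lambda>x. indicator A x * f x)"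
    unfolding eq using f i by (subst integrable_density) auto
  show "(\<integral>x. f x \<partial>density M (indicator A)) = (\<integral>x. indicator A x * f x \<partial>M)"
    unfolding eq using f i by (subst integral_density) auto
qed

lemma nn_integral_add_measure:
  assumes N: "sets N = sets M" and f: "f \<in> borel_measurable M"
  shows "integral\<^sup>N (add_measure M N) f = integral\<^sup>N M f + integral\<^sup>N N f"
  using f
proof (induction rule: borel_measurable_induct)
  case (cong f g)
  have "space N = space M" using N by (rule sets_eq_imp_space_eq)
  then show ?case
    using cong by (metis (no_types, lifting) nn_integral_cong space_add_measure)
next
  case (set A)
  then show ?case using N by (simp add: emeasure_add_measure)
next
  case (mult u c)
  have [measurable]: "u \<in> borel_measurable (add_measure M N)" "u \<in> borel_measurable N"
    using mult N by (auto cong: measurable_cong_sets)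
  show ?case using mult by (simp add: nn_integral_cmult distrib_left)
next
  case (add u v)
  have [measurable]: "u \<in> borel_measurable (add_measure M N)" "u \<in> borel_measurable N"
    "v \<in> borel_measurable (add_measure M N)" "v \<in> borel_measurable N"
    using add N by (auto cong: measurable_cong_sets)
  show ?case using add by (simp add: nn_integral_add ac_simps)
next
  case (seq U)
  have [measurable]: "\<And>i. U i \<in> borel_measurable (add_measure M N)" "\<And>i. U i \<in> borel_measurable N"
    using seq N by (auto cong: measurable_cong_sets)
  have inc: "incseq (\<lambda>i. integral\<^sup>N M (U i))" "incseq (\<lambda>i. integral\<^sup>N N (U i))"
    using seq by (auto intro!: nn_integral_mono simp: incseq_def le_fun_def)
  have eq: "\<Squnion> (range U) = (\<lambda>x. SUP i. U i x)"
    by (auto simp: fun_eq_iff image_comp)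
  have "integral\<^sup>N (add_measure M N) (\<Squnion> (range U)) = (SUP i. integral\<^sup>N (add_measure M N) (U i))"
    unfolding eq using seq by (intro nn_integral_monotone_convergence_SUP) auto
  also have "\<dots> = (SUP i. integral\<^sup>N M (U i)) + (SUP i. integral\<^sup>N N (U i))"
    using seq inc by (simp add: ennreal_SUP_add)
  also have "(SUP i. integral\<^sup>N M (U i)) = integral\<^sup>N M (\<Squnion> (range U))"
    unfolding eq using seq by (intro nn_integral_monotone_convergence_SUP[symmetric]) auto
  also have "(SUP i. integral\<^sup>N N (U i)) = integral\<^sup>N N (\<Squnion> (range U))"
    unfolding eq using seq by (intro nn_integral_monotone_convergence_SUP[symmetric]) auto
  finally show ?case .
qed

lemma integrable_add_measure_iff:
  fixes f :: "'a \<Rightarrow> real"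
  assumes N: "sets N = sets M"
  shows "integrable (add_measure M N) f \<longleftrightarrow> integrable M f \<and> integrable N f"
proof -
  have "f \<in> borel_measurable (add_measure M N) \<longleftrightarrow> f \<in> borel_measurable M"
    "f \<in> borel_measurable N \<longleftrightarrow> f \<in> borel_measurable M"
    using N by (auto cong: measurable_cong_sets)
  then show ?thesis
    unfolding integrable_iff_bounded
    by (auto simp: nn_integral_add_measure[OF N])
qed

lemma integral_add_measure:
  fixes f :: "'a \<Rightarrow> real"
  assumes N: "sets N = sets M" and "integrable M f" "integrable N f"
  shows "(\<integral>x. f x \<partial>add_measure M N) = (\<integral>x. f x \<partial>M) + (\<integral>x. f x \<partial>N)"
proof -
  have *: "integrable (add_measure M N) f" using assms by (simp add: integrable_add_measure_iff)
  have fin: "(\<integral>\<^sup>+x. ennreal (f x) \<partial>M) < \<top>" "(\<integral>\<^sup>+x. ennreal (f x) \<partial>N) < \<top>"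
    "(\<integral>\<^sup>+x. ennreal (- f x) \<partial>M) < \<top>" "(\<integral>\<^sup>+x. ennreal (- f x) \<partial>N) < \<top>"
    using assms(2,3) by (auto simp: real_integrable_def less_top)
  have [measurable]: "f \<in> borel_measurable M" using assms by auto
  show ?thesis
    using assms(2,3) * fin
    by (simp add: real_lebesgue_integral_def nn_integral_add_measure[OF N] enn2real_plus)
qed

section \<open>Disintegration of couplings on the line\<close>

lemma couplingsD:
  assumes "\<pi> \<in> couplings \<eta> \<xi>"
  shows "sets \<pi> = sets (borel :: (real \<times> real) measure)" "space \<pi> = UNIV"
    "fst \<in> measurable \<pi> borel" "snd \<in> measurable \<pi> borel"
    "distr \<pi> borel fst = \<eta>" "distr \<pi> borel snd = \<xi>" "sets \<eta> = sets borel" "sets \<xi> = sets borel"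
    "emeasure \<pi> UNIV = emeasure \<eta> UNIV"
proof -
  show s: "sets \<pi> = sets (borel :: (real \<times> real) measure)" and d: "distr \<pi> borel fst = \<eta>" "distr \<pi> borel snd = \<xi>"
    using assms by (auto simp: couplings_def)
  show sp: "space \<pi> = UNIV" using s by (rule space_eq_UNIV_if_borel)
  show m: "fst \<in> measurable \<pi> borel" "snd \<in> measurable \<pi> borel"
    using s borel_prod[where 'a=real and 'b=real] by (auto cong: measurable_cong_sets) (metis borel_prod measurable_fst measurable_snd)+
  show "sets \<eta> = sets borel" "sets \<xi> = sets borel" using d by auto
  show "emeasure \<pi> UNIV = emeasure \<eta> UNIV"
    using m sp by (subst d(1)[symmetric], subst emeasure_distr) auto
qed

lemma strip_in_borel: "A \<in> sets borel \<Longrightarrow> B \<in> sets borel \<Longrightarrow> (A :: real set) \<times> (B :: real set) \<in> sets borel"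
  unfolding borel_prod[symmetric] by auto

lemma emeasure_coupling_Times:
  assumes \<pi>: "\<pi> \<in> couplings \<eta> \<xi>"
  shows "A \<in> sets borel \<Longrightarrow> emeasure \<pi> (A \<times> UNIV) = emeasure \<eta> A"
    and "B \<in> sets borel \<Longrightarrow> emeasure \<pi> (UNIV \<times> B) = emeasure \<xi> B"
proof -
  note c = couplingsD[OF \<pi>]
  show "A \<in> sets borel \<Longrightarrow> emeasure \<pi> (A \<times> UNIV) = emeasure \<eta> A"
    using emeasure_distr[OF c(3), of A] by (simp add: c(2,5) vimage_fst)
  show "B \<in> sets borel \<Longrightarrow> emeasure \<pi> (UNIV \<times> B) = emeasure \<xi> B"
    using emeasure_distr[OF c(4), of B] by (simp add: c(2,6) vimage_snd)
qed

text \<open>\<open>F\<close> is a version of the conditional probability that \<open>y \<in> B\<close> given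
  \<open>x\<close>: the Radon-Nikodym density of \<open>A \<mapsto> \<pi> (A \<times> B)\<close> with respect
  to the first marginal.\<close>

lemma conditional_probability_exists:
  fixes B :: "real set"
  assumes \<pi>: "\<pi> \<in> couplings \<eta> \<xi>" and fin: "finite_measure \<eta>" and B: "B \<in> sets borel"
  shows "\<exists>F. F \<in> borel_measurable borel \<and> (\<forall>x. 0 \<le> F x) \<and> integrable \<eta> F \<and>
    (\<forall>A\<in>sets borel. (\<integral>x. indicator A x * F x \<partial>\<eta>) = measure \<pi> (A \<times> B))"
proof -
  note c = couplingsD[OF \<pi>]
  interpret \<eta>: finite_measure \<eta> by fact
  interpret \<pi>: finite_measure \<pi>
    using c(2,9) \<eta>.emeasure_finite[of UNIV] by (intro finite_measureI) simp
  define \<rho> where "\<rho> = distr (density \<pi> (indicator (UNIV \<times> B))) borel fst"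
  have [measurable]: "UNIV \<times> B \<in> sets \<pi>" unfolding c(1) using B by (intro strip_in_borel) auto
  have mf: "fst \<in> measurable (density \<pi> (indicator (UNIV \<times> B))) borel" using c(3) by simp
  have AB: "A \<times> B \<in> sets \<pi>" if "A \<in> sets borel" for A
    unfolding c(1) using that B by (rule strip_in_borel)
  have AU: "A \<times> UNIV \<in> sets \<pi>" if "A \<in> sets borel" for A :: "real set"
    unfolding c(1) using that by (intro strip_in_borel) auto
  have \<rho>: "emeasure \<rho> A = emeasure \<pi> (A \<times> B)" if A: "A \<in> sets borel" for A
  proof -
    have *: "fst -` A = (A \<times> UNIV :: (real \<times> real) set)" by auto
    have "emeasure \<rho> A = emeasure (density \<pi> (indicator (UNIV \<times> B))) (A \<times> UNIV)"
      unfolding \<rho>_def using A mf c(2) by (subst emeasure_distr) (auto simp: *)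
    also have "\<dots> = (\<integral>\<^sup>+z. indicator (A \<times> B) z \<partial>\<pi>)"
      using AU[OF A] by (subst emeasure_density) (auto intro!: nn_integral_cong simp: indicator_def)
    finally show ?thesis using AB[OF A] by simp
  qed
  note \<eta>A = emeasure_coupling_Times(1)[OF \<pi>]
  have s\<rho>: "sets \<rho> = sets \<eta>" using c by (simp add: \<rho>_def)
  have ac: "absolutely_continuous \<eta> \<rho>"
    unfolding absolutely_continuous_def
  proof
    fix A assume A: "A \<in> null_sets \<eta>"
    then have b: "A \<in> sets borel" and 0: "emeasure \<pi> (A \<times> UNIV) = 0" using c(7) \<eta>A by (auto simp: null_sets_def)
    have "emeasure \<rho> A \<le> emeasure \<pi> (A \<times> UNIV)"
      unfolding \<rho>[OF b] using AU[OF b] by (intro emeasure_mono) auto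
    then show "A \<in> null_sets \<rho>" using 0 b s\<rho> c(7) by (auto simp: null_sets_def)
  qed
  have f\<rho>: "finite_measure \<rho>"
    using \<rho>[of UNIV] \<pi>.emeasure_finite by (intro finite_measureI) (auto simp: \<rho>_def)
  obtain D where D: "D \<in> borel_measurable \<eta>" "AE x in \<eta>. RN_deriv \<eta> \<rho> x = ennreal (D x)" "\<And>x. 0 \<le> D x"
    using \<eta>.real_RN_deriv[OF f\<rho> ac s\<rho>] by metis
  have Db: "D \<in> borel_measurable borel" using D(1) c(7) measurable_cong_sets by blast
  have dens: "\<rho> = density \<eta> (\<lambda>x. ennreal (D x))"
    by (subst \<eta>.density_RN_deriv[OF ac s\<rho>, symmetric]) (use D in \<open>auto intro!: density_cong\<close>)
  have nn: "(\<integral>\<^sup>+x. ennreal (D x) * indicator A x \<partial>\<eta>) = emeasure \<pi> (A \<times> B)" if "A \<in> sets borel" for A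
    using that D(1) c(7) \<rho>[OF that] by (simp add: dens emeasure_density)
  have int: "integrable \<eta> D"
    using nn[of UNIV] D(1,3) \<pi>.emeasure_finite[of "UNIV \<times> B"] by (simp add: integrable_iff_bounded less_top[symmetric])
  have "(\<integral>x. indicator A x * D x \<partial>\<eta>) = measure \<pi> (A \<times> B)" if A: "A \<in> sets borel" for A
  proof -
    have "(\<integral>x. indicator A x * D x \<partial>\<eta>) = enn2real (\<integral>\<^sup>+x. ennreal (indicator A x * D x) \<partial>\<eta>)"
      using A D c(7) by (intro integral_eq_nn_integral) auto
    also have "(\<integral>\<^sup>+x. ennreal (indicator A x * D x) \<partial>\<eta>) = (\<integral>\<^sup>+x. ennreal (D x) * indicator A x \<partial>\<eta>)"
      by (intro nn_integral_cong) (auto simp: indicator_def)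
    finally show ?thesis using nn[OF A] by (simp add: measure_def)
  qed
  then show ?thesis using Db D(3) int by blast
qed

text \<open>Values of a distribution function at the rational points extend to a distribution function on
  \<open>\<real>\<close> by taking infima from the right, which makes right continuity automatic. This is how
  almost sure statements about countably many conditional probabilities turn into a probability
  measure.\<close>

lemma cdf_of_rational_values:
  fixes F :: "real \<Rightarrow> real"
  assumes mono: "\<And>q r. q \<in> \<rat> \<Longrightarrow> r \<in> \<rat> \<Longrightarrow> q \<le> r \<Longrightarrow> F q \<le> F r"
    and pos: "\<And>q. 0 \<le> F q" and one: "\<And>q. q \<in> \<rat> \<Longrightarrow> F q \<le> 1"
    and bot: "(INF n::nat. F (- real n)) = 0" and top: "(SUP n::nat. F (real n)) = 1"
  defines "G \<equiv> \<lambda>y. INF q\<in>{q\<in>\<rat>. y < q}. F q"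
  shows "real_distribution (interval_measure G)" "cdf (interval_measure G) = G"
proof -
  have ne: "{q\<in>\<rat>. y < q} \<noteq> {}" for y :: real
    using Rats_dense_in_real[of y "y + 1"] by auto
  have bdd: "bdd_below (F ` X)" for X using pos by (auto intro!: bdd_belowI[where m=0])
  have G_le: "G y \<le> F q" if "y < q" "q \<in> \<rat>" for y q
    unfolding G_def using that by (intro cINF_lower bdd) auto
  have le_G: "F q \<le> G y" if "q \<le> y" "q \<in> \<rat>" for y q
    unfolding G_def using that by (intro cINF_greatest ne) (auto intro!: mono)
  have G_less: "\<exists>q\<in>\<rat>. y < q \<and> F q < z" if "G y < z" for y z
    using that unfolding G_def by (subst (asm) cINF_less_iff[OF ne bdd]) auto
  have mG: "G x \<le> G y" if "x \<le> y" for x y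
    unfolding G_def using that by (intro cINF_superset_mono ne bdd) auto
  have rc: "continuous (at_right a) G" for a
    unfolding continuous_within
  proof (rule order_tendstoI)
    fix z assume "z < G a"
    then show "eventually (\<lambda>x. z < G x) (at_right a)"
      by (intro eventually_at_right_less[THEN eventually_mono]) (meson less_imp_le less_le_trans mG)
  next
    fix z assume "G a < z"
    then obtain q where q: "q \<in> \<rat>" "a < q" "F q < z" using G_less by blast
    then show "eventually (\<lambda>x. G x < z) (at_right a)"
      unfolding eventually_at_right[OF q(2)] using G_le[of _ q] by (meson le_less_trans)
  qed
  have G0: "0 \<le> G y" and G1: "G y \<le> 1" for y
  proof -
    show "0 \<le> G y" unfolding G_def using pos by (intro cINF_greatest ne) auto
    obtain q where "q \<in> \<rat>" "y < q" using ne[of y] by auto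
    then show "G y \<le> 1" using G_le[of y q] one[of q] by linarith
  qed
  have lb: "(G \<longlongrightarrow> 0) at_bot"
  proof (rule order_tendstoI)
    fix z :: real assume "0 < z"
    then have "(INF n::nat. F (- real n)) < z" using bot by simp
    then obtain n :: nat where n: "F (- real n) < z"
      by (subst (asm) cINF_less_iff) (auto intro!: bdd_belowI[where m=0] pos)
    show "eventually (\<lambda>y. G y < z) at_bot"
      using eventually_gt_at_bot[of "- real n"]
    proof eventually_elim
      case (elim y)
      then show ?case using G_le[of y "- real n"] n by simp
    qed
  next
    fix z :: real assume "z < 0" then show "eventually (\<lambda>y. z < G y) at_bot" using G0 by (auto intro!: always_eventually less_le_trans[of z 0])
  qed
  have lt: "(G \<longlongrightarrow> 1) at_top"
  proof (rule order_tendstoI)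
    fix z :: real assume "z < 1"
    then have "z < (SUP n::nat. F (real n))" using top by simp
    then obtain n :: nat where n: "z < F (real n)"
      by (subst (asm) less_cSUP_iff) (auto intro!: bdd_aboveI[where M=1] one)
    show "eventually (\<lambda>y. z < G y) at_top"
      using eventually_ge_at_top[of "real n"] by eventually_elim (use n in \<open>simp add: less_le_trans[OF _ le_G]\<close>)
  next
    fix z :: real assume "1 < z" then show "eventually (\<lambda>y. G y < z) at_top" using G1 by (auto intro!: always_eventually le_less_trans[of _ 1 z])
  qed
  show "real_distribution (interval_measure G)"
    by (rule real_distribution_interval_measure[OF mG rc lb lt])
  show "cdf (interval_measure G) = G"
    by (rule cdf_interval_measure[OF mG rc lb])
qed

text \<open>This makes results on distribution functions available for the slices of a measure on the plane.\<close>

lemma finite_measure_slice: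
  assumes "finite_measure \<pi>" and s: "sets \<pi> = sets (borel :: (real \<times> real) measure)" and A: "A \<in> sets borel"
  defines "\<sigma> \<equiv> distr (density \<pi> (indicator (A \<times> UNIV))) borel (snd :: real \<times> real \<Rightarrow> real)"
  shows "finite_borel_measure \<sigma>" "B \<in> sets borel \<Longrightarrow> emeasure \<sigma> B = emeasure \<pi> (A \<times> B)"
proof -
  interpret \<pi>: finite_measure \<pi> by fact
  have sp: "space \<pi> = UNIV" using s by (rule space_eq_UNIV_if_borel)
  have AU: "A \<times> UNIV \<in> sets \<pi>" using A unfolding s borel_prod[symmetric] by auto
  have m: "snd \<in> measurable (density \<pi> (indicator (A \<times> UNIV))) borel"
  proof -
    have "sets (density \<pi> (indicator (A \<times> UNIV))) = sets (borel \<Otimes>\<^sub>M borel)"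
      using s by (simp only: sets_density borel_prod)
    then show ?thesis using measurable_cong_sets measurable_snd by blast
  qed
  have *: "snd -` B = (UNIV \<times> B :: (real \<times> real) set)" for B by auto
  show e: "emeasure \<sigma> B = emeasure \<pi> (A \<times> B)" if B: "B \<in> sets borel" for B
  proof -
    have UB: "UNIV \<times> B \<in> sets \<pi>" "A \<times> B \<in> sets \<pi>" using A B unfolding s borel_prod[symmetric] by auto
    have "emeasure \<sigma> B = (\<integral>\<^sup>+z. indicator (A \<times> UNIV) z * indicator (UNIV \<times> B) z \<partial>\<pi>)"
      unfolding \<sigma>_def using m B UB AU sp by (simp add: emeasure_distr emeasure_density *)
    also have "\<dots> = (\<integral>\<^sup>+z. indicator (A \<times> B) z \<partial>\<pi>)"
      by (auto intro!: nn_integral_cong simp: indicator_def)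
    finally show ?thesis using UB by simp
  qed
  show "finite_borel_measure \<sigma>"
    unfolding finite_borel_measure_def finite_borel_measure_axioms_def
    using e[of UNIV] by (auto intro!: finite_measureI simp: \<sigma>_def)
qed

text \<open>For fixed \<open>A\<close> the half strips give the distribution function of the slice over
  \<open>A\<close>; so they determine the measure of all rectangles.\<close>

lemma measure_eqI_half_strips:
  assumes fin: "finite_measure M" "finite_measure N"
    and s: "sets M = sets (borel :: (real \<times> real) measure)" "sets N = sets (borel :: (real \<times> real) measure)"
    and eq: "\<And>A y. A \<in> sets borel \<Longrightarrow> measure M (A \<times> {..y}) = measure N (A \<times> {..y})"
  shows "M = N"
proof (rule measure_eqI_generator_eq)
  let ?E = "{a \<times> b |a b. a \<in> sets (borel :: real measure) \<and> b \<in> sets (borel :: real measure)}"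
  show "Int_stable ?E" by (rule Int_stable_pair_measure_generator)
  show "?E \<subseteq> Pow UNIV" by auto
  show "sets M = sigma_sets UNIV ?E" "sets N = sigma_sets UNIV ?E"
    unfolding s borel_prod[symmetric] sets_pair_measure by auto
  have "(UNIV :: (real \<times> real) set) = UNIV \<times> UNIV" by simp
  then have "(UNIV :: (real \<times> real) set) \<in> ?E"
    by (intro CollectI exI conjI) (assumption, simp_all)
  then show "range (\<lambda>_::nat. UNIV) \<subseteq> ?E" by (simp add: image_subset_iff)
  show "(\<Union>_::nat. UNIV) = (UNIV :: (real \<times> real) set)" by simp
  show "emeasure M UNIV \<noteq> \<infinity>" using fin(1) by (simp add: finite_measure.emeasure_finite)
  fix X assume "X \<in> ?E"
  then obtain A B where X: "X = A \<times> B" and A: "A \<in> sets borel" and B: "B \<in> sets borel" by auto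
  define p where "p P = distr (density P (indicator (A \<times> UNIV))) borel (snd :: real \<times> real \<Rightarrow> real)" for P
  note M = finite_measure_slice[OF fin(1) s(1) A, folded p_def]
  note N = finite_measure_slice[OF fin(2) s(2) A, folded p_def]
  have "p M = p N"
    using M N eq[OF A] by (intro cdf_unique') (auto simp: cdf_def fun_eq_iff measure_def)
  then show "emeasure M X = emeasure N X" unfolding X using M(2)[OF B] N(2)[OF B] by simp
qed

definition kernel_product :: "real measure \<Rightarrow> (real \<Rightarrow> real measure) \<Rightarrow> (real \<times> real) measure" where
  "kernel_product \<eta> K = measure_of UNIV (sets borel) (\<lambda>A. \<integral>\<^sup>+x. emeasure (K x) {y. (x, y) \<in> A} \<partial>\<eta>)"

lemma kernelD:
  assumes K: "K \<in> borel \<rightarrow>\<^sub>M prob_algebra (borel :: real measure)"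
  shows "prob_space (K x)" "sets (K x) = sets borel" "space (K x) = UNIV"
    "K \<in> borel \<rightarrow>\<^sub>M subprob_algebra borel"
proof -
  have "K x \<in> space (prob_algebra borel)" using measurable_space[OF K, of x] by simp
  then show "prob_space (K x)" and s: "sets (K x) = sets borel" by (simp_all add: space_prob_algebra)
  show "space (K x) = UNIV" using s by (rule space_eq_UNIV_if_borel)
  show "K \<in> borel \<rightarrow>\<^sub>M subprob_algebra borel" by (rule measurable_prob_algebraD[OF K])
qed

lemma kernel_slice:
  assumes K: "K \<in> borel \<rightarrow>\<^sub>M prob_algebra (borel :: real measure)" and s: "sets \<eta> = sets borel"
    and A: "A \<in> sets (borel :: (real \<times> real) measure)"
  shows "{y. (x, y) \<in> A} \<in> sets borel" "(\<lambda>x. emeasure (K x) {y. (x, y) \<in> A}) \<in> borel_measurable \<eta>"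
proof -
  have A': "A \<in> sets (borel \<Otimes>\<^sub>M borel)" using A unfolding borel_prod .
  have "Pair x -` A \<in> sets borel" by (rule sets_Pair1[OF A'])
  then show "{y. (x, y) \<in> A} \<in> sets borel" by (simp add: vimage_def)
  have "(SIGMA x:space (borel::real measure). {y. (x, y) \<in> A}) = A" by auto
  then have "(\<lambda>x. emeasure (K x) {y. (x, y) \<in> A}) \<in> borel_measurable borel"
    using A' by (intro emeasure_measurable_subprob_algebra2[OF _ kernelD(4)[OF K]]) simp
  then show "(\<lambda>x. emeasure (K x) {y. (x, y) \<in> A}) \<in> borel_measurable \<eta>"
    using s measurable_cong_sets by blast
qed

lemma kernel_product_props:
  assumes K: "K \<in> borel \<rightarrow>\<^sub>M prob_algebra (borel :: real measure)" and s: "sets \<eta> = sets borel"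
  shows sets_kernel_product: "sets (kernel_product \<eta> K) = sets borel"
    and emeasure_kernel_product: "A \<in> sets borel \<Longrightarrow>
      emeasure (kernel_product \<eta> K) A = (\<integral>\<^sup>+x. emeasure (K x) {y. (x, y) \<in> A} \<partial>\<eta>)"
    and emeasure_kernel_product_Times: "C \<in> sets borel \<Longrightarrow> B \<in> sets borel \<Longrightarrow>
      emeasure (kernel_product \<eta> K) (C \<times> B) = (\<integral>\<^sup>+x. indicator C x * emeasure (K x) B \<partial>\<eta>)"
proof -
  have cl: "sets (borel :: (real \<times> real) measure) \<subseteq> Pow UNIV" by auto
  interpret sigma_algebra UNIV "sets (borel :: (real \<times> real) measure)"
    using sets.sigma_algebra_axioms[of "borel :: (real \<times> real) measure"] by simp
  show "sets (kernel_product \<eta> K) = sets borel"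
    by (simp add: kernel_product_def)
  show e: "emeasure (kernel_product \<eta> K) A = (\<integral>\<^sup>+x. emeasure (K x) {y. (x, y) \<in> A} \<partial>\<eta>)"
    if A: "A \<in> sets borel" for A
    unfolding kernel_product_def
  proof (rule emeasure_measure_of_sigma[OF _ _ _ A])
    show "positive (sets borel) (\<lambda>A. \<integral>\<^sup>+x. emeasure (K x) {y. (x, y) \<in> A} \<partial>\<eta>)"
      by (simp add: positive_def)
    show "countably_additive (sets borel) (\<lambda>A. \<integral>\<^sup>+x. emeasure (K x) {y. (x, y) \<in> A} \<partial>\<eta>)"
    proof (rule countably_additiveI)
      fix A :: "nat \<Rightarrow> (real \<times> real) set"
      assume A: "range A \<subseteq> sets borel" "disjoint_family A" "\<Union> (range A) \<in> sets borel"
      have "(\<Sum>i. \<integral>\<^sup>+x. emeasure (K x) {y. (x, y) \<in> A i} \<partial>\<eta>) =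
          (\<integral>\<^sup>+x. (\<Sum>i. emeasure (K x) {y. (x, y) \<in> A i}) \<partial>\<eta>)"
        using A by (intro nn_integral_suminf[symmetric] kernel_slice[OF K s]) auto
      also have "\<dots> = (\<integral>\<^sup>+x. emeasure (K x) {y. (x, y) \<in> \<Union> (range A)} \<partial>\<eta>)"
      proof (intro nn_integral_cong)
        fix x
        have "(\<Sum>i. emeasure (K x) {y. (x, y) \<in> A i}) = emeasure (K x) (\<Union>i. {y. (x, y) \<in> A i})"
          using A kernelD[OF K] kernel_slice(1)[OF K s]
          by (intro suminf_emeasure) (auto simp: disjoint_family_on_def)
        also have "(\<Union>i. {y. (x, y) \<in> A i}) = {y. (x, y) \<in> \<Union> (range A)}" by auto
        finally show "(\<Sum>i. emeasure (K x) {y. (x, y) \<in> A i}) = emeasure (K x) {y. (x, y) \<in> \<Union> (range A)}" .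
      qed
      finally show "(\<Sum>i. \<integral>\<^sup>+x. emeasure (K x) {y. (x, y) \<in> A i} \<partial>\<eta>) =
        (\<integral>\<^sup>+x. emeasure (K x) {y. (x, y) \<in> \<Union> (range A)} \<partial>\<eta>)" .
    qed
  qed unfold_locales
  show "emeasure (kernel_product \<eta> K) (C \<times> B) = (\<integral>\<^sup>+x. indicator C x * emeasure (K x) B \<partial>\<eta>)"
    if C: "C \<in> sets borel" and B: "B \<in> sets borel"
  proof -
    have "C \<times> B \<in> sets borel" using C B unfolding borel_prod[symmetric] by auto
    then show ?thesis
      by (subst e) (auto intro!: nn_integral_cong simp: indicator_def)
  qed
qed

text \<open>The conditional distribution functions of \<open>y\<close> given \<open>x\<close> at rational
  levels are Radon-Nikodym densities. Almost everywhere they are monotone with the limits \<open>0\<close> and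
  \<open>1\<close>, so they define probability measures \<open>K x\<close>; the kernel \<open>K\<close>
  reproduces \<open>\<pi>\<close> because both give the same mass to half strips.\<close>

theorem disintegration_exists:
  assumes \<pi>: "\<pi> \<in> couplings \<eta> \<xi>" and fin: "finite_measure \<eta>"
  shows "\<exists>K. disintegrates \<eta> \<pi> K"
proof -
  note c = couplingsD[OF \<pi>]
  interpret \<eta>: finite_measure \<eta> by fact
  have fin\<pi>: "finite_measure \<pi>"
    using c(2,9) \<eta>.emeasure_finite[of UNIV] by (intro finite_measureI) simp
  interpret \<pi>: finite_measure \<pi> by fact
  have sp: "space \<eta> = UNIV" using c(7) by (rule space_eq_UNIV_if_borel)
  have "\<forall>q. \<exists>F. F \<in> borel_measurable borel \<and> (\<forall>x. 0 \<le> F x) \<and> integrable \<eta> F \<and>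
    (\<forall>A\<in>sets borel. (\<integral>x. indicator A x * F x \<partial>\<eta>) = measure \<pi> (A \<times> {..q}))"
    by (intro allI conditional_probability_exists[OF \<pi> fin]) simp
  from choice[OF this] obtain F where "\<forall>q. F q \<in> borel_measurable borel \<and> (\<forall>x. 0 \<le> F q x) \<and> integrable \<eta> (F q) \<and>
    (\<forall>A\<in>sets borel. (\<integral>x. indicator A x * F q x \<partial>\<eta>) = measure \<pi> (A \<times> {..q}))" ..
  then have Fm[measurable]: "\<And>q. F q \<in> borel_measurable borel" and F0: "\<And>q x. 0 \<le> F q x"
    and Fi: "\<And>q. integrable \<eta> (F q)"
    and FA: "\<And>q A. A \<in> sets borel \<Longrightarrow> (\<integral>x. indicator A x * F q x \<partial>\<eta>) = measure \<pi> (A \<times> {..q})"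
    by auto
  have mm: "f \<in> borel_measurable \<eta>" if "f \<in> borel_measurable borel" for f :: "real \<Rightarrow> real"
    using that c(7) measurable_cong_sets by blast
  define \<sigma> where "\<sigma> A = distr (density \<pi> (indicator (A \<times> UNIV))) borel (snd :: real \<times> real \<Rightarrow> real)" for A
  have \<sigma>: "finite_borel_measure (\<sigma> A)" "\<And>B. B \<in> sets borel \<Longrightarrow> measure (\<sigma> A) B = measure \<pi> (A \<times> B)"
    if "A \<in> sets borel" for A
    using finite_measure_slice[OF fin\<pi> c(1) that] by (auto simp: \<sigma>_def measure_def)
  have cdf\<sigma>: "cdf (\<sigma> A) q = measure \<pi> (A \<times> {..q})" if "A \<in> sets borel" for A q
    using \<sigma>(2)[OF that] by (simp add: cdf_def)
  have sp\<sigma>: "measure (\<sigma> A) (space (\<sigma> A)) = measure \<eta> A" if A: "A \<in> sets borel" for A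
    using \<sigma>(2)[OF A, of UNIV] emeasure_coupling_Times(1)[OF \<pi> A] by (simp add: \<sigma>_def measure_def)
  have ind: "integrable \<eta> (\<lambda>x. indicator A x * f x)" if "integrable \<eta> f" "A \<in> sets \<eta>" for A and f :: "real \<Rightarrow> real"
    using that by (auto intro: integrable_real_mult_indicator simp: mult.commute)
  have mono: "AE x in \<eta>. F q x \<le> F r x" if "q \<le> r" for q r
    using that finite_borel_measure.cdf_nondecreasing[OF \<sigma>(1)] c(7)
    by (intro AE_le_if_set_integral_le Fi) (auto simp: FA cdf\<sigma>[symmetric])
  have one: "AE x in \<eta>. F q x \<le> 1" for q
    using finite_borel_measure.cdf_bounded[OF \<sigma>(1)] c(7) sp
    by (intro AE_le_if_set_integral_le Fi) (auto simp: FA cdf\<sigma>[symmetric] sp\<sigma>)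
  \<comment> \<open>The limits of the conditional cdf at \<open>-\<infinity>\<close> and
    \<open>\<infinity>\<close>. A single density \<open>F q\<close> may exceed \<open>1\<close> on a null set,
    so it is cut off at \<open>1\<close> to keep the supremum finite at every point.\<close>
  define L where "L x = (INF n::nat. F (- real n) x)" for x
  define U where "U x = (SUP n::nat. min 1 (F (real n) x))" for x
  have [measurable]: "L \<in> borel_measurable borel" unfolding L_def by measurable
  have [measurable]: "U \<in> borel_measurable borel" 
    unfolding U_def by (intro borel_measurable_cSUP) (auto intro!: bdd_aboveI[where M=1])
  have L_le: "L x \<le> F (- real n) x" for n :: nat and x
    unfolding L_def using F0 by (intro cINF_lower) (auto intro!: bdd_belowI[where m=0])
  have L0: "0 \<le> L x" for x unfolding L_def using F0 by (intro cINF_greatest) auto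
  have U_ge: "min 1 (F (real n) x) \<le> U x" for n :: nat and x
    unfolding U_def by (intro cSUP_upper) (auto intro!: bdd_aboveI[where M=1])
  have U1: "U x \<le> 1" for x unfolding U_def by (intro cSUP_least) auto
  have U0: "0 \<le> U x" for x using U_ge[where n=0 and x=x] F0[of 0 x] by (auto simp: min_def split: if_splits)
  have Li: "integrable \<eta> L"
    using L0 L_le[where n=0] F0 by (intro Bochner_Integration.integrable_bound[OF Fi[of "- real 0"] mm]) (auto intro!: AE_I2)
  have Ui: "integrable \<eta> U"
    using U0 U1 by (intro \<eta>.integrable_const_bound[of _ 1] mm) (auto intro!: AE_I2)
  have bot: "AE x in \<eta>. L x \<le> 0"
  proof (rule AE_le_if_set_integral_le[OF Li])
    fix A assume A: "A \<in> sets \<eta>"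
    then have Ab: "A \<in> sets borel" using c(7) by simp
    have "(\<integral>x. indicator A x * L x \<partial>\<eta>) \<le> cdf (\<sigma> A) (- real n)" for n
      unfolding cdf\<sigma>[OF Ab] FA[OF Ab, symmetric]
      using A Li Fi L_le by (intro integral_mono ind mult_left_mono) auto
    then have "(\<integral>x. indicator A x * L x \<partial>\<eta>) \<le> 0"
      by (intro LIMSEQ_le_const[OF finite_borel_measure.cdf_lim_neg_infty[OF \<sigma>(1)[OF Ab]]]) auto
    then show "(\<integral>x. indicator A x * L x \<partial>\<eta>) \<le> (\<integral>x. indicator A x * 0 \<partial>\<eta>)" by simp
  qed simp
  have top: "AE x in \<eta>. 1 \<le> U x"
  proof (rule AE_le_if_set_integral_le[OF _ Ui])
    fix A assume A: "A \<in> sets \<eta>"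
    then have Ab: "A \<in> sets borel" using c(7) by simp
    have "cdf (\<sigma> A) (real n) \<le> (\<integral>x. indicator A x * U x \<partial>\<eta>)" for n
      unfolding cdf\<sigma>[OF Ab] FA[OF Ab, symmetric]
    proof (rule integral_mono_AE[OF ind[OF Fi A] ind[OF Ui A]])
      show "AE x in \<eta>. indicator A x * F (real n) x \<le> indicator A x * U x"
        using one[of "real n"]
      proof eventually_elim
        case (elim x)
        then have "F (real n) x \<le> U x" using U_ge[of n x] by (simp only: min_absorb2)
        then show ?case by (simp add: indicator_def)
      qed
    qed
    then have "measure \<eta> A \<le> (\<integral>x. indicator A x * U x \<partial>\<eta>)"
      unfolding sp\<sigma>[OF Ab, symmetric]
      by (intro LIMSEQ_le_const2[OF finite_borel_measure.cdf_lim_infty[OF \<sigma>(1)[OF Ab]]]) auto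
    then show "(\<integral>x. indicator A x * 1 \<partial>\<eta>) \<le> (\<integral>x. indicator A x * U x \<partial>\<eta>)" using A sp by simp
  qed simp
  \<comment> \<open>Only countably many conditions, because \<open>q\<close> and \<open>r\<close> are rational:
    one null set takes care of all of them.\<close>
  have "AE x in \<eta>. (\<forall>q\<in>\<rat>. \<forall>r\<in>\<rat>. q \<le> r \<longrightarrow> F q x \<le> F r x) \<and> (\<forall>q\<in>\<rat>. F q x \<le> 1) \<and> L x \<le> 0 \<and> 1 \<le> U x"
    using mono one bot top
    by (intro AE_conjI) (auto intro!: AE_ball_countable[OF countable_rat, THEN iffD2] simp: AE_ball_countable countable_rat)
  then obtain N where N: "N \<in> null_sets \<eta>"
    and good: "\<And>x. x \<notin> N \<Longrightarrow> (\<forall>q\<in>\<rat>. \<forall>r\<in>\<rat>. q \<le> r \<longrightarrow> F q x \<le> F r x) \<and> (\<forall>q\<in>\<rat>. F q x \<le> 1) \<and> L x \<le> 0 \<and> 1 \<le> U x"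
    unfolding eventually_ae_filter using sp by blast
  have Nb[measurable]: "N \<in> sets borel" using N c(7) by auto
  define G where "G x y = (INF q\<in>{q\<in>\<rat>. y < q}. F q x)" for x y
  \<comment> \<open>On the exceptional null set any probability measure will do; the kernel has to be Markov at
    every point.\<close>
  define K where "K x = (if x \<in> N then return borel 0 else interval_measure (G x))" for x
  have cr: "countable {q::real\<in>\<rat>. y < q}" for y using countable_rat by (rule countable_subset[rotated]) auto
  have [measurable]: "(\<lambda>x. G x y) \<in> borel_measurable borel" for y
    unfolding G_def by (intro borel_measurable_cINF_real cr Fm)
  have K1: "real_distribution (interval_measure (G x))" and K2: "cdf (interval_measure (G x)) = G x" if x: "x \<notin> N" for x
  proof -
    have L: "L x = 0" using good[OF x] L0[of x] by auto
    have "(SUP n::nat. F (real n) x) = U x"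
      unfolding U_def using good[OF x] by (intro SUP_cong refl) (simp add: min_absorb2)
    then have U: "(SUP n::nat. F (real n) x) = 1" using good[OF x] U1[of x] by auto
    show "real_distribution (interval_measure (G x))" "cdf (interval_measure (G x)) = G x"
      using cdf_of_rational_values[of "\<lambda>q. F q x"] good[OF x] F0 L U unfolding L_def G_def by auto
  qed
  have Kp: "prob_space (K x)" "sets (K x) = sets borel" for x
    using K1[of x] by (auto simp: K_def real_distribution_def intro!: prob_space_return)
  have Ky: "emeasure (K x) {..y} = (if x \<in> N then indicator {..y} 0 else ennreal (G x y))" for x y
  proof -
    interpret prob_space "K x" by (rule Kp)
    show ?thesis
    proof (cases "x \<in> N")
      case False
      then have "measure (K x) {..y} = G x y" using fun_cong[OF K2[OF False], of y] by (simp add: K_def cdf_def)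
      then show ?thesis using False by (simp add: emeasure_eq_measure)
    qed (simp add: K_def)
  qed
  have K: "K \<in> borel \<rightarrow>\<^sub>M prob_algebra borel"
  proof (intro measurable_prob_algebraI Kp measurable_subprob_algebra_generated)
    show "sets (borel :: real measure) = sigma_sets UNIV (range atMost)"
      by (simp add: borel_eq_atMost)
    show "Int_stable (range (atMost :: real \<Rightarrow> _))" by (auto simp: Int_stable_def)
    show "subprob_space (K x)" for x using Kp(1) by (rule prob_space_imp_subprob_space)
    show "(\<lambda>x. emeasure (K x) A) \<in> borel_measurable borel" if "A \<in> range atMost" for A
      using that by (auto simp: Ky)
    have "emeasure (K x) UNIV = 1" for x
      using prob_space.emeasure_space_1[OF Kp(1)] space_eq_UNIV_if_borel[OF Kp(2)] by metis
    then show "(\<lambda>x. emeasure (K x) UNIV) \<in> borel_measurable borel" by simp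
  qed (use Kp in auto)
  note kp = kernel_product_props[OF K c(7)]
  have fink: "finite_measure (kernel_product \<eta> K)"
  proof (rule finite_measureI)
    have "emeasure (kernel_product \<eta> K) (UNIV \<times> UNIV) = (\<integral>\<^sup>+x. 1 \<partial>\<eta>)"
      using prob_space.emeasure_space_1[OF Kp(1)] space_eq_UNIV_if_borel[OF Kp(2)]
      by (subst kp(3)) (auto intro!: nn_integral_cong)
    then show "emeasure (kernel_product \<eta> K) (space (kernel_product \<eta> K)) \<noteq> \<infinity>"
      using \<eta>.emeasure_finite space_eq_UNIV_if_borel[OF kp(1)] by (simp add: sp)
  qed
  have eq: "\<pi> = kernel_product \<eta> K"
  proof (rule measure_eqI_half_strips[OF fin\<pi> fink c(1) kp(1)])
    fix A :: "real set" and y :: real assume A: "A \<in> sets borel"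
    then have A\<eta>: "A \<in> sets \<eta>" using c(7) by simp
    have AEN: "AE x in \<eta>. x \<notin> N" using N by (rule AE_not_in)
    have G0: "0 \<le> G x y" for x
    proof -
      have "{q\<in>\<rat>. y < q} \<noteq> {}" using Rats_dense_in_real[of y "y + 1"] by auto
      then show ?thesis unfolding G_def using F0 by (intro cINF_greatest) auto
    qed
    have Gle: "G x y \<le> F q x" if "q \<in> \<rat>" "y < q" for q x
      unfolding G_def using that F0 by (intro cINF_lower) (auto intro!: bdd_belowI[where m=0])
    obtain q0 where q0: "q0 \<in> \<rat>" "y < q0" using Rats_dense_in_real[of y "y + 1"] by auto
    have Gi: "integrable \<eta> (\<lambda>x. G x y)"
      using G0 Gle[OF q0] F0 by (intro Bochner_Integration.integrable_bound[OF Fi[of q0] mm]) (auto intro!: AE_I2)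
    have "emeasure (kernel_product \<eta> K) (A \<times> {..y}) = (\<integral>\<^sup>+x. ennreal (indicator A x * G x y) \<partial>\<eta>)"
      using AEN by (subst kp(3)[OF A]) (auto intro!: nn_integral_cong_AE simp: Ky indicator_def elim!: eventually_mono)
    also have "\<dots> = ennreal (\<integral>x. indicator A x * G x y \<partial>\<eta>)"
      using G0 by (intro nn_integral_eq_integral ind[OF Gi A\<eta>]) auto
    finally have m: "measure (kernel_product \<eta> K) (A \<times> {..y}) = (\<integral>x. indicator A x * G x y \<partial>\<eta>)"
      using G0 by (simp add: measure_def integral_nonneg_AE)
    \<comment> \<open>\<open>G x y\<close> is squeezed between the density at the possibly irrational level
      \<open>y\<close> and the densities at the rational levels above it; right continuity of \<open>cdf
      (\<sigma> A)\<close> closes the gap.\<close>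
    have le: "(\<integral>x. indicator A x * G x y \<partial>\<eta>) \<le> cdf (\<sigma> A) q" if "q \<in> \<rat>" "y < q" for q
      unfolding cdf\<sigma>[OF A] FA[OF A, symmetric]
      using Gle[OF that] by (intro integral_mono ind[OF Gi A\<eta>] ind[OF Fi A\<eta>] mult_left_mono) auto
    have "(\<integral>x. indicator A x * G x y \<partial>\<eta>) \<le> cdf (\<sigma> A) y"
    proof (rule ccontr)
      assume "\<not> (\<integral>x. indicator A x * G x y \<partial>\<eta>) \<le> cdf (\<sigma> A) y"
      then have *: "cdf (\<sigma> A) y < (\<integral>x. indicator A x * G x y \<partial>\<eta>)" by simp
      have "(cdf (\<sigma> A) \<longlongrightarrow> cdf (\<sigma> A) y) (at_right y)"
        using finite_borel_measure.cdf_is_right_cont[OF \<sigma>(1)[OF A]] by (simp add: continuous_within)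
      from order_tendstoD(2)[OF this *]
      obtain b where b: "y < b" "\<And>z. y < z \<Longrightarrow> z < b \<Longrightarrow> cdf (\<sigma> A) z < (\<integral>x. indicator A x * G x y \<partial>\<eta>)"
        unfolding eventually_at_right[OF less_add_one] by auto
      obtain q where "q \<in> \<rat>" "y < q" "q < b" using Rats_dense_in_real[OF b(1)] by auto
      then show False using le[of q] b(2)[of q] by auto
    qed
    moreover have "cdf (\<sigma> A) y \<le> (\<integral>x. indicator A x * G x y \<partial>\<eta>)"
      unfolding cdf\<sigma>[OF A] FA[OF A, symmetric]
    proof (rule integral_mono_AE[OF ind[OF Fi A\<eta>] ind[OF Gi A\<eta>]])
      have "AE x in \<eta>. \<forall>q\<in>{q\<in>\<rat>. y < q}. F y x \<le> F q x"
        unfolding AE_ball_countable[OF cr] using mono by auto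
      then show "AE x in \<eta>. indicator A x * F y x \<le> indicator A x * G x y"
      proof eventually_elim
        case (elim x)
        then have "F y x \<le> G x y" unfolding G_def using q0 by (intro cINF_greatest) auto
        then show ?case by (auto simp: indicator_def)
      qed
    qed
    ultimately show "measure \<pi> (A \<times> {..y}) = measure (kernel_product \<eta> K) (A \<times> {..y})"
      using m cdf\<sigma>[OF A] by simp
  qed
  show ?thesis
    unfolding disintegrates_def
  proof (intro exI[of _ K] conjI ballI K)
    show "emeasure \<pi> A = (\<integral>\<^sup>+ x. emeasure (K x) {y. (x, y) \<in> A} \<partial>\<eta>)" if "A \<in> sets borel" for A
      unfolding eq by (rule kp(2)[OF that])
  qed
qed

lemma disintegrates_disint:
  assumes "\<pi> \<in> couplings \<eta> \<xi>" "finite_measure \<eta>"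
  shows "disintegrates \<eta> \<pi> (disint \<eta> \<pi>)"
  unfolding disint_def using disintegration_exists[OF assms] by (rule someI_ex)

lemma nn_integral_disintegrates:
  fixes f :: "real \<times> real \<Rightarrow> ennreal"
  assumes K: "disintegrates \<eta> \<pi> K" and s: "sets \<eta> = sets borel" "sets \<pi> = sets borel"
    and f: "f \<in> borel_measurable borel"
  shows "(\<lambda>x. \<integral>\<^sup>+y. f (x, y) \<partial>K x) \<in> borel_measurable borel"
    and "(\<integral>\<^sup>+z. f z \<partial>\<pi>) = (\<integral>\<^sup>+x. \<integral>\<^sup>+y. f (x, y) \<partial>K x \<partial>\<eta>)"
proof -
  have Kb: "K \<in> borel \<rightarrow>\<^sub>M prob_algebra borel"
    and KA: "\<And>A. A \<in> sets borel \<Longrightarrow> emeasure \<pi> A = (\<integral>\<^sup>+ x. emeasure (K x) {y. (x, y) \<in> A} \<partial>\<eta>)"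
    using K by (auto simp: disintegrates_def)
  note k = kernelD[OF Kb]
  have fx: "(\<lambda>y. u (x, y)) \<in> borel_measurable (K x)" if u: "u \<in> borel_measurable borel" for u :: "real \<times> real \<Rightarrow> ennreal" and x
  proof -
    have "(\<lambda>y. u (x, y)) \<in> borel_measurable borel"
      using u unfolding borel_prod[symmetric] by (rule measurable_Pair2) simp
    then show ?thesis using k(2)[of x] measurable_cong_sets by blast
  qed
  have m: "(\<lambda>x. \<integral>\<^sup>+y. u (x, y) \<partial>K x) \<in> borel_measurable borel" if "u \<in> borel_measurable borel" for u :: "real \<times> real \<Rightarrow> ennreal"
    using that unfolding borel_prod[symmetric]
    by (intro nn_integral_measurable_subprob_algebra2[OF _ k(4)]) simp
  then have m\<eta>: "(\<lambda>x. \<integral>\<^sup>+y. u (x, y) \<partial>K x) \<in> borel_measurable \<eta>" if "u \<in> borel_measurable borel" for u :: "real \<times> real \<Rightarrow> ennreal"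
    using that s(1) measurable_cong_sets by blast
  have m\<pi>: "u \<in> borel_measurable \<pi>" if "u \<in> borel_measurable borel" for u :: "real \<times> real \<Rightarrow> ennreal"
    using that s(2) measurable_cong_sets by blast
  show "(\<lambda>x. \<integral>\<^sup>+y. f (x, y) \<partial>K x) \<in> borel_measurable borel" using m[OF f] .
  show "(\<integral>\<^sup>+z. f z \<partial>\<pi>) = (\<integral>\<^sup>+x. \<integral>\<^sup>+y. f (x, y) \<partial>K x \<partial>\<eta>)"
    using f
  proof (induction rule: borel_measurable_induct)
    case (cong f g)
    then have "f = g" by auto
    then show ?case using cong by simp
  next
    case (set A)
    have "(\<integral>\<^sup>+x. \<integral>\<^sup>+y. indicator A (x, y) \<partial>K x \<partial>\<eta>) = (\<integral>\<^sup>+ x. emeasure (K x) {y. (x, y) \<in> A} \<partial>\<eta>)"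
    proof (intro nn_integral_cong)
      fix x
      have "(\<integral>\<^sup>+y. indicator A (x, y) \<partial>K x) = (\<integral>\<^sup>+y. indicator {y. (x, y) \<in> A} y \<partial>K x)"
        by (intro nn_integral_cong) (auto simp: indicator_def)
      then show "(\<integral>\<^sup>+y. indicator A (x, y) \<partial>K x) = emeasure (K x) {y. (x, y) \<in> A}"
        using kernel_slice(1)[OF Kb s(1) set, of x] k(2)[of x] by simp
    qed
    then show ?case using KA[OF set] set s(2) by simp
  next
    case (mult u c)
    then show ?case by (simp add: nn_integral_cmult fx m\<eta> m\<pi>)
  next
    case (add u v)
    then show ?case by (simp add: nn_integral_add fx m\<eta> m\<pi>)
  next
    case (seq U)
    have eq: "\<Squnion> (range U) = (\<lambda>x. SUP i. U i x)"
      by (auto simp: fun_eq_iff image_comp)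
    have inc: "incseq (\<lambda>i x. \<integral>\<^sup>+y. U i (x, y) \<partial>K x)" "incseq (\<lambda>i y. U i (x, y))" for x
      using seq(3) by (auto intro!: nn_integral_mono simp: incseq_def le_fun_def)
    have "integral\<^sup>N \<pi> (\<Squnion> (range U)) = (SUP i. \<integral>\<^sup>+z. U i z \<partial>\<pi>)"
      unfolding eq using seq by (intro nn_integral_monotone_convergence_SUP m\<pi>) auto
    also have "\<dots> = (SUP i. \<integral>\<^sup>+x. \<integral>\<^sup>+y. U i (x, y) \<partial>K x \<partial>\<eta>)" using seq by simp
    also have "\<dots> = (\<integral>\<^sup>+x. (SUP i. \<integral>\<^sup>+y. U i (x, y) \<partial>K x) \<partial>\<eta>)"
      using seq by (intro nn_integral_monotone_convergence_SUP[symmetric] inc m\<eta>) auto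
    also have "\<dots> = (\<integral>\<^sup>+x. \<integral>\<^sup>+y. (SUP i. U i (x, y)) \<partial>K x \<partial>\<eta>)"
      using seq by (intro nn_integral_cong nn_integral_monotone_convergence_SUP[symmetric] inc fx) auto
    finally show ?case unfolding eq .
  qed
qed

section \<open>Conditional means\<close>

text \<open>The conditional expectation of \<open>y\<close> given \<open>x\<close> under \<open>\<pi>\<close>.
  The cost and the classes of couplings depend on the disintegration only through this function, and later
  arguments use it only through its characterisation by bounded test functions.\<close>

definition cond_mean :: "real measure \<Rightarrow> (real \<times> real) measure \<Rightarrow> real \<Rightarrow> real" where
  "cond_mean \<eta> \<pi> x = (\<integral>y. y \<partial>disint \<eta> \<pi> x)"

lemma borel_measurable_fst_real: "(f :: real \<Rightarrow> 'b::topological_space) \<in> borel_measurable borel \<Longrightarrow> (\<lambda>z :: real \<times> real. f (fst z)) \<in> borel_measurable borel"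
  and borel_measurable_snd_real: "(f :: real \<Rightarrow> 'b::topological_space) \<in> borel_measurable borel \<Longrightarrow> (\<lambda>z :: real \<times> real. f (snd z)) \<in> borel_measurable borel"
  unfolding borel_prod[symmetric]
  by (auto intro: measurable_compose[OF measurable_fst] measurable_compose[OF measurable_snd])

text \<open>Positive and negative part of \<open>h x * y\<close> are disintegrated separately; both inner
  integrals are finite for almost every \<open>x\<close> because \<open>y\<close> is integrable.\<close>

lemma cond_mean_props:
  assumes \<pi>: "\<pi> \<in> couplings \<eta> \<xi>" and fin: "finite_measure \<eta>" and int: "integrable \<pi> snd"
  shows borel_measurable_cond_mean: "cond_mean \<eta> \<pi> \<in> borel_measurable borel"
    and integrable_cond_mean: "integrable \<eta> (cond_mean \<eta> \<pi>)"
    and integral_cond_mean: "\<And>h. h \<in> borel_measurable borel \<Longrightarrow> (\<And>x. \<bar>h x\<bar> \<le> 1) \<Longrightarrow>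
      (\<integral>x. h x * cond_mean \<eta> \<pi> x \<partial>\<eta>) = (\<integral>z. h (fst z) * snd z \<partial>\<pi>)"
proof -
  note c = couplingsD[OF \<pi>]
  define K where "K = disint \<eta> \<pi>"
  have K: "disintegrates \<eta> \<pi> K" unfolding K_def by (rule disintegrates_disint[OF \<pi> fin])
  then have Kb: "K \<in> borel \<rightarrow>\<^sub>M prob_algebra borel" by (auto simp: disintegrates_def)
  note k = kernelD[OF Kb]
  have m_def: "cond_mean \<eta> \<pi> = (\<lambda>x. \<integral>y. y \<partial>K x)" by (simp add: cond_mean_def K_def fun_eq_iff)
  show mb: "cond_mean \<eta> \<pi> \<in> borel_measurable borel"
    unfolding m_def by (rule measurable_compose[OF k(4) integral_measurable_subprob_algebra]) simp
  have idK: "f \<in> borel_measurable (K x)" if "f \<in> borel_measurable borel" for x and f :: "real \<Rightarrow> real"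
    using that k(2)[of x] measurable_cong_sets by blast
  have mb\<eta>: "f \<in> borel_measurable \<eta>" if "f \<in> borel_measurable borel" for f :: "real \<Rightarrow> 'c::topological_space"
    using that c(7) measurable_cong_sets by blast
  have nb: "(\<lambda>z :: real \<times> real. ennreal \<bar>snd z\<bar>) \<in> borel_measurable borel"
    by (rule borel_measurable_snd_real) simp
  note N = nn_integral_disintegrates[OF K c(7,1) nb]
  have fin1: "(\<integral>\<^sup>+x. \<integral>\<^sup>+y. ennreal \<bar>y\<bar> \<partial>K x \<partial>\<eta>) < \<infinity>"
    using int N(2) by (simp add: integrable_iff_bounded)
  have AEK: "AE x in \<eta>. (\<integral>\<^sup>+y. ennreal \<bar>y\<bar> \<partial>K x) \<noteq> \<infinity>"
    using fin1 N(1) by (intro nn_integral_PInf_AE mb\<eta>) auto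
  have intK: "integrable (K x) (\<lambda>y. y)" if "(\<integral>\<^sup>+y. ennreal \<bar>y\<bar> \<partial>K x) \<noteq> \<infinity>" for x
    using that idK[of "\<lambda>y. y"] by (simp add: integrable_iff_bounded less_top)
  have absm: "ennreal \<bar>cond_mean \<eta> \<pi> x\<bar> \<le> (\<integral>\<^sup>+y. ennreal \<bar>y\<bar> \<partial>K x)" for x
  proof (cases "integrable (K x) (\<lambda>y. y)")
    case True
    then show ?thesis using integral_norm_bound_ennreal[OF True] by (simp add: m_def)
  qed (simp add: m_def not_integrable_integral_eq)
  show "integrable \<eta> (cond_mean \<eta> \<pi>)"
    using mb\<eta>[OF mb] le_less_trans[OF nn_integral_mono[OF absm] fin1] by (simp add: integrable_iff_bounded)
  fix h :: "real \<Rightarrow> real" assume hb[measurable]: "h \<in> borel_measurable borel" and h1: "\<And>x. \<bar>h x\<bar> \<le> 1"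
  have hi: "integrable \<pi> (\<lambda>z. h (fst z) * snd z)"
  proof (rule Bochner_Integration.integrable_bound[OF int])
    have "(\<lambda>z. h (fst z) * snd z) \<in> borel_measurable borel"
      unfolding borel_prod[symmetric] by measurable
    then show "(\<lambda>z. h (fst z) * snd z) \<in> borel_measurable \<pi>" using c(1) measurable_cong_sets by blast
    show "AE z in \<pi>. norm (h (fst z) * snd z) \<le> norm (snd z)"
      using h1 by (auto simp: abs_mult mult_left_le_one_le)
  qed
  define p where "p s x = (\<integral>\<^sup>+y. ennreal (s * (h x * y)) \<partial>K x)" for s x
  have pb: "(\<lambda>z :: real \<times> real. ennreal (s * (h (fst z) * snd z))) \<in> borel_measurable borel" for s
    unfolding borel_prod[symmetric] by measurable
  have pm[measurable]: "p s \<in> borel_measurable borel" and pi: "(\<integral>\<^sup>+z. ennreal (s * (h (fst z) * snd z)) \<partial>\<pi>) = (\<integral>\<^sup>+x. p s x \<partial>\<eta>)" for s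
    using nn_integral_disintegrates[OF K c(7,1) pb[of s]] by (simp_all add: p_def[abs_def])
  have pfin: "p s x < \<infinity>" if "\<bar>s\<bar> \<le> 1" "(\<integral>\<^sup>+y. ennreal \<bar>y\<bar> \<partial>K x) \<noteq> \<infinity>" for s x
  proof -
    have "p s x \<le> (\<integral>\<^sup>+y. ennreal \<bar>y\<bar> \<partial>K x)"
      unfolding p_def
    proof (intro nn_integral_mono ennreal_leI)
      fix y
      have "\<bar>s * (h x * y)\<bar> \<le> 1 * (1 * \<bar>y\<bar>)"
        unfolding abs_mult using that(1) h1[of x] by (intro mult_mono) auto
      then show "s * (h x * y) \<le> \<bar>y\<bar>" by simp
    qed
    then show ?thesis using that(2) by (auto simp: less_top[symmetric] top_unique)
  qed
  have ppi: "integrable \<eta> (\<lambda>x. enn2real (p s x))" "(\<integral>x. enn2real (p s x) \<partial>\<eta>) = enn2real (\<integral>\<^sup>+z. ennreal (s * (h (fst z) * snd z)) \<partial>\<pi>)"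
    if s: "\<bar>s\<bar> \<le> 1" for s
  proof -
    have e: "(\<integral>\<^sup>+x. ennreal (enn2real (p s x)) \<partial>\<eta>) = (\<integral>\<^sup>+x. p s x \<partial>\<eta>)"
    proof (rule nn_integral_cong_AE)
      show "AE x in \<eta>. ennreal (enn2real (p s x)) = p s x"
        using AEK by eventually_elim (use pfin[OF s] in auto)
    qed
    have "(\<integral>\<^sup>+x. p s x \<partial>\<eta>) \<le> (\<integral>\<^sup>+z. ennreal \<bar>snd z\<bar> \<partial>\<pi>)"
      unfolding pi[symmetric]
    proof (intro nn_integral_mono ennreal_leI)
      fix z :: "real \<times> real"
      have "\<bar>s * (h (fst z) * snd z)\<bar> \<le> 1 * (1 * \<bar>snd z\<bar>)"
        unfolding abs_mult using s h1[of "fst z"] by (intro mult_mono) auto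
      then show "s * (h (fst z) * snd z) \<le> \<bar>snd z\<bar>" by simp
    qed
    also have "\<dots> < \<infinity>" using int by (simp add: integrable_iff_bounded)
    finally show "integrable \<eta> (\<lambda>x. enn2real (p s x))" using e by (simp add: integrable_iff_bounded mb\<eta>)
    show "(\<integral>x. enn2real (p s x) \<partial>\<eta>) = enn2real (\<integral>\<^sup>+z. ennreal (s * (h (fst z) * snd z)) \<partial>\<pi>)"
      unfolding pi e[symmetric] by (intro integral_eq_nn_integral) (auto simp: mb\<eta>)
  qed
  have "(\<integral>x. h x * cond_mean \<eta> \<pi> x \<partial>\<eta>) = (\<integral>x. enn2real (p 1 x) - enn2real (p (-1) x) \<partial>\<eta>)"
  proof (rule integral_cong_AE)
    show "AE x in \<eta>. h x * cond_mean \<eta> \<pi> x = enn2real (p 1 x) - enn2real (p (- 1) x)"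
      using AEK
    proof eventually_elim
      case (elim x)
      have "h x * cond_mean \<eta> \<pi> x = (\<integral>y. h x * y \<partial>K x)" by (simp add: m_def)
      moreover have "integrable (K x) (\<lambda>y. h x * y)" using intK[OF elim] by simp
      ultimately show ?case by (simp only: real_lebesgue_integral_def p_def) simp
    qed
    show "(\<lambda>x. h x * cond_mean \<eta> \<pi> x) \<in> borel_measurable \<eta>" using mb by (intro mb\<eta>) simp
    show "(\<lambda>x. enn2real (p 1 x) - enn2real (p (- 1) x)) \<in> borel_measurable \<eta>" by (intro mb\<eta>) simp
  qed
  also have "\<dots> = (\<integral>z. h (fst z) * snd z \<partial>\<pi>)"
    using ppi[of 1] ppi[of "-1"] hi by (simp add: real_lebesgue_integral_def)
  finally show "(\<integral>x. h x * cond_mean \<eta> \<pi> x \<partial>\<eta>) = (\<integral>z. h (fst z) * snd z \<partial>\<pi>)" .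
qed

lemma cond_mean_unique:
  assumes \<pi>: "\<pi> \<in> couplings \<eta> \<xi>" and fin: "finite_measure \<eta>" and int: "integrable \<pi> snd"
    and g: "g \<in> borel_measurable borel" "integrable \<eta> g"
    and eq: "\<And>h. h \<in> borel_measurable borel \<Longrightarrow> (\<And>x. \<bar>h x\<bar> \<le> 1) \<Longrightarrow>
      (\<integral>x. h x * g x \<partial>\<eta>) = (\<integral>z. h (fst z) * snd z \<partial>\<pi>)"
  shows "AE x in \<eta>. cond_mean \<eta> \<pi> x = g x"
proof -
  note cm = cond_mean_props[OF \<pi> fin int] and c = couplingsD[OF \<pi>]
  have "(\<integral>x. indicator A x * g x \<partial>\<eta>) = (\<integral>x. indicator A x * cond_mean \<eta> \<pi> x \<partial>\<eta>)" if "A \<in> sets \<eta>" for A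
    using that c(7) by (subst eq) (auto simp: cm(3) indicator_def)
  then have "AE x in \<eta>. cond_mean \<eta> \<pi> x \<le> g x" "AE x in \<eta>. g x \<le> cond_mean \<eta> \<pi> x"
    by (auto intro!: AE_le_if_set_integral_le g cm)
  then show ?thesis by eventually_elim auto
qed

lemma fin_measD:
  assumes "\<eta> \<in> fin_meas"
  shows "sets \<eta> = sets borel" "space \<eta> = UNIV" "finite_measure \<eta>" "integrable \<eta> (\<lambda>x. x)"
    "integrable \<eta> (\<lambda>x. c :: real)" "integrable \<eta> (\<lambda>x. max (k - x) 0)" "integrable \<eta> (\<lambda>x. max (x - k) 0)"
proof -
  show s: "sets \<eta> = sets borel" and fin: "finite_measure \<eta>" using assms by (auto simp: fin_meas_def)
  show "space \<eta> = UNIV" using s by (rule space_eq_UNIV_if_borel)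
  interpret finite_measure \<eta> by fact
  have "integrable \<eta> (\<lambda>x. \<bar>x\<bar>)" using assms by (auto simp: fin_meas_def)
  have m: "(\<lambda>x. x) \<in> borel_measurable \<eta>" by (rule measurable_if_sets_borel[OF s]) simp
  show i: "integrable \<eta> (\<lambda>x. x)"
    by (rule integrable_abs_iff[OF m, THEN iffD1]) fact
  show "integrable \<eta> (\<lambda>x. c)" by (rule integrable_const)
  show "integrable \<eta> (\<lambda>x. max (k - x) 0)" "integrable \<eta> (\<lambda>x. max (x - k) 0)"
    using i by (auto intro!: integrable_max)
qed

lemma
  fixes f :: "real \<Rightarrow> real"
  assumes \<pi>: "\<pi> \<in> couplings \<eta> \<xi>" and f: "f \<in> borel_measurable borel"
  shows integral_coupling_fst: "(\<integral>z. f (fst z) \<partial>\<pi>) = (\<integral>x. f x \<partial>\<eta>)"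
    and integrable_coupling_fst: "integrable \<pi> (\<lambda>z. f (fst z)) \<longleftrightarrow> integrable \<eta> f"
    and integral_coupling_snd: "(\<integral>z. f (snd z) \<partial>\<pi>) = (\<integral>x. f x \<partial>\<xi>)"
    and integrable_coupling_snd: "integrable \<pi> (\<lambda>z. f (snd z)) \<longleftrightarrow> integrable \<xi> f"
proof -
  note c = couplingsD[OF \<pi>]
  show "(\<integral>z. f (fst z) \<partial>\<pi>) = (\<integral>x. f x \<partial>\<eta>)"
    unfolding c(5)[symmetric] using c(3) f by (rule integral_distr[symmetric])
  show "integrable \<pi> (\<lambda>z. f (fst z)) \<longleftrightarrow> integrable \<eta> f"
    unfolding c(5)[symmetric] using c(3) f by (rule integrable_distr_eq[symmetric])
  show "(\<integral>z. f (snd z) \<partial>\<pi>) = (\<integral>x. f x \<partial>\<xi>)"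
    unfolding c(6)[symmetric] using c(4) f by (rule integral_distr[symmetric])
  show "integrable \<pi> (\<lambda>z. f (snd z)) \<longleftrightarrow> integrable \<xi> f"
    unfolding c(6)[symmetric] using c(4) f by (rule integrable_distr_eq[symmetric])
qed

lemma AE_fst_if_AE:
  assumes \<pi>: "\<pi> \<in> couplings \<eta> \<xi>" and "AE x in \<eta>. P x"
  shows "AE z in \<pi>. P (fst z)"
  using assms(2) unfolding couplingsD(5)[OF \<pi>, symmetric] by (rule AE_distrD[OF couplingsD(3)[OF \<pi>]])

lemma integrable_coupling:
  assumes \<pi>: "\<pi> \<in> couplings \<eta> \<xi>" and "\<eta> \<in> fin_meas" "\<xi> \<in> fin_meas"
  shows "finite_measure \<pi>" "integrable \<pi> fst" "integrable \<pi> snd"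
proof -
  show "finite_measure \<pi>"
    using couplingsD(2,9)[OF \<pi>] finite_measure.emeasure_finite[OF fin_measD(3)[OF assms(2)], of UNIV]
    by (intro finite_measureI) simp
  have m: "(\<lambda>x. x) \<in> borel_measurable (borel :: real measure)" by simp
  show "integrable \<pi> fst"
    by (rule integrable_coupling_fst[OF \<pi> m, THEN iffD2, OF fin_measD(4)[OF assms(2)]])
  show "integrable \<pi> snd"
    by (rule integrable_coupling_snd[OF \<pi> m, THEN iffD2, OF fin_measD(4)[OF assms(3)]])
qed

lemma measure_coupling:
  assumes \<pi>: "\<pi> \<in> couplings \<eta> \<xi>"
  shows "measure \<xi> UNIV = measure \<eta> UNIV"
proof -
  note c = couplingsD[OF \<pi>]
  have "measure \<xi> UNIV = measure \<pi> UNIV"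
    unfolding c(6)[symmetric] using c(2,4) by (simp add: measure_distr)
  then show ?thesis unfolding measure_def c(9) .
qed

lemma cond_mean_fin:
  assumes "\<pi> \<in> couplings \<eta> \<xi>" "\<eta> \<in> fin_meas" "\<xi> \<in> fin_meas"
  shows "cond_mean \<eta> \<pi> \<in> borel_measurable borel" "integrable \<eta> (cond_mean \<eta> \<pi>)"
    "\<And>h. h \<in> borel_measurable borel \<Longrightarrow> (\<And>x. \<bar>h x\<bar> \<le> 1) \<Longrightarrow>
      (\<integral>x. h x * cond_mean \<eta> \<pi> x \<partial>\<eta>) = (\<integral>z. h (fst z) * snd z \<partial>\<pi>)"
  using cond_mean_props[OF assms(1) fin_measD(3)[OF assms(2)] integrable_coupling(3)[OF assms]] by auto

lemma bary_cond_mean: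
  assumes "\<pi> \<in> couplings \<eta> \<xi>" "\<eta> \<in> fin_meas" "\<xi> \<in> fin_meas"
  shows "(\<integral>x. cond_mean \<eta> \<pi> x \<partial>\<eta>) = bary \<xi>"
  using cond_mean_fin(3)[OF assms, of "\<lambda>x. 1"] integral_coupling_snd[OF assms(1), of "\<lambda>x. x"]
  by (simp add: bary_def)

text \<open>Taking the conditional mean does not change the displacement, weighted by a function of the
  starting point.\<close>

lemma integral_shift_test:
  assumes \<pi>: "\<pi> \<in> couplings \<eta> \<xi>" and \<eta>: "\<eta> \<in> fin_meas" and \<xi>: "\<xi> \<in> fin_meas"
    and h: "h \<in> borel_measurable borel" "\<And>x. \<bar>h x\<bar> \<le> 1"
  shows "integrable \<eta> (\<lambda>x. h x * (x - cond_mean \<eta> \<pi> x))"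
    and "integrable \<pi> (\<lambda>z. h (fst z) * (fst z - snd z))"
    and "(\<integral>x. h x * (x - cond_mean \<eta> \<pi> x) \<partial>\<eta>) = (\<integral>z. h (fst z) * (fst z - snd z) \<partial>\<pi>)"
proof -
  note ic = integrable_coupling[OF \<pi> \<eta> \<xi>] and cm = cond_mean_fin[OF \<pi> \<eta> \<xi>] and f = fin_measD[OF \<eta>]
  have h\<pi>: "(\<lambda>z. h (fst z)) \<in> borel_measurable \<pi>"
    by (rule measurable_if_sets_borel[OF couplingsD(1)[OF \<pi>] borel_measurable_fst_real[OF h(1)]])
  have h\<eta>: "h \<in> borel_measurable \<eta>" by (rule measurable_if_sets_borel[OF f(1) h(1)])
  have i: "integrable \<pi> (\<lambda>z. h (fst z) * fst z)" "integrable \<pi> (\<lambda>z. h (fst z) * snd z)"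
    by (rule integrable_bounded_times[OF ic(2) h\<pi> h(2)] integrable_bounded_times[OF ic(3) h\<pi> h(2)])+
  have j: "integrable \<eta> (\<lambda>x. h x * x)" "integrable \<eta> (\<lambda>x. h x * cond_mean \<eta> \<pi> x)"
    by (rule integrable_bounded_times[OF f(4) h\<eta> h(2)] integrable_bounded_times[OF cm(2) h\<eta> h(2)])+
  show "integrable \<eta> (\<lambda>x. h x * (x - cond_mean \<eta> \<pi> x))" "integrable \<pi> (\<lambda>z. h (fst z) * (fst z - snd z))"
    using i j by (simp_all add: right_diff_distrib)
  have hx: "(\<lambda>x. h x * x) \<in> borel_measurable borel" using h(1) by measurable
  show "(\<integral>x. h x * (x - cond_mean \<eta> \<pi> x) \<partial>\<eta>) = (\<integral>z. h (fst z) * (fst z - snd z) \<partial>\<pi>)"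
    using i j cm(3)[OF h] integral_coupling_fst[OF \<pi> hx] by (simp add: right_diff_distrib)
qed

lemma cost_cond_mean: "cost \<eta> \<pi> = (\<integral>x. \<bar>x - cond_mean \<eta> \<pi> x\<bar> \<partial>\<eta>)"
  by (simp add: cost_def cond_mean_def)

section \<open>Puts, calls and their gaps\<close>

text \<open>This allows calls to be expressed by puts throughout, so that only the put side needs to be
  studied.\<close>

lemma call_put_parity:
  assumes "\<eta> \<in> fin_meas"
  shows "call_fun \<eta> k = put_fun \<eta> k + bary \<eta> - k * measure \<eta> UNIV"
proof -
  note f = fin_measD[OF assms]
  have "call_fun \<eta> k = (\<integral>x. max (k - x) 0 + (x - k) \<partial>\<eta>)"
    unfolding call_fun_def by (intro Bochner_Integration.integral_cong) auto
  then show ?thesis using f by (simp add: put_fun_def bary_def)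
qed

text \<open>\<open>put_fun \<eta> k\<close> stays within bounded distance of a function that depends only on
  the mass of \<open>\<eta>\<close>. For two measures of equal mass the difference of the puts is therefore
  bounded, and suprema of it are honest suprema.\<close>

lemma put_fun_diff_bounded:
  assumes "\<eta> \<in> fin_meas"
  shows "\<bar>put_fun \<eta> k - max k 0 * measure \<eta> UNIV\<bar> \<le> (\<integral>x. \<bar>x\<bar> \<partial>\<eta>)"
proof -
  note f = fin_measD[OF assms]
  have "put_fun \<eta> k - max k 0 * measure \<eta> UNIV = (\<integral>x. max (k - x) 0 - max k 0 \<partial>\<eta>)"
    using f by (simp add: put_fun_def)
  also have "\<bar>\<dots>\<bar> \<le> (\<integral>x. \<bar>max (k - x) 0 - max k 0\<bar> \<partial>\<eta>)"
    by (rule integral_abs_bound)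
  also have "\<dots> \<le> (\<integral>x. \<bar>x\<bar> \<partial>\<eta>)"
    using f by (intro integral_mono) auto
  finally show ?thesis .
qed

lemma put_gap_bounded:
  assumes "\<mu> \<in> fin_meas" "\<nu> \<in> fin_meas" "measure \<mu> UNIV = measure \<nu> UNIV"
  shows "bdd_above (range (\<lambda>k. put_fun \<mu> k - put_fun \<nu> k))"
proof (intro bdd_aboveI2)
  fix k
  show "put_fun \<mu> k - put_fun \<nu> k \<le> (\<integral>x. \<bar>x\<bar> \<partial>\<mu>) + (\<integral>x. \<bar>x\<bar> \<partial>\<nu>)"
    using put_fun_diff_bounded[OF assms(1), of k] put_fun_diff_bounded[OF assms(2), of k] assms(3)
    by (simp add: abs_le_iff)
qed

lemma put_gap_le_p_gap:
  assumes "\<mu> \<in> fin_meas" "\<nu> \<in> fin_meas" "measure \<mu> UNIV = measure \<nu> UNIV"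
  shows "put_fun \<mu> k - put_fun \<nu> k \<le> p_gap \<mu> \<nu>"
  unfolding p_gap_def by (rule cSUP_upper[OF UNIV_I put_gap_bounded[OF assms]])

lemma c_gap_eq:
  assumes "\<mu> \<in> fin_meas" "\<nu> \<in> fin_meas" "measure \<mu> UNIV = measure \<nu> UNIV"
  shows "c_gap \<mu> \<nu> = p_gap \<mu> \<nu> + bary \<mu> - bary \<nu>"
proof -
  have eq: "call_fun \<mu> k - call_fun \<nu> k = (put_fun \<mu> k - put_fun \<nu> k) + (bary \<mu> - bary \<nu>)" for k
    using assms(3) by (simp add: call_put_parity assms(1,2))
  have bdd: "bdd_above (range (\<lambda>k. call_fun \<mu> k - call_fun \<nu> k))"
    unfolding eq using put_gap_le_p_gap[OF assms]
    by (intro bdd_aboveI[where M="p_gap \<mu> \<nu> + (bary \<mu> - bary \<nu>)"]) auto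
  have "c_gap \<mu> \<nu> \<le> p_gap \<mu> \<nu> + (bary \<mu> - bary \<nu>)"
    unfolding c_gap_def eq using put_gap_le_p_gap[OF assms] by (intro cSUP_least) auto
  moreover have "p_gap \<mu> \<nu> \<le> c_gap \<mu> \<nu> - (bary \<mu> - bary \<nu>)"
    unfolding p_gap_def
  proof (rule cSUP_least)
    fix k show "put_fun \<mu> k - put_fun \<nu> k \<le> c_gap \<mu> \<nu> - (bary \<mu> - bary \<nu>)"
      using cSUP_upper[OF UNIV_I bdd, of k] unfolding c_gap_def eq by simp
  qed simp
  ultimately show ?thesis by simp
qed

lemma call_gap_le_c_gap:
  assumes "\<mu> \<in> fin_meas" "\<nu> \<in> fin_meas" "measure \<mu> UNIV = measure \<nu> UNIV"
  shows "call_fun \<mu> k - call_fun \<nu> k \<le> c_gap \<mu> \<nu>"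
  using put_gap_le_p_gap[OF assms, of k] assms(3)
  by (simp add: call_put_parity assms(1,2) c_gap_eq[OF assms])

lemma put_fun_nonneg: "0 \<le> put_fun \<eta> k" and call_fun_nonneg: "0 \<le> call_fun \<eta> k"
  by (simp_all add: put_fun_def call_fun_def)

section \<open>The lower bound\<close>

text \<open>The right side contains \<open>k - y\<close> restricted to the event that the mean lies below
  \<open>k\<close>. Comparing it with \<open>max (k - y) 0\<close> yields the conditional Jensen inequality
  for puts together with its case of equality.\<close>

lemma put_cond_mean_eq:
  assumes "\<pi> \<in> couplings \<eta> \<xi>" "\<eta> \<in> fin_meas" "\<xi> \<in> fin_meas"
  shows "integrable \<pi> (\<lambda>z. indicator {x. cond_mean \<eta> \<pi> x < k} (fst z) * (k - snd z))"
    "(\<integral>x. max (k - cond_mean \<eta> \<pi> x) 0 \<partial>\<eta>) =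
      (\<integral>z. indicator {x. cond_mean \<eta> \<pi> x < k} (fst z) * (k - snd z) \<partial>\<pi>)"
proof -
  define m where "m = cond_mean \<eta> \<pi>"
  define h :: "real \<Rightarrow> real" where "h = indicator {x. m x < k}"
  note cm = cond_mean_fin[OF assms, folded m_def] and ic = integrable_coupling[OF assms]
  interpret \<pi>: finite_measure \<pi> by fact
  interpret \<eta>: finite_measure \<eta> by (rule fin_measD(3)) fact
  have [measurable]: "m \<in> borel_measurable borel" by (rule cm)
  have hb[measurable]: "h \<in> borel_measurable borel" unfolding h_def by measurable
  have h1: "\<bar>h x\<bar> \<le> 1" for x by (simp add: h_def indicator_def)
  have hm: "(\<lambda>z. h (fst z)) \<in> borel_measurable \<pi>"
    by (rule measurable_if_sets_borel[OF couplingsD(1)[OF assms(1)] borel_measurable_fst_real[OF hb]])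
  have hm': "h \<in> borel_measurable \<eta>" by (rule measurable_if_sets_borel[OF fin_measD(1)[OF assms(2)] hb])
  have i: "integrable \<pi> (\<lambda>z. h (fst z) * k)" "integrable \<pi> (\<lambda>z. h (fst z) * snd z)"
    "integrable \<eta> (\<lambda>x. h x * k)" "integrable \<eta> (\<lambda>x. h x * m x)"
    by (rule integrable_bounded_times[OF \<pi>.integrable_const hm h1] integrable_bounded_times[OF ic(3) hm h1]
        integrable_bounded_times[OF \<eta>.integrable_const hm' h1] integrable_bounded_times[OF cm(2) hm' h1])+
  then show "integrable \<pi> (\<lambda>z. indicator {x. cond_mean \<eta> \<pi> x < k} (fst z) * (k - snd z))"
    unfolding m_def[symmetric] h_def[symmetric] by (simp add: right_diff_distrib)
  have "(\<integral>x. max (k - m x) 0 \<partial>\<eta>) = (\<integral>x. h x * k - h x * m x \<partial>\<eta>)"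
    by (intro Bochner_Integration.integral_cong) (auto simp: h_def indicator_def)
  also have "\<dots> = (\<integral>z. h (fst z) * k \<partial>\<pi>) - (\<integral>z. h (fst z) * snd z \<partial>\<pi>)"
    using i cm(3)[OF hb h1] integral_coupling_fst[OF assms(1) hb] by simp
  also have "\<dots> = (\<integral>z. h (fst z) * (k - snd z) \<partial>\<pi>)"
    using i by (simp add: right_diff_distrib)
  finally show "(\<integral>x. max (k - cond_mean \<eta> \<pi> x) 0 \<partial>\<eta>) =
      (\<integral>z. indicator {x. cond_mean \<eta> \<pi> x < k} (fst z) * (k - snd z) \<partial>\<pi>)"
    unfolding m_def h_def .
qed

lemma put_cond_mean_le:
  assumes "\<pi> \<in> couplings \<eta> \<xi>" "\<eta> \<in> fin_meas" "\<xi> \<in> fin_meas"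
  shows "(\<integral>x. max (k - cond_mean \<eta> \<pi> x) 0 \<partial>\<eta>) \<le> put_fun \<xi> k"
proof -
  have "(\<integral>x. max (k - cond_mean \<eta> \<pi> x) 0 \<partial>\<eta>) \<le> (\<integral>z. max (k - snd z) 0 \<partial>\<pi>)"
    unfolding put_cond_mean_eq(2)[OF assms]
    using put_cond_mean_eq(1)[OF assms] fin_measD(6)[OF assms(3)] integrable_coupling_snd[OF assms(1), of "\<lambda>y. max (k - y) 0"]
    by (intro integral_mono) (auto simp: indicator_def)
  then show ?thesis
    using integral_coupling_snd[OF assms(1), of "\<lambda>y. max (k - y) 0"] by (simp add: put_fun_def)
qed

text \<open>\<open>\<bar>d\<bar> = 2 * max (- d) 0 + d\<close>, and the integral of \<open>d = x - cond_mean
  \<eta> \<pi> x\<close> depends only on the marginals. So minimising the cost means minimising the upward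
  shift.\<close>

lemma cost_eq:
  assumes "\<pi> \<in> couplings \<eta> \<xi>" "\<eta> \<in> fin_meas" "\<xi> \<in> fin_meas"
  shows "cost \<eta> \<pi> = 2 * (\<integral>x. max (cond_mean \<eta> \<pi> x - x) 0 \<partial>\<eta>) + bary \<eta> - bary \<xi>"
proof -
  note cm = cond_mean_fin(2)[OF assms] and f = fin_measD(4)[OF assms(2)]
  have "cost \<eta> \<pi> = (\<integral>x. 2 * max (cond_mean \<eta> \<pi> x - x) 0 + (x - cond_mean \<eta> \<pi> x) \<partial>\<eta>)"
    unfolding cost_cond_mean by (intro Bochner_Integration.integral_cong) (auto simp: max_def abs_if)
  then show ?thesis using cm f bary_cond_mean[OF assms] by (simp add: bary_def)
qed

text \<open>Each strike \<open>k\<close> gives a lower bound, by \<open>max (m - x) 0 \<ge> max (k - x) 0 -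
  max (k - m) 0\<close> and Jensen.\<close>

lemma p_gap_le_upward_shift:
  assumes "\<pi> \<in> couplings \<mu> \<nu>" "\<mu> \<in> fin_meas" "\<nu> \<in> fin_meas"
  shows "p_gap \<mu> \<nu> \<le> (\<integral>x. max (cond_mean \<mu> \<pi> x - x) 0 \<partial>\<mu>)"
  unfolding p_gap_def
proof (rule cSUP_least)
  fix k
  note cm = cond_mean_fin(2)[OF assms] and f = fin_measD[OF assms(2)]
  have i: "integrable \<mu> (\<lambda>x. max (k - cond_mean \<mu> \<pi> x) 0)"
    using cm f(5) by (intro integrable_max) auto
  have "put_fun \<mu> k - put_fun \<nu> k \<le> (\<integral>x. max (k - x) 0 \<partial>\<mu>) - (\<integral>x. max (k - cond_mean \<mu> \<pi> x) 0 \<partial>\<mu>)"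
    using put_cond_mean_le[OF assms, of k] by (simp add: put_fun_def)
  also have "\<dots> = (\<integral>x. max (k - x) 0 - max (k - cond_mean \<mu> \<pi> x) 0 \<partial>\<mu>)"
    using i f by simp
  also have "\<dots> \<le> (\<integral>x. max (cond_mean \<mu> \<pi> x - x) 0 \<partial>\<mu>)"
    using i f cm by (intro integral_mono) (auto intro!: integrable_max)
  finally show "put_fun \<mu> k - put_fun \<nu> k \<le> (\<integral>x. max (cond_mean \<mu> \<pi> x - x) 0 \<partial>\<mu>)" .
qed simp

lemma cost_ge:
  assumes "\<pi> \<in> couplings \<mu> \<nu>" "\<mu> \<in> fin_meas" "\<nu> \<in> fin_meas"
  shows "p_gap \<mu> \<nu> + c_gap \<mu> \<nu> \<le> cost \<mu> \<pi>"
  using p_gap_le_upward_shift[OF assms] measure_coupling[OF assms(1)]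
  by (simp add: cost_eq[OF assms] c_gap_eq[OF assms(2,3)])

section \<open>Comonotone couplings as best responses\<close>

lemma borel_pair_set_measurable:
  assumes "Measurable.pred (borel \<Otimes>\<^sub>M borel) (P :: real \<times> real \<Rightarrow> bool)"
  shows "{z. P z} \<in> sets (borel :: (real \<times> real) measure)"
  using assms unfolding pred_def borel_prod by simp

text \<open>Comonotonicity of \<open>f\<close> and the second coordinate, tested at the level \<open>s\<close>
  of \<open>f\<close>. The last two alternatives cover the levels at which one of the two parts is null; a
  threshold \<open>k\<close> would then bound all values of the second coordinate from one side.\<close>

definition splits_at :: "(real \<times> real) measure \<Rightarrow> (real \<times> real \<Rightarrow> real) \<Rightarrow> real \<Rightarrow> bool" where
  "splits_at \<pi> f s \<longleftrightarrow>
    (\<exists>k. AE z in \<pi>. (s \<le> f z \<longrightarrow> k \<le> snd z) \<and> (f z < s \<longrightarrow> snd z \<le> k)) \<or>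
    (AE z in \<pi>. s \<le> f z) \<or> (AE z in \<pi>. f z < s)"

text \<open>The monotone coupling of two laws through a common uniform variable. For each level
  \<open>s\<close>, the part above \<open>s\<close> in the first coordinate is matched with an upper tail in
  the second.\<close>

lemma quantile_coupling:
  assumes "real_distribution \<alpha>" "real_distribution \<beta>"
  shows "\<exists>\<kappa>\<in>couplings \<alpha> \<beta>. \<forall>s. splits_at \<kappa> fst s"
proof -
  interpret A: cdf_distribution \<alpha> unfolding cdf_distribution_def by fact
  interpret B: cdf_distribution \<beta> unfolding cdf_distribution_def by fact
  \<comment> \<open>\<open>A.I\<close> and \<open>B.I\<close> are the quantile functions, that is, the
    generalised inverses of the two cdfs.\<close>
  define \<Omega> where "\<Omega> = restrict_space (lborel :: real measure) {0<..<1}"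
  have sp: "space \<Omega> = {0<..<1}" by (simp add: \<Omega>_def space_restrict_space)
  have s\<Omega>: "sets \<Omega> = sets (restrict_space borel {0<..<1::real})"
    unfolding \<Omega>_def by (rule sets_restrict_space_cong) simp
  have mI: "A.I \<in> borel_measurable \<Omega>" "B.I \<in> borel_measurable \<Omega>"
    using A.measurable_CI B.measurable_CI measurable_cong_sets[OF s\<Omega> refl] by blast+
  define \<kappa> where "\<kappa> = distr \<Omega> borel (\<lambda>u. (A.I u, B.I u))"
  have mp: "(\<lambda>u. (A.I u, B.I u)) \<in> \<Omega> \<rightarrow>\<^sub>M borel"
    unfolding borel_prod[symmetric] using mI by (rule measurable_Pair)
  have mf: "(fst :: real \<times> real \<Rightarrow> real) \<in> borel \<rightarrow>\<^sub>M borel" "(snd :: real \<times> real \<Rightarrow> real) \<in> borel \<rightarrow>\<^sub>M borel"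
    using borel_measurable_fst_real[of "\<lambda>x. x"] borel_measurable_snd_real[of "\<lambda>x. x"] by simp_all
  have "distr \<kappa> borel fst = \<alpha>"
    unfolding \<kappa>_def distr_distr[OF mf(1) mp] using A.distr_I_eq_M by (simp add: \<Omega>_def comp_def)
  moreover have "distr \<kappa> borel snd = \<beta>"
    unfolding \<kappa>_def distr_distr[OF mf(2) mp] using B.distr_I_eq_M by (simp add: \<Omega>_def comp_def)
  ultimately have \<kappa>: "\<kappa> \<in> couplings \<alpha> \<beta>" by (simp add: couplings_def \<kappa>_def)
  have AE\<kappa>: "AE z in \<kappa>. P z" if P: "Measurable.pred (borel \<Otimes>\<^sub>M borel) P"
    and u: "\<And>u. 0 < u \<Longrightarrow> u < 1 \<Longrightarrow> P (A.I u, B.I u)" for P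
  proof -
    have "{z \<in> space borel. P z} \<in> sets borel" using borel_pair_set_measurable[OF P] by simp
    from AE_distr_iff[OF mp this] show ?thesis
      unfolding \<kappa>_def using u by (auto intro!: AE_I2 simp: sp)
  qed
  show ?thesis
  proof (rule bexI[OF _ \<kappa>], rule allI)
    fix s
    define U where "U = {u. 0 < u \<and> u < 1 \<and> s \<le> A.I u}"
    have "U \<subseteq> {0<..<1}" by (auto simp: U_def)
    then have "U = {} \<or> U = {0<..<1} \<or> (\<exists>u0\<in>{0<..<1}. u0 \<notin> U \<and> (\<exists>u1. u1 \<in> U))" by blast
    then consider "U = {}" | "U = {0<..<1}" | u0 u1 where "0 < u0" "u0 < 1" "u0 \<notin> U" "u1 \<in> U"
      unfolding greaterThanLessThan_iff Bex_def by blast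
    then show "splits_at \<kappa> fst s"
    proof cases
      case 1
      have "AE z in \<kappa>. fst z < s"
        using 1 by (intro AE\<kappa>) (auto simp: U_def not_le)
      then show ?thesis unfolding splits_at_def by simp
    next
      case 2
      have "AE z in \<kappa>. s \<le> fst z"
      proof (rule AE\<kappa>)
        fix u :: real assume "0 < u" "u < 1"
        then have "u \<in> U" using 2 by simp
        then show "s \<le> fst (A.I u, B.I u)" by (simp add: U_def)
      qed measurable
      then show ?thesis unfolding splits_at_def by simp
    next
      case 3
      define k where "k = (INF u\<in>U. B.I u)"
      have up: "B.I v \<le> B.I u" if "0 < v" "v < 1" "v \<notin> U" "u \<in> U" for u v
      proof -
        have uu: "0 < u" "u < 1" "s \<le> A.I u" using that by (auto simp: U_def)
        have "A.I v < A.I u" using that uu by (auto simp: U_def)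
        then have "v \<le> u"
          using mono_onD[OF A.mono_I, of u v] that uu by (cases "v \<le> u") auto
        then show ?thesis using mono_onD[OF B.mono_I, of v u] that uu by auto
      qed
      have bdd: "bdd_below (B.I ` U)" using up[OF 3(1-3)] by (intro bdd_belowI[where m="B.I u0"]) auto
      have "AE z in \<kappa>. (s \<le> fst z \<longrightarrow> k \<le> snd z) \<and> (fst z < s \<longrightarrow> snd z \<le> k)"
      proof (rule AE\<kappa>)
        fix u :: real assume u: "0 < u" "u < 1"
        show "(s \<le> fst (A.I u, B.I u) \<longrightarrow> k \<le> snd (A.I u, B.I u)) \<and> (fst (A.I u, B.I u) < s \<longrightarrow> snd (A.I u, B.I u) \<le> k)"
        proof (cases "u \<in> U")
          case True
          then have "k \<le> B.I u" unfolding k_def by (intro cINF_lower bdd)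
          then show ?thesis using True by (simp add: U_def)
        next
          case False
          then have "B.I u \<le> k" unfolding k_def using 3(4) up[OF u False] by (intro cINF_greatest) auto
          then show ?thesis using False u by (simp add: U_def)
        qed
      qed measurable
      then show ?thesis unfolding splits_at_def by (intro disjI1 exI)
    qed
  qed
qed

text \<open>The coupling of \<open>\<mu>\<close> and \<open>\<nu>\<close> in which \<open>w x\<close> and
  \<open>y\<close> are comonotone; points with the same value of \<open>w\<close> share the conditional law
  that the quantile coupling of \<open>w x\<close> and \<open>y\<close> provides.\<close>

lemma comonotone_coupling_exists:
  fixes w :: "real \<Rightarrow> real"
  assumes \<mu>: "\<mu> \<in> fin_meas" and \<nu>: "\<nu> \<in> fin_meas"
    and mass: "measure \<mu> UNIV = measure \<nu> UNIV" "0 < measure \<mu> UNIV"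
    and w: "w \<in> borel_measurable borel"
  shows "\<exists>\<pi>\<in>couplings \<mu> \<nu>. \<forall>s. splits_at \<pi> (\<lambda>z. w (fst z)) s"
proof -
  note f\<mu> = fin_measD[OF \<mu>] and f\<nu> = fin_measD[OF \<nu>]
  interpret \<mu>: finite_measure \<mu> by fact
  interpret \<nu>: finite_measure \<nu> by fact
  define M where "M = measure \<mu> UNIV"
  have M: "0 < M" "emeasure \<mu> UNIV = ennreal M" "emeasure \<nu> UNIV = ennreal M"
    using mass by (simp_all add: M_def \<mu>.emeasure_eq_measure \<nu>.emeasure_eq_measure)
  define r where "r = ennreal (1 / M)"
  have rM: "r * ennreal M = 1" "ennreal M * r = 1"
    unfolding r_def using M(1) by (simp_all add: ennreal_mult[symmetric])
  have cancel: "ennreal M * (r * a) = a" for a by (simp add: mult.assoc[symmetric] rM)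
  have w\<mu>: "w \<in> borel_measurable \<mu>" by (rule measurable_if_sets_borel[OF f\<mu>(1) w])
  have ws: "w \<in> borel_measurable (scale_measure r \<mu>)"
    by (rule measurable_if_sets_borel[OF _ w]) (simp add: f\<mu>(1))
  \<comment> \<open>Couple the law of \<open>w\<close> with \<open>\<nu>\<close>, both normalised to mass one,
    and feed \<open>w x\<close> into the resulting kernel.\<close>
  define \<alpha> where "\<alpha> = distr (scale_measure r \<mu>) borel w"
  define \<beta> where "\<beta> = scale_measure r \<nu>"
  have \<alpha>: "real_distribution \<alpha>"
  proof -
    interpret prob_space "scale_measure r \<mu>"
      by standard (simp add: space_scale_measure f\<mu>(2) M(2) rM)
    show ?thesis unfolding \<alpha>_def using ws by (rule real_distribution_distr)
  qed
  have \<beta>: "real_distribution \<beta>"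
    unfolding real_distribution_def real_distribution_axioms_def \<beta>_def
    by (auto intro!: prob_spaceI simp: space_scale_measure f\<nu>(1,2) M(3) rM)
  obtain \<kappa> where \<kappa>: "\<kappa> \<in> couplings \<alpha> \<beta>" and mono: "\<And>s.
    splits_at \<kappa> fst s"
    using quantile_coupling[OF \<alpha> \<beta>] by blast
  note c = couplingsD[OF \<kappa>]
  have "finite_measure \<alpha>" using \<alpha> by (simp add: real_distribution_def prob_space_def)
  from disintegration_exists[OF \<kappa> this] obtain K where "disintegrates \<alpha> \<kappa> K" ..
  then have K: "K \<in> borel \<rightarrow>\<^sub>M prob_algebra borel"
    and KA: "\<And>A. A \<in> sets borel \<Longrightarrow> emeasure \<kappa> A = (\<integral>\<^sup>+ x. emeasure (K x) {y. (x, y) \<in> A} \<partial>\<alpha>)"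
    by (auto simp: disintegrates_def)
  have Kw: "(\<lambda>x. K (w x)) \<in> borel \<rightarrow>\<^sub>M prob_algebra borel"
    by (rule measurable_compose[OF w K])
  define \<pi> where "\<pi> = kernel_product \<mu> (\<lambda>x. K (w x))"
  note kp = kernel_product_props[OF Kw f\<mu>(1), folded \<pi>_def]
  have sp: "space \<pi> = UNIV" using kp(1) by (rule space_eq_UNIV_if_borel)
  have trm: "(\<lambda>z. (w (fst z), snd z)) \<in> borel \<rightarrow>\<^sub>M (borel :: (real \<times> real) measure)"
    unfolding borel_prod[symmetric] using w by measurable
  have vs: "{z. (w (fst z), snd z) \<in> B} \<in> sets borel" if "B \<in> sets borel" for B :: "(real \<times> real) set"
    using measurable_sets[OF trm that] by (simp add: vimage_def)
  have tr: "emeasure \<kappa> B = r * emeasure \<pi> {z. (w (fst z), snd z) \<in> B}" if B: "B \<in> sets borel" for B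
  proof -
    have m: "(\<lambda>x. emeasure (K x) {y. (x, y) \<in> B}) \<in> borel_measurable borel"
      by (rule kernel_slice(2)[OF K _ B]) simp
    have "emeasure \<kappa> B = (\<integral>\<^sup>+x. emeasure (K (w x)) {y. (w x, y) \<in> B} \<partial>scale_measure r \<mu>)"
      unfolding KA[OF B] \<alpha>_def using ws m by (intro nn_integral_distr) simp_all
    also have "\<dots> = r * (\<integral>\<^sup>+x. emeasure (K (w x)) {y. (w x, y) \<in> B} \<partial>\<mu>)"
      using measurable_compose[OF w\<mu> m] by (rule nn_integral_scale_measure)
    also have "(\<integral>\<^sup>+x. emeasure (K (w x)) {y. (w x, y) \<in> B} \<partial>\<mu>) = emeasure \<pi> {z. (w (fst z), snd z) \<in> B}"
      by (subst kp(2)[OF vs[OF B]]) simp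
    finally show ?thesis .
  qed
  have "distr \<pi> borel fst = \<mu>"
  proof (rule measure_eqI)
    fix A assume "A \<in> sets (distr \<pi> borel fst)"
    then have A: "A \<in> sets borel" by simp
    have m: "fst \<in> \<pi> \<rightarrow>\<^sub>M borel"
      by (rule measurable_if_sets_borel[OF kp(1)]) (rule borel_measurable_fst_real[of "\<lambda>x. x", simplified])
    have "emeasure (distr \<pi> borel fst) A = emeasure \<pi> (A \<times> UNIV)"
      using emeasure_distr[OF m A] by (simp add: sp vimage_fst)
    also have "\<dots> = (\<integral>\<^sup>+x. indicator A x \<partial>\<mu>)"
      using prob_space.emeasure_space_1[OF kernelD(1)[OF K]]
      by (subst kp(3)[OF A]) (auto simp: kernelD(3)[OF K])
    also have "\<dots> = emeasure \<mu> A" using A f\<mu>(1) by simp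
    finally show "emeasure (distr \<pi> borel fst) A = emeasure \<mu> A" .
  qed (simp add: f\<mu>(1))
  moreover have "distr \<pi> borel snd = \<nu>"
  proof (rule measure_eqI)
    fix B assume "B \<in> sets (distr \<pi> borel snd)"
    then have B: "B \<in> sets borel" by simp
    have m: "snd \<in> \<pi> \<rightarrow>\<^sub>M borel"
      by (rule measurable_if_sets_borel[OF kp(1)]) (rule borel_measurable_snd_real[of "\<lambda>x. x", simplified])
    have UB: "(UNIV :: real set) \<times> B \<in> sets borel" using B unfolding borel_prod[symmetric] by auto
    have *: "{z. (w (fst z), snd z) \<in> UNIV \<times> B} = UNIV \<times> B" by auto
    have "emeasure (distr \<pi> borel snd) B = emeasure \<pi> (UNIV \<times> B)"
      using emeasure_distr[OF m B] by (simp add: sp vimage_snd)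
    also have "\<dots> = ennreal M * emeasure \<kappa> (UNIV \<times> B)"
      unfolding tr[OF UB] * cancel ..
    also have "emeasure \<kappa> (UNIV \<times> B) = emeasure (distr \<kappa> borel snd) B"
      using emeasure_distr[OF c(4) B] c(2) by (simp add: vimage_snd)
    also have "\<dots> = r * emeasure \<nu> B" unfolding c(6) \<beta>_def by simp
    finally show "emeasure (distr \<pi> borel snd) B = emeasure \<nu> B" unfolding cancel .
  qed (simp add: f\<nu>(1))
  ultimately have \<pi>: "\<pi> \<in> couplings \<mu> \<nu>" using kp(1) by (simp add: couplings_def)
  have AE: "AE z in \<pi>. P (w (fst z), snd z)"
    if P: "Measurable.pred (borel \<Otimes>\<^sub>M borel) P" and ae: "AE z in \<kappa>. P z" for P
  proof -
    have B: "{z. \<not> P z} \<in> sets borel" using P by (intro borel_pair_set_measurable) measurable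
    have "emeasure \<kappa> {z. \<not> P z} = 0"
      using ae B c(1,2) by (subst (asm) AE_iff_measurable[OF _ refl]) simp_all
    then have "r * emeasure \<pi> {z. \<not> P (w (fst z), snd z)} = 0"
      using tr[OF B] by simp
    then have "emeasure \<pi> {z. \<not> P (w (fst z), snd z)} = 0"
      using M(1) by (simp add: r_def)
    then show ?thesis
      using vs[OF B] kp(1) sp by (intro AE_I[of _ _ "{z. \<not> P (w (fst z), snd z)}"]) auto
  qed
  show ?thesis
  proof (rule bexI[OF _ \<pi>], rule allI)
    fix s
    consider k where "AE z in \<kappa>. (s \<le> fst z \<longrightarrow> k \<le> snd z) \<and> (fst z < s \<longrightarrow> snd z \<le> k)"
      | "AE z in \<kappa>. s \<le> fst z" | "AE z in \<kappa>. fst z < s"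
      using mono[of s] unfolding splits_at_def by blast
    then show "splits_at \<pi> (\<lambda>z. w (fst z)) s"
    proof cases
      case 1
      have "AE z in \<pi>. (s \<le> fst (w (fst z), snd z) \<longrightarrow> k \<le> snd (w (fst z), snd z)) \<and>
        (fst (w (fst z), snd z) < s \<longrightarrow> snd (w (fst z), snd z) \<le> k)"
        by (rule AE[OF _ 1]) measurable
      then show ?thesis unfolding splits_at_def fst_conv snd_conv by (intro disjI1 exI)
    next
      case 2
      have "AE z in \<pi>. s \<le> fst (w (fst z), snd z)" by (rule AE[OF _ 2]) measurable
      then show ?thesis unfolding splits_at_def by simp
    next
      case 3
      have "AE z in \<pi>. fst (w (fst z), snd z) < s" by (rule AE[OF _ 3]) measurable
      then show ?thesis unfolding splits_at_def by simp
    qed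
  qed
qed

lemma layer_cake_grid:
  fixes t :: real
  assumes "0 \<le> t" "t \<le> real n"
  shows "\<bar>t - (\<Sum>j\<in>{1..n}. if real j \<le> t then 1 else 0)\<bar> \<le> 1"
proof -
  have "{j\<in>{1..n}. real j \<le> t} = {1..nat \<lfloor>t\<rfloor>}"
    using assms by (auto simp: le_nat_floor) linarith+
  then have "(\<Sum>j\<in>{1..n}. if real j \<le> t then 1 else 0 :: real) = real (nat \<lfloor>t\<rfloor>)"
    by (simp add: sum.If_cases Int_def)
  then show ?thesis using assms(1) by linarith
qed

text \<open>If \<open>{w \<ge> s}\<close> is matched with the part of \<open>\<nu>\<close> above
  \<open>k\<close>, then \<open>x - y\<close> integrates over it to at most \<open>call_fun \<mu> k - call_fun
  \<nu> k\<close>.\<close>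

lemma upper_tail_shift_le:
  fixes w :: "real \<Rightarrow> real"
  assumes \<mu>: "\<mu> \<in> fin_meas" and \<nu>: "\<nu> \<in> fin_meas" and \<pi>: "\<pi> \<in> couplings \<mu> \<nu>"
    and pc: "0 \<le> p_gap \<mu> \<nu>" "0 \<le> c_gap \<mu> \<nu>" and w: "w \<in> borel_measurable borel"
    and mono: "splits_at \<pi> (\<lambda>z. w (fst z)) s"
  shows "(\<integral>z. (if s \<le> w (fst z) then 1 else 0) * (fst z - snd z) \<partial>\<pi>) \<le> c_gap \<mu> \<nu>"
proof -
  note ic = integrable_coupling[OF \<pi> \<mu> \<nu>]
  have m: "measure \<mu> UNIV = measure \<nu> UNIV" using measure_coupling[OF \<pi>] by simp
  define h where "h z = (if s \<le> w (fst z) then 1 else 0 :: real)" for z :: "real \<times> real"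
  have hb: "h \<in> borel_measurable \<pi>"
  proof (rule measurable_if_sets_borel[OF couplingsD(1)[OF \<pi>]])
    note w[measurable]
    have "(\<lambda>x. if s \<le> w x then 1 else 0 :: real) \<in> borel_measurable borel" by measurable
    from borel_measurable_fst_real[OF this] show "h \<in> borel_measurable borel" unfolding h_def[abs_def] .
  qed
  have hi: "integrable \<pi> (\<lambda>z. h z * (fst z - snd z))"
    using ic by (intro integrable_bounded_times hb) (auto simp: h_def)
  have ifst: "(\<integral>z. fst z \<partial>\<pi>) = bary \<mu>" "(\<integral>z. snd z \<partial>\<pi>) = bary \<nu>"
    using integral_coupling_fst[OF \<pi>, of "\<lambda>x. x"] integral_coupling_snd[OF \<pi>, of "\<lambda>x. x"] by (simp_all add: bary_def)
  have "(\<integral>z. h z * (fst z - snd z) \<partial>\<pi>) \<le> c_gap \<mu> \<nu>"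
    using mono unfolding splits_at_def
  proof (elim disjE exE)
    fix k assume k: "AE z in \<pi>. (s \<le> w (fst z) \<longrightarrow> k \<le> snd z) \<and> (w (fst z) < s \<longrightarrow> snd z \<le> k)"
    have mb: "(\<lambda>x. max (x - k) 0) \<in> borel_measurable borel" by simp
    have i: "integrable \<pi> (\<lambda>z. max (fst z - k) 0)" "integrable \<pi> (\<lambda>z. max (snd z - k) 0)"
      using integrable_coupling_fst[OF \<pi> mb] integrable_coupling_snd[OF \<pi> mb] fin_measD(7)[OF \<mu>] fin_measD(7)[OF \<nu>] by auto
    have "(\<integral>z. h z * (fst z - snd z) \<partial>\<pi>) \<le> (\<integral>z. max (fst z - k) 0 - max (snd z - k) 0 \<partial>\<pi>)"
    proof (rule integral_mono_AE[OF hi])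
      show "AE z in \<pi>. h z * (fst z - snd z) \<le> max (fst z - k) 0 - max (snd z - k) 0"
        using k by eventually_elim (auto simp: h_def)
    qed (use i in auto)
    also have "\<dots> = call_fun \<mu> k - call_fun \<nu> k"
      using i integral_coupling_fst[OF \<pi> mb] integral_coupling_snd[OF \<pi> mb] by (simp add: call_fun_def)
    also have "\<dots> \<le> c_gap \<mu> \<nu>" by (rule call_gap_le_c_gap[OF \<mu> \<nu> m])
    finally show ?thesis .
  next
    assume "AE z in \<pi>. s \<le> w (fst z)"
    then have "AE z in \<pi>. h z * (fst z - snd z) = fst z - snd z" by eventually_elim (simp add: h_def)
    then have "(\<integral>z. h z * (fst z - snd z) \<partial>\<pi>) = (\<integral>z. fst z - snd z \<partial>\<pi>)"
      using hi ic by (intro integral_cong_AE) auto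
    also have "\<dots> = bary \<mu> - bary \<nu>" using ic ifst by simp
    finally show ?thesis using pc(1) c_gap_eq[OF \<mu> \<nu> m] by simp
  next
    assume "AE z in \<pi>. w (fst z) < s"
    then have "AE z in \<pi>. h z * (fst z - snd z) = 0" by eventually_elim (simp add: h_def)
    then have "(\<integral>z. h z * (fst z - snd z) \<partial>\<pi>) = (\<integral>z. 0 \<partial>\<pi>)"
      using hi by (intro integral_cong_AE) auto
    then show ?thesis using pc(2) by simp
  qed
  then show ?thesis by (simp add: h_def)
qed

text \<open>Write \<open>w\<close> as \<open>-1\<close> plus a positive
  combination, of total weight \<open>2\<close>, of indicators of \<open>{w \<ge> s}\<close>. The constant
  contributes \<open>bary \<nu> - bary \<mu> = p_gap \<mu> \<nu> - c_gap \<mu> \<nu>\<close>, and under the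
  comonotone coupling each indicator contributes at most \<open>c_gap \<mu> \<nu>\<close>.\<close>

lemma best_response:
  fixes w :: "real \<Rightarrow> real"
  assumes \<mu>: "\<mu> \<in> fin_meas" and \<nu>: "\<nu> \<in> fin_meas"
    and mass: "measure \<mu> UNIV = measure \<nu> UNIV" "0 < measure \<mu> UNIV"
    and pc: "0 \<le> p_gap \<mu> \<nu>" "0 \<le> c_gap \<mu> \<nu>"
    and w: "w \<in> borel_measurable borel" and w1: "\<And>x. \<bar>w x\<bar> \<le> 1"
  shows "\<exists>\<pi>\<in>couplings \<mu> \<nu>. (\<integral>z. w (fst z) * (fst z - snd z) \<partial>\<pi>) \<le> p_gap \<mu> \<nu> + c_gap \<mu> \<nu>"
proof -
  obtain \<pi> where \<pi>: "\<pi> \<in> couplings \<mu> \<nu>" and mono: "\<And>s.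
      splits_at \<pi> (\<lambda>z. w (fst z)) s"
    using comonotone_coupling_exists[OF \<mu> \<nu> mass w] by blast
  note ic = integrable_coupling[OF \<pi> \<mu> \<nu>]
  define d where "d z = fst z - snd z" for z :: "real \<times> real"
  have di: "integrable \<pi> d" unfolding d_def[abs_def] using ic by auto
  have dint: "(\<integral>z. d z \<partial>\<pi>) = bary \<mu> - bary \<nu>"
    using ic integral_coupling_fst[OF \<pi>, of "\<lambda>x. x"] integral_coupling_snd[OF \<pi>, of "\<lambda>x. x"]
    by (simp add: bary_def d_def)
  have wb: "(\<lambda>z. w (fst z)) \<in> borel_measurable \<pi>"
    by (rule measurable_if_sets_borel[OF couplingsD(1)[OF \<pi>] borel_measurable_fst_real[OF w]])
  have wdi: "integrable \<pi> (\<lambda>z. w (fst z) * d z)" by (intro integrable_bounded_times di wb w1)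
  define h where "h s z = (if s \<le> w (fst z) then 1 else 0 :: real)" for s and z :: "real \<times> real"
  have hb: "h s \<in> borel_measurable \<pi>" for s
  proof -
    note wb[measurable]
    show ?thesis unfolding h_def[abs_def] by measurable
  qed
  have hdi: "integrable \<pi> (\<lambda>z. h s z * d z)" for s
    by (intro integrable_bounded_times di hb) (simp add: h_def)
  have tail: "(\<integral>z. h s z * d z \<partial>\<pi>) \<le> c_gap \<mu> \<nu>" for s
    using upper_tail_shift_le[OF \<mu> \<nu> \<pi> pc w mono[of s]] by (simp add: h_def d_def)
  have bound: "(\<integral>z. w (fst z) * d z \<partial>\<pi>) \<le> p_gap \<mu> \<nu> + c_gap \<mu> \<nu> + 2 / real n * (\<integral>z. \<bar>d z\<bar> \<partial>\<pi>)"
    if n: "0 < n" for n :: nat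
  proof -
    \<comment> \<open>\<open>w + 1\<close> takes values in \<open>[0, 2]\<close>; it is approximated by \<open>2 /
      n\<close> times the number of levels \<open>lev j\<close> below \<open>w\<close>.\<close>
    define lev where "lev j = 2 * real j / real n - 1" for j :: nat
    define g where "g z = (\<Sum>j\<in>{1..n}. h (lev j) z)" for z
    have gi: "integrable \<pi> (\<lambda>z. g z * d z)"
      unfolding g_def sum_distrib_right by (intro Bochner_Integration.integrable_sum hdi)
    have gint: "(\<integral>z. g z * d z \<partial>\<pi>) \<le> real n * c_gap \<mu> \<nu>"
    proof -
      have "(\<integral>z. g z * d z \<partial>\<pi>) = (\<Sum>j\<in>{1..n}. \<integral>z. h (lev j) z * d z \<partial>\<pi>)"
        unfolding g_def sum_distrib_right by (intro Bochner_Integration.integral_sum hdi)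
      also have "\<dots> \<le> (\<Sum>j\<in>{1..n}. c_gap \<mu> \<nu>)" by (intro sum_mono tail)
      finally show ?thesis by simp
    qed
    have close: "w (fst z) * d z \<le> (2 / real n * g z - 1) * d z + 2 / real n * \<bar>d z\<bar>" for z
    proof -
      define t where "t = real n * (w (fst z) + 1) / 2"
      have w2: "0 \<le> w (fst z) + 1" "w (fst z) + 1 \<le> 2"
        using w1[of "fst z"] by (auto simp: abs_le_iff)
      have t: "0 \<le> t" "t \<le> real n"
        using w2 mult_left_mono[OF w2(2), of "real n"] by (simp_all add: t_def)
      have "h (lev j) z = (if real j \<le> t then 1 else 0)" for j
        using n by (simp add: h_def lev_def t_def field_simps)
      then have "\<bar>t - g z\<bar> \<le> 1" using layer_cake_grid[OF t] by (simp add: g_def)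
      moreover have "w (fst z) - (2 / real n * g z - 1) = 2 / real n * (t - g z)"
        using n by (simp add: t_def field_simps)
      ultimately have "\<bar>w (fst z) - (2 / real n * g z - 1)\<bar> \<le> 2 / real n"
        using n by (simp add: abs_mult divide_right_mono mult_left_le)
      then have "\<bar>w (fst z) - (2 / real n * g z - 1)\<bar> * \<bar>d z\<bar> \<le> 2 / real n * \<bar>d z\<bar>"
        by (rule mult_right_mono) simp
      then have "(w (fst z) - (2 / real n * g z - 1)) * d z \<le> 2 / real n * \<bar>d z\<bar>"
        unfolding abs_mult[symmetric] by linarith
      then show ?thesis by (simp add: left_diff_distrib)
    qed
    have "(\<integral>z. w (fst z) * d z \<partial>\<pi>) \<le> (\<integral>z. 2 / real n * (g z * d z) - d z + 2 / real n * \<bar>d z\<bar> \<partial>\<pi>)"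
      using close by (intro integral_mono wdi) (use gi di in \<open>auto simp: left_diff_distrib mult.assoc\<close>)
    also have "\<dots> = 2 / real n * (\<integral>z. g z * d z \<partial>\<pi>) - (bary \<mu> - bary \<nu>) + 2 / real n * (\<integral>z. \<bar>d z\<bar> \<partial>\<pi>)"
      using gi di by (simp add: dint)
    also have "\<dots> \<le> 2 / real n * (real n * c_gap \<mu> \<nu>) - (bary \<mu> - bary \<nu>) + 2 / real n * (\<integral>z. \<bar>d z\<bar> \<partial>\<pi>)"
      using gint by (intro add_right_mono diff_right_mono mult_left_mono) auto
    finally show ?thesis using n by (simp add: c_gap_eq[OF \<mu> \<nu> mass(1)])
  qed
  \<comment> \<open>The coupling does not depend on \<open>n\<close>, so the discretisation error can be sent to
    zero.\<close>
  have "(\<lambda>n. p_gap \<mu> \<nu> + c_gap \<mu> \<nu> + 2 / real n * (\<integral>z. \<bar>d z\<bar> \<partial>\<pi>)) \<longlonglongrightarrow> p_gap \<mu> \<nu> + c_gap \<mu> \<nu> + 0 * (\<integral>z. \<bar>d z\<bar> \<partial>\<pi>)"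
    by (intro tendsto_intros lim_const_over_n)
  then have "(\<integral>z. w (fst z) * d z \<partial>\<pi>) \<le> p_gap \<mu> \<nu> + c_gap \<mu> \<nu>"
    using bound by (intro LIMSEQ_le_const[where X="\<lambda>n. p_gap \<mu> \<nu> + c_gap \<mu> \<nu> + 2 / real n * (\<integral>z. \<bar>d z\<bar> \<partial>\<pi>)"]) (auto intro!: exI[of _ 1])
  then show ?thesis using \<pi> unfolding d_def by blast
qed

section \<open>The lower bound is sharp\<close>

text \<open>Couplings form a convex set on which the conditional mean is affine.\<close>

lemma mixture_coupling:
  assumes \<eta>: "\<eta> \<in> fin_meas" and \<xi>: "\<xi> \<in> fin_meas" and \<pi>: "\<pi> \<in> couplings \<eta> \<xi>" and \<pi>': "\<pi>' \<in> couplings \<eta> \<xi>"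
    and t: "0 \<le> t" "t \<le> 1"
  shows "\<exists>\<rho>\<in>couplings \<eta> \<xi>. AE x in \<eta>. cond_mean \<eta> \<rho> x = (1 - t) * cond_mean \<eta> \<pi> x + t * cond_mean \<eta> \<pi>' x"
proof -
  note c = couplingsD[OF \<pi>] and c' = couplingsD[OF \<pi>']
  define \<rho> where "\<rho> = add_measure (density \<pi> (\<lambda>_. ennreal (1 - t))) (density \<pi>' (\<lambda>_. ennreal t))"
  have s: "sets (density \<pi>' (\<lambda>_. ennreal t)) = sets (density \<pi> (\<lambda>_. ennreal (1 - t)))" by (simp add: c(1) c'(1))
  have s\<rho>: "sets \<rho> = sets borel" by (simp add: \<rho>_def c(1))
  have sp: "space \<rho> = UNIV" using s\<rho> by (rule space_eq_UNIV_if_borel)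
  have e\<rho>: "emeasure \<rho> A = ennreal (1 - t) * emeasure \<pi> A + ennreal t * emeasure \<pi>' A" if "A \<in> sets borel" for A
    using that unfolding \<rho>_def
    by (subst emeasure_add_measure[OF s]) (simp_all add: c(1) c'(1) emeasure_density_const)
  have conv: "ennreal (1 - t) * a + ennreal t * a = a" for a
    using t by (simp add: distrib_right[symmetric] ennreal_plus[symmetric] del: ennreal_plus)
  have marg: "distr \<rho> borel f = \<zeta>" if f: "f \<in> borel_measurable borel" and "distr \<pi> borel f = \<zeta>" "distr \<pi>' borel f = \<zeta>"
    for f :: "real \<times> real \<Rightarrow> real" and \<zeta>
  proof (rule measure_eqI)
    show "sets (distr \<rho> borel f) = sets \<zeta>" using that(2) by auto
    fix A assume "A \<in> sets (distr \<rho> borel f)"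
    then have A: "A \<in> sets borel" by simp
    have fA: "f -` A \<in> sets borel" using measurable_sets[OF f A] by simp
    have "emeasure (distr \<rho> borel f) A = emeasure \<rho> (f -` A)"
      using emeasure_distr[OF measurable_if_sets_borel[OF s\<rho> f] A] by (simp add: sp)
    also have "\<dots> = ennreal (1 - t) * emeasure \<zeta> A + ennreal t * emeasure \<zeta> A"
      using emeasure_distr[OF measurable_if_sets_borel[OF c(1) f] A]
        emeasure_distr[OF measurable_if_sets_borel[OF c'(1) f] A]
      by (simp add: e\<rho>[OF fA] that(2,3) c(2) c'(2))
    finally show "emeasure (distr \<rho> borel f) A = emeasure \<zeta> A" unfolding conv .
  qed
  have \<rho>: "\<rho> \<in> couplings \<eta> \<xi>"
    using marg[OF borel_measurable_fst_real[of "\<lambda>x. x"] c(5) c'(5)] marg[OF borel_measurable_snd_real[of "\<lambda>x. x"] c(6) c'(6)] s\<rho>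
    by (simp add: couplings_def)
  note cm = cond_mean_fin[OF \<pi> \<eta> \<xi>] and cm' = cond_mean_fin[OF \<pi>' \<eta> \<xi>]
  note ic = integrable_coupling[OF \<pi> \<eta> \<xi>] and ic' = integrable_coupling[OF \<pi>' \<eta> \<xi>]
  have int\<rho>: "(\<integral>z. f z \<partial>\<rho>) = (1 - t) * (\<integral>z. f z \<partial>\<pi>) + t * (\<integral>z. f z \<partial>\<pi>')"
    if "integrable \<pi> f" "integrable \<pi>' f" for f
  proof -
    have "integrable (density \<pi> (\<lambda>_. ennreal (1 - t))) f" "integrable (density \<pi>' (\<lambda>_. ennreal t)) f"
      using that t by (subst integrable_real_density; auto)+
    then show ?thesis
      unfolding \<rho>_def using that t by (simp add: integral_add_measure[OF s] integral_real_density)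
  qed
  have "AE x in \<eta>. cond_mean \<eta> \<rho> x = (1 - t) * cond_mean \<eta> \<pi> x + t * cond_mean \<eta> \<pi>' x"
  proof (rule cond_mean_unique[OF \<rho> fin_measD(3)[OF \<eta>] integrable_coupling(3)[OF \<rho> \<eta> \<xi>]])
    show "(\<lambda>x. (1 - t) * cond_mean \<eta> \<pi> x + t * cond_mean \<eta> \<pi>' x) \<in> borel_measurable borel"
      using cm(1) cm'(1) by simp
    show "integrable \<eta> (\<lambda>x. (1 - t) * cond_mean \<eta> \<pi> x + t * cond_mean \<eta> \<pi>' x)"
      using cm(2) cm'(2) by simp
    fix h :: "real \<Rightarrow> real" assume h: "h \<in> borel_measurable borel" "\<And>x. \<bar>h x\<bar> \<le> 1"
    have i: "integrable \<eta> (\<lambda>x. h x * cond_mean \<eta> \<pi> x)" "integrable \<eta> (\<lambda>x. h x * cond_mean \<eta> \<pi>' x)"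
      by (rule integrable_bounded_times[OF cm(2) measurable_if_sets_borel[OF c(7) h(1)] h(2)]
          integrable_bounded_times[OF cm'(2) measurable_if_sets_borel[OF c(7) h(1)] h(2)])+
    have i2: "integrable \<pi> (\<lambda>z. h (fst z) * snd z)" "integrable \<pi>' (\<lambda>z. h (fst z) * snd z)"
      by (rule integrable_bounded_times[OF ic(3) measurable_if_sets_borel[OF c(1) borel_measurable_fst_real[OF h(1)]] h(2)]
          integrable_bounded_times[OF ic'(3) measurable_if_sets_borel[OF c'(1) borel_measurable_fst_real[OF h(1)]] h(2)])+
    have "(\<integral>x. h x * ((1 - t) * cond_mean \<eta> \<pi> x + t * cond_mean \<eta> \<pi>' x) \<partial>\<eta>)
        = (\<integral>x. (1 - t) * (h x * cond_mean \<eta> \<pi> x) + t * (h x * cond_mean \<eta> \<pi>' x) \<partial>\<eta>)"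
      by (intro Bochner_Integration.integral_cong) (auto simp: algebra_simps)
    also have "\<dots> = (1 - t) * (\<integral>z. h (fst z) * snd z \<partial>\<pi>) + t * (\<integral>z. h (fst z) * snd z \<partial>\<pi>')"
      using i cm(3)[OF h] cm'(3)[OF h] by simp
    also have "\<dots> = (\<integral>z. h (fst z) * snd z \<partial>\<rho>)" by (rule int\<rho>[OF i2, symmetric])
    finally show "(\<integral>x. h x * ((1 - t) * cond_mean \<eta> \<pi> x + t * cond_mean \<eta> \<pi>' x) \<partial>\<eta>) = (\<integral>z. h (fst z) * snd z \<partial>\<rho>)" .
  qed
  then show ?thesis using \<rho> by blast
qed

text \<open>A convex approximation of the absolute value with a derivative \<open>t / smooth_abs \<epsilon>
  t\<close> in \<open>[-1, 1]\<close> that is Lipschitz with constant \<open>1 / \<epsilon>\<close>.\<close>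

definition smooth_abs :: "real \<Rightarrow> real \<Rightarrow> real" where
  "smooth_abs \<epsilon> t = sqrt (t\<^sup>2 + \<epsilon>\<^sup>2)"

lemma smooth_abs_basic:
  assumes "0 < \<epsilon>"
  shows "\<bar>t\<bar> \<le> smooth_abs \<epsilon> t" "\<epsilon> \<le> smooth_abs \<epsilon> t" "0 < smooth_abs \<epsilon> t" "smooth_abs \<epsilon> t \<le> \<bar>t\<bar> + \<epsilon>"
    "\<bar>t / smooth_abs \<epsilon> t\<bar> \<le> 1" "smooth_abs \<epsilon> t - \<epsilon> \<le> t / smooth_abs \<epsilon> t * t"
proof -
  show a: "\<bar>t\<bar> \<le> smooth_abs \<epsilon> t" unfolding smooth_abs_def real_sqrt_abs[symmetric] by simp
  show b: "\<epsilon> \<le> smooth_abs \<epsilon> t" unfolding smooth_abs_def by (rule real_sqrt_sum_squares_ge2)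
  then show p: "0 < smooth_abs \<epsilon> t" using assms by simp
  show "smooth_abs \<epsilon> t \<le> \<bar>t\<bar> + \<epsilon>"
    using assms sqrt_sum_squares_le_sum_abs[of t \<epsilon>] by (simp add: smooth_abs_def)
  show "\<bar>t / smooth_abs \<epsilon> t\<bar> \<le> 1" using a p by simp
  have "(smooth_abs \<epsilon> t)\<^sup>2 = t\<^sup>2 + \<epsilon>\<^sup>2" unfolding smooth_abs_def by simp
  moreover have "\<epsilon> * \<epsilon> \<le> \<epsilon> * smooth_abs \<epsilon> t" using assms b by simp
  ultimately have "(smooth_abs \<epsilon> t - \<epsilon>) * smooth_abs \<epsilon> t \<le> t * t"
    by (simp add: algebra_simps power2_eq_square)
  then show "smooth_abs \<epsilon> t - \<epsilon> \<le> t / smooth_abs \<epsilon> t * t" using p by (simp add: field_simps)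
qed

lemma smooth_abs_lipschitz: "smooth_abs \<epsilon> b \<le> smooth_abs \<epsilon> a + \<bar>b - a\<bar>"
  using real_sqrt_sum_squares_triangle_ineq[of a "b - a" \<epsilon> 0] by (simp add: smooth_abs_def)

text \<open>The second-order upper bound follows from \<open>2 * A * B \<le> A\<^sup>2 + B\<^sup>2\<close> for
  the two values of \<open>smooth_abs\<close>.\<close>

lemma smooth_abs_upper:
  assumes "0 < \<epsilon>"
  shows "smooth_abs \<epsilon> b \<le> smooth_abs \<epsilon> a + a / smooth_abs \<epsilon> a * (b - a) + (b - a)\<^sup>2 / (2 * \<epsilon>)"
proof -
  define A where "A = smooth_abs \<epsilon> a"
  define B where "B = smooth_abs \<epsilon> b"
  have A: "0 < A" "\<epsilon> \<le> A" using smooth_abs_basic[OF assms] by (auto simp: A_def)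
  have sq: "A\<^sup>2 = a\<^sup>2 + \<epsilon>\<^sup>2" "B\<^sup>2 = b\<^sup>2 + \<epsilon>\<^sup>2" by (auto simp: A_def B_def smooth_abs_def)
  have "2 * A * B \<le> A\<^sup>2 + B\<^sup>2" using sum_squares_bound[of A B] by simp
  then have "2 * A * B \<le> 2 * A\<^sup>2 + 2 * a * (b - a) + (b - a)\<^sup>2"
    unfolding sq by (simp add: power2_eq_square algebra_simps)
  then have "B \<le> (2 * A\<^sup>2 + 2 * a * (b - a) + (b - a)\<^sup>2) / (2 * A)"
    using A by (simp add: pos_le_divide_eq mult.commute mult.left_commute)
  also have "\<dots> = A + a / A * (b - a) + (b - a)\<^sup>2 / (2 * A)"
    using A by (simp add: field_simps power2_eq_square)
  also have "(b - a)\<^sup>2 / (2 * A) \<le> (b - a)\<^sup>2 / (2 * \<epsilon>)"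
    using A assms by (intro divide_left_mono) auto
  finally show ?thesis by (simp add: A_def B_def)
qed

text \<open>The second-order bound needs square integrable increments, which first moments do not provide. So
  the increment is truncated at \<open>2 * R\<close>; what is cut off costs only a Lipschitz term, and it is
  controlled by the tails of \<open>m\<close> and \<open>m'\<close> beyond \<open>R\<close>.\<close>

lemma smooth_abs_step:
  fixes R t d m m' :: real
  assumes \<epsilon>: "0 < \<epsilon>" and R: "0 \<le> R" and t: "0 \<le> t"
  shows "smooth_abs \<epsilon> (d - t * (m' - m)) \<le> smooth_abs \<epsilon> d - t * (d / smooth_abs \<epsilon> d * (m' - m))
    + 2 * t * (max (\<bar>m\<bar> - R) 0 + max (\<bar>m'\<bar> - R) 0) + 2 * t\<^sup>2 * R\<^sup>2 / \<epsilon>"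
proof -
  define w where "w = d / smooth_abs \<epsilon> d"
  define h where "h = m' - m"
  define h' where "h' = max (- 2 * R) (min (2 * R) h)"
  define \<Delta> where "\<Delta> = max (\<bar>m\<bar> - R) 0 + max (\<bar>m'\<bar> - R) 0"
  have w: "\<bar>w\<bar> \<le> 1" unfolding w_def by (rule smooth_abs_basic(5)[OF \<epsilon>])
  have \<Delta>: "\<bar>h - h'\<bar> \<le> \<Delta>" using R by (auto simp: h'_def h_def \<Delta>_def max_def min_def abs_if)
  have "\<bar>h'\<bar> \<le> 2 * R" using R by (auto simp: h'_def)
  then have "h'\<^sup>2 \<le> (2 * R)\<^sup>2" by (metis abs_ge_zero power2_abs power_mono)
  then have h'2: "t\<^sup>2 * h'\<^sup>2 / (2 * \<epsilon>) \<le> t\<^sup>2 * (2 * R)\<^sup>2 / (2 * \<epsilon>)"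
    using \<epsilon> by (intro divide_right_mono mult_left_mono) auto
  have "smooth_abs \<epsilon> (d - t * h) \<le> smooth_abs \<epsilon> (d - t * h') + \<bar>(d - t * h) - (d - t * h')\<bar>"
    by (rule smooth_abs_lipschitz)
  also have "\<bar>(d - t * h) - (d - t * h')\<bar> = t * \<bar>h - h'\<bar>"
  proof -
    have "(d - t * h) - (d - t * h') = - (t * (h - h'))" by (simp add: algebra_simps)
    then show ?thesis using t by (simp add: abs_mult)
  qed
  also have "smooth_abs \<epsilon> (d - t * h') \<le> smooth_abs \<epsilon> d + w * (- t * h') + t\<^sup>2 * h'\<^sup>2 / (2 * \<epsilon>)"
    using smooth_abs_upper[OF \<epsilon>, of "d - t * h'" d] by (simp add: w_def power_mult_distrib)
  finally have 1: "smooth_abs \<epsilon> (d - t * h) \<le> smooth_abs \<epsilon> d + w * (- t * h') + t\<^sup>2 * (2 * R)\<^sup>2 / (2 * \<epsilon>) + t * \<bar>h - h'\<bar>"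
    using h'2 by linarith
  have "w * (h - h') \<le> \<bar>w\<bar> * \<bar>h - h'\<bar>" by (metis abs_ge_self abs_mult)
  also have "\<dots> \<le> 1 * \<Delta>" using w \<Delta> by (intro mult_mono) auto
  finally have "t * (w * (h - h')) \<le> t * \<Delta>" using t by (intro mult_left_mono) auto
  moreover have "t * \<bar>h - h'\<bar> \<le> t * \<Delta>" using t \<Delta> by (intro mult_left_mono)
  moreover have "t\<^sup>2 * (2 * R)\<^sup>2 / (2 * \<epsilon>) = 2 * t\<^sup>2 * R\<^sup>2 / \<epsilon>" using \<epsilon> by (simp add: field_simps power2_eq_square)
  moreover have "w * (- t * h') = - (t * (w * h)) + t * (w * (h - h'))" by (simp add: algebra_simps)
  ultimately show ?thesis using 1 unfolding w_def[symmetric] h_def[symmetric] \<Delta>_def[symmetric] by linarith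
qed

lemma tail_tendsto_0:
  assumes \<nu>: "\<nu> \<in> fin_meas"
  shows "(\<lambda>n. \<integral>y. max (\<bar>y\<bar> - real n) 0 \<partial>\<nu>) \<longlonglongrightarrow> 0"
proof -
  note f = fin_measD[OF \<nu>]
  have m: "(\<lambda>y. max (\<bar>y\<bar> - real n) 0) \<in> borel_measurable \<nu>" for n
    by (rule measurable_if_sets_borel[OF f(1)]) simp
  have "(\<lambda>n. \<integral>y. max (\<bar>y\<bar> - real n) 0 \<partial>\<nu>) \<longlonglongrightarrow> (\<integral>y. 0 \<partial>\<nu>)"
  proof (rule integral_dominated_convergence[where w="\<lambda>y. \<bar>y\<bar>"])
    show "AE y in \<nu>. (\<lambda>n. max (\<bar>y\<bar> - real n) 0) \<longlonglongrightarrow> 0"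
    proof (rule AE_I2, rule tendsto_eventually)
      fix y :: real
      show "\<forall>\<^sub>F n in sequentially. max (\<bar>y\<bar> - real n) 0 = 0"
        using eventually_ge_at_top[of "nat \<lceil>\<bar>y\<bar>\<rceil>"] by eventually_elim linarith
    qed
    show "AE y in \<nu>. norm (max (\<bar>y\<bar> - real n) 0) \<le> \<bar>y\<bar>" for n by (auto intro!: AE_I2)
    show "(\<lambda>y. 0) \<in> borel_measurable \<nu>" by (rule measurable_const) simp
    show "integrable \<nu> (\<lambda>y. \<bar>y\<bar>)" using f(4) by (rule integrable_abs)
  qed (rule m)
  then show ?thesis by simp
qed

text \<open>Conditional means are uniformly integrable, with a bound that depends only on the second
  marginal.\<close>

lemma tail_cond_mean_le:
  assumes "\<pi> \<in> couplings \<eta> \<xi>" "\<eta> \<in> fin_meas" "\<xi> \<in> fin_meas" and R: "0 \<le> R"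
  shows "integrable \<eta> (\<lambda>x. max (\<bar>cond_mean \<eta> \<pi> x\<bar> - R) 0)"
    "(\<integral>x. max (\<bar>cond_mean \<eta> \<pi> x\<bar> - R) 0 \<partial>\<eta>) \<le> (\<integral>y. max (\<bar>y\<bar> - R) 0 \<partial>\<xi>)"
proof -
  note cm = cond_mean_fin(2)[OF assms(1-3)] and f = fin_measD[OF assms(2)] and g = fin_measD[OF assms(3)]
  note b = bary_cond_mean[OF assms(1-3)] and mass = measure_coupling[OF assms(1)]
  show "integrable \<eta> (\<lambda>x. max (\<bar>cond_mean \<eta> \<pi> x\<bar> - R) 0)"
    using cm f(5) by (intro integrable_max) auto
  have split: "max (\<bar>y\<bar> - R) 0 = max (R - y) 0 + (y - R) + max (- R - y) 0" for y
    using R by (auto simp: max_def abs_if)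
  have im: "integrable \<eta> (\<lambda>x. max (k - cond_mean \<eta> \<pi> x) 0)" for k
    using cm f(5) by (intro integrable_max) auto
  have "(\<integral>x. max (\<bar>cond_mean \<eta> \<pi> x\<bar> - R) 0 \<partial>\<eta>) =
    (\<integral>x. max (R - cond_mean \<eta> \<pi> x) 0 \<partial>\<eta>) + (bary \<xi> - measure \<eta> UNIV * R) + (\<integral>x. max (- R - cond_mean \<eta> \<pi> x) 0 \<partial>\<eta>)"
    unfolding split using im[of R] im[of "-R"] cm f by (simp add: b)
  also have "\<dots> \<le> put_fun \<xi> R + (bary \<xi> - measure \<xi> UNIV * R) + put_fun \<xi> (- R)"
    unfolding mass by (intro add_mono put_cond_mean_le[OF assms(1-3)] order_refl)
  also have "\<dots> = (\<integral>y. max (\<bar>y\<bar> - R) 0 \<partial>\<xi>)"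
    unfolding split using g by (simp add: put_fun_def bary_def)
  finally show "(\<integral>x. max (\<bar>cond_mean \<eta> \<pi> x\<bar> - R) 0 \<partial>\<eta>) \<le> (\<integral>y. max (\<bar>y\<bar> - R) 0 \<partial>\<xi>)" .
qed

text \<open>Take a near minimiser \<open>\<pi>\<close> of the smoothed cost, with derivative \<open>w\<close>.
  Moving a little towards the best response \<open>\<pi>'\<close> to \<open>w\<close> hardly improves the
  cost, so \<open>\<pi>\<close> is nearly as good against \<open>w\<close> as \<open>\<pi>'\<close>, for which
  the weighted displacement is at most \<open>p_gap \<mu> \<nu> + c_gap \<mu> \<nu>\<close>. For
  \<open>\<pi>\<close> itself, the weighted displacement is nearly the cost.\<close>

lemma near_optimal_coupling_exists:
  assumes \<mu>: "\<mu> \<in> fin_meas" and \<nu>: "\<nu> \<in> fin_meas"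
    and mass: "measure \<mu> UNIV = measure \<nu> UNIV" "0 < measure \<mu> UNIV"
    and pc: "0 \<le> p_gap \<mu> \<nu>" "0 \<le> c_gap \<mu> \<nu>" and e: "0 < e"
  shows "\<exists>\<pi>\<in>couplings \<mu> \<nu>. cost \<mu> \<pi> \<le> p_gap \<mu> \<nu> + c_gap \<mu> \<nu> + e"
proof -
  note f = fin_measD[OF \<mu>]
  \<comment> \<open>Of the error \<open>e\<close>, one quarter each goes to smoothing
    (\<open>\<epsilon>\<close>), to the tails beyond \<open>R\<close>, to the quadratic term of a step of
    length \<open>t\<close>, and to the near-minimality of \<open>\<pi>\<close>.\<close>
  define M where "M = measure \<mu> UNIV"
  have M: "0 < M" using mass by (simp add: M_def)
  define \<epsilon> where "\<epsilon> = e / (4 * M)"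
  have \<epsilon>: "0 < \<epsilon>" "\<epsilon> * M = e / 4" using e M by (auto simp: \<epsilon>_def)
  have "\<forall>\<^sub>F n in sequentially. (\<integral>y. max (\<bar>y\<bar> - real n) 0 \<partial>\<nu>) < e / 16"
    using e by (intro order_tendstoD(2)[OF tail_tendsto_0[OF \<nu>]]) simp
  then obtain n where n: "(\<integral>y. max (\<bar>y\<bar> - real n) 0 \<partial>\<nu>) < e / 16"
    using eventually_happens'[OF sequentially_bot] by blast
  define R where "R = real n"
  have R: "0 \<le> R" by (simp add: R_def)
  define t where "t = min 1 (e * \<epsilon> / (8 * M * (R\<^sup>2 + 1)))"
  have R1: "0 < R\<^sup>2 + 1" by (simp add: add_nonneg_pos)
  have t: "0 < t" "t \<le> 1" using e \<epsilon>(1) M R1 by (simp_all add: t_def)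
  have tR: "2 * t * R\<^sup>2 / \<epsilon> * M \<le> e / 4"
  proof -
    have "t * (8 * M * (R\<^sup>2 + 1)) \<le> e * \<epsilon>"
      using M R1 by (simp add: t_def pos_le_divide_eq[symmetric])
    moreover have "t * (8 * M * R\<^sup>2) \<le> t * (8 * M * (R\<^sup>2 + 1))"
      using t M by (intro mult_left_mono) auto
    ultimately have "8 * (t * M * R\<^sup>2) \<le> e * \<epsilon>" by (simp add: algebra_simps)
    then show ?thesis using \<epsilon>(1) by (simp add: field_simps)
  qed
  define J where "J \<pi> = (\<integral>x. smooth_abs \<epsilon> (x - cond_mean \<mu> \<pi> x) \<partial>\<mu>)" for \<pi>
  have sm[measurable]: "smooth_abs \<epsilon> \<in> borel_measurable borel" unfolding smooth_abs_def[abs_def] by measurable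
  have Ji: "integrable \<mu> (\<lambda>x. smooth_abs \<epsilon> (x - cond_mean \<mu> \<pi> x))" if "\<pi> \<in> couplings \<mu> \<nu>" for \<pi>
  proof (rule Bochner_Integration.integrable_bound[where f="\<lambda>x. \<bar>x - cond_mean \<mu> \<pi> x\<bar> + \<epsilon>"])
    note cm = cond_mean_fin(1,2)[OF that \<mu> \<nu>]
    note cm(1)[measurable]
    show "integrable \<mu> (\<lambda>x. \<bar>x - cond_mean \<mu> \<pi> x\<bar> + \<epsilon>)"
      using cm(2) f(4,5) by (intro Bochner_Integration.integrable_add integrable_abs Bochner_Integration.integrable_diff)
    show "(\<lambda>x. smooth_abs \<epsilon> (x - cond_mean \<mu> \<pi> x)) \<in> borel_measurable \<mu>"
      by (rule measurable_if_sets_borel[OF f(1)]) measurable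
    show "AE x in \<mu>. norm (smooth_abs \<epsilon> (x - cond_mean \<mu> \<pi> x)) \<le> norm (\<bar>x - cond_mean \<mu> \<pi> x\<bar> + \<epsilon>)"
      using smooth_abs_basic(3,4)[OF \<epsilon>(1)] \<epsilon>(1) by (intro AE_I2) (simp add: less_imp_le)
  qed
  have ne: "couplings \<mu> \<nu> \<noteq> {}" using best_response[OF \<mu> \<nu> mass pc, of "\<lambda>x. 0"] by auto
  have bdd: "bdd_below (J ` couplings \<mu> \<nu>)"
    using smooth_abs_basic(3)[OF \<epsilon>(1)] by (intro bdd_belowI[where m=0]) (auto simp: J_def less_imp_le intro!: integral_nonneg_AE AE_I2)
  obtain \<pi> where \<pi>: "\<pi> \<in> couplings \<mu> \<nu>" and "J \<pi> < (INF \<rho>\<in>couplings \<mu> \<nu>. J \<rho>) + t * (e / 4)"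
    using cINF_less_iff[OF ne bdd, of "(INF \<rho>\<in>couplings \<mu> \<nu>. J \<rho>) + t * (e / 4)"] t e by auto
  then have near: "J \<pi> \<le> J \<rho> + t * (e / 4)" if "\<rho> \<in> couplings \<mu> \<nu>" for \<rho>
    using cINF_lower[OF bdd that] by simp
  define m where "m = cond_mean \<mu> \<pi>"
  note cm = cond_mean_fin[OF \<pi> \<mu> \<nu>, folded m_def]
  note cm(1)[measurable]
  \<comment> \<open>The derivative of the smoothed cost with respect to the displacement \<open>x - m x\<close>;
    \<open>\<pi>'\<close> below is the best response to it.\<close>
  define w where "w x = (x - m x) / smooth_abs \<epsilon> (x - m x)" for x
  have wb[measurable]: "w \<in> borel_measurable borel" unfolding w_def[abs_def] by measurable
  have w1: "\<bar>w x\<bar> \<le> 1" for x unfolding w_def by (rule smooth_abs_basic(5)[OF \<epsilon>(1)])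
  have w\<mu>: "w \<in> borel_measurable \<mu>" by (rule measurable_if_sets_borel[OF f(1) wb])
  obtain \<pi>' where \<pi>': "\<pi>' \<in> couplings \<mu> \<nu>" and br: "(\<integral>z. w (fst z) * (fst z - snd z) \<partial>\<pi>') \<le> p_gap \<mu> \<nu> + c_gap \<mu> \<nu>"
    using best_response[OF \<mu> \<nu> mass pc wb w1] by blast
  define m' where "m' = cond_mean \<mu> \<pi>'"
  note cm' = cond_mean_fin[OF \<pi>' \<mu> \<nu>, folded m'_def]
  have wi: "integrable \<mu> (\<lambda>x. w x * g x)" if "integrable \<mu> g" for g
    using that w\<mu> w1 by (rule integrable_bounded_times)
  have resp: "(\<integral>x. w x * (x - m' x) \<partial>\<mu>) \<le> p_gap \<mu> \<nu> + c_gap \<mu> \<nu>"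
    unfolding m'_def integral_shift_test(3)[OF \<pi>' \<mu> \<nu> wb w1] by (rule br)
  obtain \<rho> where \<rho>: "\<rho> \<in> couplings \<mu> \<nu>" and m\<rho>: "AE x in \<mu>. cond_mean \<mu> \<rho> x = (1 - t) * m x + t * m' x"
    using mixture_coupling[OF \<mu> \<nu> \<pi> \<pi>', of t] t unfolding m_def m'_def by auto
  note tail = tail_cond_mean_le[OF \<pi> \<mu> \<nu> R, folded m_def] and tail' = tail_cond_mean_le[OF \<pi>' \<mu> \<nu> R, folded m'_def]
  have T: "(\<integral>y. max (\<bar>y\<bar> - R) 0 \<partial>\<nu>) < e / 16" using n by (simp add: R_def)
  define u where "u x = smooth_abs \<epsilon> (x - m x) - t * (w x * (m' x - m x)) +
    2 * t * (max (\<bar>m x\<bar> - R) 0 + max (\<bar>m' x\<bar> - R) 0) + 2 * t\<^sup>2 * R\<^sup>2 / \<epsilon>" for x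
  have ui: "integrable \<mu> u"
    unfolding u_def[abs_def] using Ji[OF \<pi>, folded m_def] wi[of "\<lambda>x. m' x - m x"] cm(2) cm'(2) tail(1) tail'(1) f(5)
    by (intro Bochner_Integration.integrable_add Bochner_Integration.integrable_diff integrable_mult_right) auto
  \<comment> \<open>Near-minimality against the mixture \<open>\<rho>\<close>: the directional derivative
    towards \<open>\<pi>'\<close> cannot be very negative.\<close>
  have "J \<pi> \<le> J \<rho> + t * (e / 4)" by (rule near[OF \<rho>])
  also have "J \<rho> \<le> (\<integral>x. u x \<partial>\<mu>)"
    unfolding J_def
  proof (rule integral_mono_AE[OF Ji[OF \<rho>] ui])
    show "AE x in \<mu>. smooth_abs \<epsilon> (x - cond_mean \<mu> \<rho> x) \<le> u x"
      using m\<rho>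
    proof eventually_elim
      case (elim x)
      have eq: "x - cond_mean \<mu> \<rho> x = (x - m x) - t * (m' x - m x)" unfolding elim by (simp add: algebra_simps)
      show ?case unfolding u_def w_def eq using t by (intro smooth_abs_step \<epsilon>(1) R) simp
    qed
  qed
  also have "(\<integral>x. u x \<partial>\<mu>) = J \<pi> - t * (\<integral>x. w x * (m' x - m x) \<partial>\<mu>) +
      2 * t * ((\<integral>x. max (\<bar>m x\<bar> - R) 0 \<partial>\<mu>) + (\<integral>x. max (\<bar>m' x\<bar> - R) 0 \<partial>\<mu>)) + M * (2 * t\<^sup>2 * R\<^sup>2 / \<epsilon>)"
    unfolding u_def J_def m_def[symmetric] M_def
    using Ji[OF \<pi>, folded m_def] wi[of "\<lambda>x. m' x - m x"] cm(2) cm'(2) tail(1) tail'(1) f(2,5) by simp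
  finally have "t * (\<integral>x. w x * (m' x - m x) \<partial>\<mu>) \<le>
      2 * t * ((\<integral>x. max (\<bar>m x\<bar> - R) 0 \<partial>\<mu>) + (\<integral>x. max (\<bar>m' x\<bar> - R) 0 \<partial>\<mu>)) + M * (2 * t\<^sup>2 * R\<^sup>2 / \<epsilon>) + t * (e / 4)"
    by simp
  also have "\<dots> = t * (2 * ((\<integral>x. max (\<bar>m x\<bar> - R) 0 \<partial>\<mu>) + (\<integral>x. max (\<bar>m' x\<bar> - R) 0 \<partial>\<mu>)) + 2 * t * R\<^sup>2 / \<epsilon> * M + e / 4)"
    by (simp add: algebra_simps power2_eq_square)
  finally have "(\<integral>x. w x * (m' x - m x) \<partial>\<mu>) \<le>
      2 * ((\<integral>x. max (\<bar>m x\<bar> - R) 0 \<partial>\<mu>) + (\<integral>x. max (\<bar>m' x\<bar> - R) 0 \<partial>\<mu>)) + 2 * t * R\<^sup>2 / \<epsilon> * M + e / 4"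
    using t by (simp only: mult_le_cancel_left_pos)
  moreover have "i \<le> 3 * (e / 4)" if "i \<le> 2 * (a + b) + q + e / 4" "a \<le> T" "b \<le> T" "T < e / 16" "q \<le> e / 4"
    for i a b q T :: real
    using that by argo
  ultimately have 1: "(\<integral>x. w x * (m' x - m x) \<partial>\<mu>) \<le> 3 * (e / 4)"
    using tail(2) tail'(2) T tR by blast
  have "cost \<mu> \<pi> - \<epsilon> * M = (\<integral>x. \<bar>x - m x\<bar> - \<epsilon> \<partial>\<mu>)"
    unfolding cost_cond_mean m_def[symmetric] M_def using f(2,4,5) cm(2) by simp
  also have "\<dots> \<le> (\<integral>x. w x * (x - m' x) + w x * (m' x - m x) \<partial>\<mu>)"
  proof (rule integral_mono)
    show "integrable \<mu> (\<lambda>x. \<bar>x - m x\<bar> - \<epsilon>)"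
      using cm(2) f(4,5) by (intro integrable_abs Bochner_Integration.integrable_diff)
    show "integrable \<mu> (\<lambda>x. w x * (x - m' x) + w x * (m' x - m x))"
      using wi[of "\<lambda>x. x - m' x"] wi[of "\<lambda>x. m' x - m x"] f(4) cm(2) cm'(2) by auto
    fix x
    have "smooth_abs \<epsilon> (x - m x) - \<epsilon> \<le> w x * (x - m x)" unfolding w_def by (rule smooth_abs_basic(6)[OF \<epsilon>(1)])
    then show "\<bar>x - m x\<bar> - \<epsilon> \<le> w x * (x - m' x) + w x * (m' x - m x)"
      using smooth_abs_basic(1)[OF \<epsilon>(1), of "x - m x"] by (simp add: algebra_simps)
  qed
  also have "\<dots> = (\<integral>x. w x * (x - m' x) \<partial>\<mu>) + (\<integral>x. w x * (m' x - m x) \<partial>\<mu>)"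
    using wi[of "\<lambda>x. x - m' x"] wi[of "\<lambda>x. m' x - m x"] f(4) cm(2) cm'(2) by simp
  finally have "cost \<mu> \<pi> \<le> p_gap \<mu> \<nu> + c_gap \<mu> \<nu> + e" using resp 1 \<epsilon>(2) by linarith
  then show ?thesis using \<pi> by blast
qed

lemma V_eq_gaps:
  assumes \<mu>: "\<mu> \<in> fin_meas" and \<nu>: "\<nu> \<in> fin_meas"
    and mass: "measure \<mu> UNIV = measure \<nu> UNIV" "0 < measure \<mu> UNIV"
    and pc: "0 \<le> p_gap \<mu> \<nu>" "0 \<le> c_gap \<mu> \<nu>"
  shows "V \<mu> \<nu> = p_gap \<mu> \<nu> + c_gap \<mu> \<nu>"
proof (rule antisym)
  have bdd: "bdd_below (cost \<mu> ` couplings \<mu> \<nu>)"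
    using cost_ge[OF _ \<mu> \<nu>] by (intro bdd_belowI[where m="p_gap \<mu> \<nu> + c_gap \<mu> \<nu>"]) auto
  show "V \<mu> \<nu> \<le> p_gap \<mu> \<nu> + c_gap \<mu> \<nu>"
  proof (rule field_le_epsilon)
    fix e :: real assume "0 < e"
    from near_optimal_coupling_exists[OF \<mu> \<nu> mass pc this]
    obtain \<pi> where "\<pi> \<in> couplings \<mu> \<nu>" "cost \<mu> \<pi> \<le> p_gap \<mu> \<nu> + c_gap \<mu> \<nu> + e" by blast
    then show "V \<mu> \<nu> \<le> p_gap \<mu> \<nu> + c_gap \<mu> \<nu> + e"
      unfolding V_def by (intro order_trans[OF cINF_lower[OF bdd]])
  qed
  have "couplings \<mu> \<nu> \<noteq> {}" using near_optimal_coupling_exists[OF \<mu> \<nu> mass pc, of 1] by auto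
  then show "p_gap \<mu> \<nu> + c_gap \<mu> \<nu> \<le> V \<mu> \<nu>"
    unfolding V_def using cost_ge[OF _ \<mu> \<nu>] by (intro cINF_greatest)
qed

section \<open>Contact points and one-sided derivatives\<close>

text \<open>The slope of \<open>\<lambda>k. max (k - x) 0\<close> between \<open>a\<close> and
  \<open>b\<close> is \<open>1\<close> for \<open>x \<le> a\<close>, \<open>0\<close> for \<open>x \<ge>
  b\<close>, and in between otherwise.\<close>

lemma put_fun_increment:
  assumes \<eta>: "\<eta> \<in> fin_meas" and ab: "a \<le> b"
  shows "(b - a) * measure \<eta> {..a} \<le> put_fun \<eta> b - put_fun \<eta> a"
    "put_fun \<eta> b - put_fun \<eta> a \<le> (b - a) * measure \<eta> {..<b}"
proof -
  note f = fin_measD[OF \<eta>]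
  interpret finite_measure \<eta> by fact
  have diff: "put_fun \<eta> b - put_fun \<eta> a = (\<integral>x. max (b - x) 0 - max (a - x) 0 \<partial>\<eta>)"
    using f(6) by (simp add: put_fun_def)
  have s: "{..a} \<in> sets \<eta>" "{..<b} \<in> sets \<eta>" using f(1) by auto
  have i: "integrable \<eta> (\<lambda>x. (b - a) * indicator {..a} x)" "integrable \<eta> (\<lambda>x. (b - a) * indicator {..<b} x)"
    using s by (auto simp: emeasure_eq_measure intro!: integrable_mult_right integrable_real_indicator)
  have "(\<integral>x. (b - a) * indicator {..a} x \<partial>\<eta>) \<le> (\<integral>x. max (b - x) 0 - max (a - x) 0 \<partial>\<eta>)"
    using i f(6) ab by (intro integral_mono) (auto simp: indicator_def)
  then show "(b - a) * measure \<eta> {..a} \<le> put_fun \<eta> b - put_fun \<eta> a"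
    using f(2) by (simp add: diff)
  have "(\<integral>x. max (b - x) 0 - max (a - x) 0 \<partial>\<eta>) \<le> (\<integral>x. (b - a) * indicator {..<b} x \<partial>\<eta>)"
    using i f(6) ab by (intro integral_mono) (auto simp: indicator_def)
  then show "put_fun \<eta> b - put_fun \<eta> a \<le> (b - a) * measure \<eta> {..<b}"
    using f(2) by (simp add: diff)
qed

lemma put_fun_one_sided_derivs:
  assumes \<eta>: "\<eta> \<in> fin_meas"
  shows "left_deriv (\<lambda>k. put_fun \<eta> k + c) k = measure \<eta> {..<k}"
    and "right_deriv (\<lambda>k. put_fun \<eta> k + c) k = measure \<eta> {..k}"
proof -
  note f = fin_measD[OF \<eta>]
  interpret finite_borel_measure \<eta>
    unfolding finite_borel_measure_def finite_borel_measure_axioms_def using f(1,3) by simp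
  let ?q = "\<lambda>y. ((put_fun \<eta> y + c) - (put_fun \<eta> k + c)) / (y - k)"
  have ql: "cdf \<eta> y \<le> ?q y \<and> ?q y \<le> measure \<eta> {..<k}" if "y < k" for y
  proof -
    have "?q y = (put_fun \<eta> k - put_fun \<eta> y) / (k - y)"
      using that by (simp add: divide_simps) (simp add: algebra_simps)
    then show ?thesis
      using that put_fun_increment[OF \<eta>, of y k]
      by (simp add: cdf_def pos_le_divide_eq pos_divide_le_eq mult.commute)
  qed
  have qr: "measure \<eta> {..k} \<le> ?q y \<and> ?q y \<le> cdf \<eta> y" if "k < y" for y
  proof -
    have "(y - k) * measure \<eta> {..<y} \<le> (y - k) * cdf \<eta> y"
      unfolding cdf_def using that f(1) by (intro mult_left_mono finite_measure_mono) auto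
    then have "put_fun \<eta> y - put_fun \<eta> k \<le> (y - k) * cdf \<eta> y"
      using that put_fun_increment(2)[OF \<eta>, of k y] by linarith
    then show ?thesis
      using that put_fun_increment(1)[OF \<eta>, of k y]
      by (simp add: pos_le_divide_eq pos_divide_le_eq mult.commute)
  qed
  have "(?q \<longlongrightarrow> measure \<eta> {..<k}) (at_left k)"
    by (rule tendsto_sandwich[OF _ _ cdf_at_left tendsto_const])
      (use ql in \<open>auto intro!: eventually_mono[OF eventually_at_left_real[of "k - 1" k]]\<close>)
  then have "((\<lambda>k. put_fun \<eta> k + c) has_vector_derivative measure \<eta> {..<k}) (at_left k)"
    unfolding has_real_derivative_iff_has_vector_derivative[symmetric] has_field_derivative_iff .
  then show "left_deriv (\<lambda>k. put_fun \<eta> k + c) k = measure \<eta> {..<k}"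
    by (intro vector_derivative_within) auto
  have "(cdf \<eta> \<longlongrightarrow> cdf \<eta> k) (at_right k)"
    using cdf_is_right_cont[of k] by (simp add: continuous_within)
  then have cr: "(cdf \<eta> \<longlongrightarrow> measure \<eta> {..k}) (at_right k)" by (simp add: cdf_def)
  have "(?q \<longlongrightarrow> measure \<eta> {..k}) (at_right k)"
    by (rule tendsto_sandwich[OF _ _ tendsto_const cr])
      (use qr in \<open>auto intro!: eventually_mono[OF eventually_at_right_real[of k "k + 1"]]\<close>)
  then have "((\<lambda>k. put_fun \<eta> k + c) has_vector_derivative measure \<eta> {..k}) (at_right k)"
    unfolding has_real_derivative_iff_has_vector_derivative[symmetric] has_field_derivative_iff .
  then show "right_deriv (\<lambda>k. put_fun \<eta> k + c) k = measure \<eta> {..k}"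
    by (intro vector_derivative_within) auto
qed

lemma put_fun_continuous:
  assumes \<eta>: "\<eta> \<in> fin_meas"
  shows "continuous_on UNIV (put_fun \<eta>)"
proof -
  note f = fin_measD[OF \<eta>]
  interpret finite_measure \<eta> by fact
  have le: "\<bar>put_fun \<eta> b - put_fun \<eta> a\<bar> \<le> measure \<eta> UNIV * (b - a)" if "a \<le> b" for a b
  proof -
    have "0 \<le> (b - a) * measure \<eta> {..a}" using that by simp
    moreover have "(b - a) * measure \<eta> {..<b} \<le> (b - a) * measure \<eta> UNIV"
      using that bounded_measure[of "{..<b}"] f(2) by (intro mult_left_mono) auto
    ultimately show ?thesis using put_fun_increment[OF \<eta> that] by (simp add: mult.commute)
  qed
  have "(measure \<eta> UNIV)-lipschitz_on UNIV (put_fun \<eta>)"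
  proof (rule lipschitz_onI)
    fix x y :: real
    show "dist (put_fun \<eta> x) (put_fun \<eta> y) \<le> measure \<eta> UNIV * dist x y"
      using le[of x y] le[of y x] by (cases "x \<le> y") (auto simp: dist_real_def abs_minus_commute)
  qed simp
  then show ?thesis by (rule lipschitz_on_continuous_on)
qed

lemma put_tail:
  assumes \<eta>: "\<eta> \<in> fin_meas" and k: "k \<le> - real n"
  shows "put_fun \<eta> k \<le> (\<integral>y. max (\<bar>y\<bar> - real n) 0 \<partial>\<eta>)"
proof -
  note f = fin_measD[OF \<eta>]
  have "integrable \<eta> (\<lambda>y. max (\<bar>y\<bar> - real n) 0)" using f(4,5) by (intro integrable_max) auto
  then show ?thesis unfolding put_fun_def using f(6) k by (intro integral_mono) (auto simp: max_def abs_if)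
qed

lemma call_tail:
  assumes \<eta>: "\<eta> \<in> fin_meas" and k: "real n \<le> k"
  shows "call_fun \<eta> k \<le> (\<integral>y. max (\<bar>y\<bar> - real n) 0 \<partial>\<eta>)"
proof -
  note f = fin_measD[OF \<eta>]
  have "integrable \<eta> (\<lambda>y. max (\<bar>y\<bar> - real n) 0)" using f(4,5) by (intro integrable_max) auto
  then show ?thesis unfolding call_fun_def using f(7) k by (intro integral_mono) (auto simp: max_def abs_if)
qed

text \<open>Because both gaps are positive, the difference of the puts stays away from its supremum near
  \<open>-\<infinity>\<close> and near \<open>\<infinity>\<close>. By continuity it is attained, on a compact set with end points
  \<open>xm\<close> and \<open>xp\<close>.\<close>

lemma contact_points:
  assumes \<mu>: "\<mu> \<in> fin_meas" and \<nu>: "\<nu> \<in> fin_meas" and mass: "measure \<mu> UNIV = measure \<nu> UNIV"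
    and pc: "0 < p_gap \<mu> \<nu>" "0 < c_gap \<mu> \<nu>"
  shows "put_fun \<mu> (xm \<mu> \<nu>) - put_fun \<nu> (xm \<mu> \<nu>) = p_gap \<mu> \<nu>"
    "put_fun \<mu> (xp \<mu> \<nu>) - put_fun \<nu> (xp \<mu> \<nu>) = p_gap \<mu> \<nu>"
    "xm \<mu> \<nu> \<le> xp \<mu> \<nu>"
proof -
  define D where "D k = put_fun \<mu> k - put_fun \<nu> k" for k
  define p where "p = p_gap \<mu> \<nu>"
  define c where "c = c_gap \<mu> \<nu>"
  have Dp: "D k \<le> p" for k unfolding D_def p_def by (rule put_gap_le_p_gap[OF \<mu> \<nu> mass])
  have cont: "continuous_on S D" for S
    unfolding D_def[abs_def]
    by (intro continuous_on_diff continuous_on_subset[OF put_fun_continuous] \<mu> \<nu>) auto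
  \<comment> \<open>The put gap tends to \<open>0 < p\<close> at \<open>-\<infinity>\<close> and to \<open>p - c
    < p\<close> at \<open>\<infinity>\<close>, so it exceeds \<open>max \<delta> (p - (c - \<delta>)) <
    p\<close> only on a compact interval.\<close>
  define \<delta> where "\<delta> = min p c / 2"
  have \<delta>: "0 < \<delta>" "\<delta> < p" "\<delta> < c" using pc by (auto simp: \<delta>_def p_def c_def)
  have "\<forall>\<^sub>F n in sequentially. (\<integral>y. max (\<bar>y\<bar> - real n) 0 \<partial>\<mu>) < \<delta>"
    using \<delta>(1) by (rule order_tendstoD(2)[OF tail_tendsto_0[OF \<mu>]])
  then obtain n where n: "(\<integral>y. max (\<bar>y\<bar> - real n) 0 \<partial>\<mu>) < \<delta>"
    using eventually_happens'[OF sequentially_bot] by blast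
  have low: "D k < \<delta>" if "k \<le> - real n" for k
    using put_tail[OF \<mu> that] put_fun_nonneg[of \<nu> k] n by (simp add: D_def)
  have high: "D k < p - (c - \<delta>)" if "real n \<le> k" for k
  proof -
    have "D k = call_fun \<mu> k - call_fun \<nu> k - (c - p)"
      using mass by (simp add: D_def c_def p_def c_gap_eq[OF \<mu> \<nu> mass] call_put_parity \<mu> \<nu>)
    then show ?thesis using call_tail[OF \<mu> that] call_fun_nonneg[of \<nu> k] n by simp
  qed
  have out: "k \<in> {- real n..real n}" if "D k = p" for k
    using low[of k] high[of k] \<delta> that by (cases "k \<le> - real n"; cases "real n \<le> k") auto
  obtain k0 where "\<forall>k\<in>{- real n..real n}. D k \<le> D k0"
    using continuous_attains_sup[OF compact_Icc _ cont, of "- real n" "real n"] by fastforce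
  then have k0: "\<And>k. k \<in> {- real n..real n} \<Longrightarrow> D k \<le> D k0" by blast
  have "D k0 = p"
  proof (rule ccontr)
    assume "D k0 \<noteq> p"
    then have "D k0 < p" using Dp[of k0] by simp
    define b where "b = max (D k0) (max \<delta> (p - (c - \<delta>)))"
    have "b < p" using \<open>D k0 < p\<close> \<delta> by (simp add: b_def)
    have "D k \<le> b" for k
      using low[of k] high[of k] k0[of k] unfolding b_def
      by (cases "k \<le> - real n"; cases "real n \<le> k") (auto simp: le_max_iff_disj)
    then have "p \<le> b" unfolding p_def p_gap_def D_def by (intro cSUP_least) auto
    then show False using \<open>b < p\<close> by simp
  qed
  define S where "S = {k. D k = p}"
  have S: "{k. Ptilde \<mu> \<nu> k = put_fun \<mu> k} = S"
    by (auto simp: S_def D_def p_def Ptilde_def)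
  have ne: "S \<noteq> {}" using \<open>D k0 = p\<close> by (auto simp: S_def)
  have cl: "closed S"
    unfolding S_def by (intro closed_Collect_eq cont continuous_on_const)
  have bdd: "bdd_below S" "bdd_above S"
    using out by (auto simp: S_def intro!: bdd_belowI[where m="- real n"] bdd_aboveI[where M="real n"])
  have "xm \<mu> \<nu> \<in> S" unfolding xm_def S by (rule closed_contains_Inf[OF ne bdd(1) cl])
  moreover have "xp \<mu> \<nu> \<in> S" unfolding xp_def S by (rule closed_contains_Sup[OF ne bdd(2) cl])
  ultimately show "put_fun \<mu> (xm \<mu> \<nu>) - put_fun \<nu> (xm \<mu> \<nu>) = p_gap \<mu> \<nu>"
    "put_fun \<mu> (xp \<mu> \<nu>) - put_fun \<nu> (xp \<mu> \<nu>) = p_gap \<mu> \<nu>"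
    by (auto simp: S_def D_def p_def)
  show "xm \<mu> \<nu> \<le> xp \<mu> \<nu>" unfolding xm_def xp_def S by (rule cInf_le_cSup[OF ne bdd(2,1)])
qed

text \<open>The one-sided derivatives of the puts are the distribution functions, so each atom makes up for
  the difference in mass between \<open>\<mu>\<close> and \<open>\<nu>\<close> on its side of the contact
  set.\<close>

lemma atom_masses:
  assumes \<mu>: "\<mu> \<in> fin_meas" and \<nu>: "\<nu> \<in> fin_meas"
  shows "Delta_m \<mu> \<nu> - left_deriv (Ptilde \<mu> \<nu>) (xm \<mu> \<nu>) = measure \<mu> {..<xm \<mu> \<nu>} - measure \<nu> {..<xm \<mu> \<nu>}"
    "right_deriv (Ptilde \<mu> \<nu>) (xp \<mu> \<nu>) - Delta_p \<mu> \<nu> = measure \<nu> {..xp \<mu> \<nu>} - measure \<mu> {..xp \<mu> \<nu>}"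
proof -
  have eq: "Ptilde \<mu> \<nu> = (\<lambda>k. put_fun \<nu> k + p_gap \<mu> \<nu>)" "put_fun \<mu> = (\<lambda>k. put_fun \<mu> k + 0)"
    by (auto simp: Ptilde_def)
  show "Delta_m \<mu> \<nu> - left_deriv (Ptilde \<mu> \<nu>) (xm \<mu> \<nu>) = measure \<mu> {..<xm \<mu> \<nu>} - measure \<nu> {..<xm \<mu> \<nu>}"
    unfolding Delta_m_def eq(1) put_fun_one_sided_derivs(1)[OF \<nu>]
    by (subst eq(2)) (simp only: put_fun_one_sided_derivs(1)[OF \<mu>])
  show "right_deriv (Ptilde \<mu> \<nu>) (xp \<mu> \<nu>) - Delta_p \<mu> \<nu> = measure \<nu> {..xp \<mu> \<nu>} - measure \<mu> {..xp \<mu> \<nu>}"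
    unfolding Delta_p_def eq(1) put_fun_one_sided_derivs(2)[OF \<nu>]
    by (subst eq(2)) (simp only: put_fun_one_sided_derivs(2)[OF \<mu>])
qed

section \<open>Couplings composed of the three pieces are optimal\<close>

lemma fin_meas_marginals:
  assumes \<pi>: "\<pi> \<in> couplings \<eta> \<xi>" and "finite_measure \<pi>" "integrable \<pi> fst" "integrable \<pi> snd"
  shows "\<eta> \<in> fin_meas" "\<xi> \<in> fin_meas"
proof -
  note c = couplingsD[OF \<pi>]
  have "finite_measure \<eta>" "finite_measure \<xi>"
    unfolding c(5,6)[symmetric] using assms(2) c(3,4) by (auto intro: finite_measure.finite_measure_distr)
  moreover have "integrable \<eta> (\<lambda>x. \<bar>x\<bar>)"
    using integrable_coupling_fst[OF \<pi>, of "\<lambda>x. \<bar>x\<bar>"] assms(3) by simp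
  moreover have "integrable \<xi> (\<lambda>x. \<bar>x\<bar>)"
    using integrable_coupling_snd[OF \<pi>, of "\<lambda>x. \<bar>x\<bar>"] assms(4) by simp
  ultimately show "\<eta> \<in> fin_meas" "\<xi> \<in> fin_meas" using c(7,8) by (simp_all add: fin_meas_def)
qed

lemma cost_eq_integral:
  assumes \<pi>: "\<pi> \<in> couplings \<eta> \<xi>" and \<eta>: "\<eta> \<in> fin_meas" and \<xi>: "\<xi> \<in> fin_meas"
    and ae: "AE x in \<eta>. \<bar>x - cond_mean \<eta> \<pi> x\<bar> = g x" and g: "integrable \<eta> g"
  shows "cost \<eta> \<pi> = (\<integral>x. g x \<partial>\<eta>)"
  unfolding cost_cond_mean
proof (rule integral_cong_AE[OF _ _ ae])
  have "integrable \<eta> (\<lambda>x. \<bar>x - cond_mean \<eta> \<pi> x\<bar>)"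
    using cond_mean_fin(2)[OF \<pi> \<eta> \<xi>] fin_measD(4)[OF \<eta>] by simp
  then show "(\<lambda>x. \<bar>x - cond_mean \<eta> \<pi> x\<bar>) \<in> borel_measurable \<eta>" by (rule borel_measurable_integrable)
  show "g \<in> borel_measurable \<eta>" using g by (rule borel_measurable_integrable)
qed

lemma cost_ge_bary_diff:
  assumes \<pi>: "\<pi> \<in> couplings \<eta> \<xi>" and \<eta>: "\<eta> \<in> fin_meas" and \<xi>: "\<xi> \<in> fin_meas"
  shows "\<bar>bary \<eta> - bary \<xi>\<bar> \<le> cost \<eta> \<pi>"
proof -
  note cm = cond_mean_fin(2)[OF assms] and f = fin_measD(4)[OF \<eta>]
  have "(\<integral>x. x - cond_mean \<eta> \<pi> x \<partial>\<eta>) = bary \<eta> - bary \<xi>"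
    using cm f bary_cond_mean[OF assms] by (simp add: bary_def)
  then show ?thesis unfolding cost_cond_mean using integral_abs_bound[of \<eta> "\<lambda>x. x - cond_mean \<eta> \<pi> x"] by simp
qed

lemma V_eqI:
  assumes \<pi>: "\<pi> \<in> couplings \<eta> \<xi>" and "cost \<eta> \<pi> = v" and "\<And>\<rho>. \<rho> \<in> couplings \<eta> \<xi> \<Longrightarrow> v \<le> cost \<eta> \<rho>"
  shows "V \<eta> \<xi> = v"
  unfolding V_def
proof (rule antisym)
  show "(INF \<rho>\<in>couplings \<eta> \<xi>. cost \<eta> \<rho>) \<le> v"
    using assms(2,3) by (intro cINF_lower2[OF _ \<pi>]) (auto intro!: bdd_belowI[where m=v])
  show "v \<le> (INF \<rho>\<in>couplings \<eta> \<xi>. cost \<eta> \<rho>)"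
    using assms by (intro cINF_greatest) auto
qed

text \<open>The modulus of the integral of \<open>x - cond_mean \<eta> \<pi> x\<close> is a lower bound for
  the cost of every coupling; it is attained when the mean lies on one side of \<open>x\<close>.\<close>

lemma cost_one_sided:
  assumes \<pi>: "\<pi> \<in> couplings \<eta> \<xi>" and \<eta>: "\<eta> \<in> fin_meas" and \<xi>: "\<xi> \<in> fin_meas" and s: "\<bar>s\<bar> = 1"
    and ae: "AE x in \<eta>. 0 \<le> s * (x - cond_mean \<eta> \<pi> x)"
  shows "cost \<eta> \<pi> = s * (bary \<eta> - bary \<xi>)" "V \<eta> \<xi> = s * (bary \<eta> - bary \<xi>)"
proof -
  note cm = cond_mean_fin(2)[OF \<pi> \<eta> \<xi>] and f = fin_measD(4)[OF \<eta>]
  have s': "s = 1 \<or> s = - 1" using s by linarith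
  have "cost \<eta> \<pi> = (\<integral>x. s * (x - cond_mean \<eta> \<pi> x) \<partial>\<eta>)"
  proof (rule cost_eq_integral[OF \<pi> \<eta> \<xi>])
    show "AE x in \<eta>. \<bar>x - cond_mean \<eta> \<pi> x\<bar> = s * (x - cond_mean \<eta> \<pi> x)"
      using ae s' by (auto elim!: eventually_mono)
    show "integrable \<eta> (\<lambda>x. s * (x - cond_mean \<eta> \<pi> x))" using cm f by simp
  qed
  then show cost: "cost \<eta> \<pi> = s * (bary \<eta> - bary \<xi>)"
    using cm f bary_cond_mean[OF \<pi> \<eta> \<xi>] by (simp add: bary_def)
  have "s * (bary \<eta> - bary \<xi>) \<le> cost \<eta> \<rho>" if "\<rho> \<in> couplings \<eta> \<xi>" for \<rho>
    using cost_ge_bary_diff[OF that \<eta> \<xi>] s' by auto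
  with \<pi> cost show "V \<eta> \<xi> = s * (bary \<eta> - bary \<xi>)" by (rule V_eqI)
qed

lemma cost_couplings_Sub:
  assumes \<pi>: "\<pi> \<in> couplings_Sub \<eta> \<xi>" and "\<eta> \<in> fin_meas" "\<xi> \<in> fin_meas"
  shows "cost \<eta> \<pi> = bary \<xi> - bary \<eta>" "V \<eta> \<xi> = bary \<xi> - bary \<eta>"
  using cost_one_sided[of \<pi> \<eta> \<xi> "- 1"] assms
  by (simp_all add: couplings_Sub_def cond_mean_def)

lemma cost_couplings_Sup:
  assumes \<pi>: "\<pi> \<in> couplings_Sup \<eta> \<xi>" and "\<eta> \<in> fin_meas" "\<xi> \<in> fin_meas"
  shows "cost \<eta> \<pi> = bary \<eta> - bary \<xi>" "V \<eta> \<xi> = bary \<eta> - bary \<xi>"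
  using cost_one_sided[of \<pi> \<eta> \<xi> "1"] assms
  by (simp_all add: couplings_Sup_def cond_mean_def)

lemma cost_couplings_M:
  assumes \<pi>: "\<pi> \<in> couplings_M \<eta> \<xi>" and \<eta>: "\<eta> \<in> fin_meas" and \<xi>: "\<xi> \<in> fin_meas"
  shows "cost \<eta> \<pi> = 0"
proof -
  have c: "\<pi> \<in> couplings \<eta> \<xi>" and ae: "AE x in \<eta>. cond_mean \<eta> \<pi> x = x"
    using \<pi> by (auto simp: couplings_M_def cond_mean_def)
  note cm = cond_mean_fin(2)[OF c \<eta> \<xi>] and f = fin_measD(4)[OF \<eta>]
  have "cost \<eta> \<pi> = (\<integral>x. 0 \<partial>\<eta>)"
  proof (rule cost_eq_integral[OF c \<eta> \<xi>])
    show "AE x in \<eta>. \<bar>x - cond_mean \<eta> \<pi> x\<bar> = 0"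
      using ae by eventually_elim simp
    show "integrable \<eta> (\<lambda>x. 0)" using cm f by simp
  qed
  then show ?thesis by simp
qed

lemma integral_shift_le_cost:
  assumes \<pi>: "\<pi> \<in> couplings \<eta> \<xi>" and \<eta>: "\<eta> \<in> fin_meas" and \<xi>: "\<xi> \<in> fin_meas"
    and h: "h \<in> borel_measurable borel" "\<And>x. \<bar>h x\<bar> \<le> 1"
  shows "(\<integral>z. h (fst z) * (fst z - snd z) \<partial>\<pi>) \<le> cost \<eta> \<pi>"
  unfolding integral_shift_test(3)[OF assms, symmetric] cost_cond_mean
proof (rule integral_mono[OF integral_shift_test(1)[OF assms]])
  show "integrable \<eta> (\<lambda>x. \<bar>x - cond_mean \<eta> \<pi> x\<bar>)"
    using cond_mean_fin(2)[OF \<pi> \<eta> \<xi>] fin_measD(4)[OF \<eta>] by simp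
  fix x
  have "\<bar>h x\<bar> * \<bar>x - cond_mean \<eta> \<pi> x\<bar> \<le> 1 * \<bar>x - cond_mean \<eta> \<pi> x\<bar>"
    by (rule mult_right_mono[OF h(2)]) simp
  then show "h x * (x - cond_mean \<eta> \<pi> x) \<le> \<bar>x - cond_mean \<eta> \<pi> x\<bar>"
    unfolding abs_mult[symmetric] by simp
qed

lemma add_measure_parts:
  fixes \<pi>1 \<pi>2 \<pi>3 :: "(real \<times> real) measure"
  assumes s: "sets \<pi>1 = sets borel" "sets \<pi>2 = sets borel" "sets \<pi>3 = sets borel"
    and \<pi>: "\<pi> = add_measure (add_measure \<pi>1 \<pi>2) \<pi>3"
  shows "finite_measure \<pi> \<Longrightarrow> finite_measure \<pi>1 \<and> finite_measure \<pi>2 \<and> finite_measure \<pi>3"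
    and "integrable \<pi> f \<longleftrightarrow> integrable \<pi>1 f \<and> integrable \<pi>2 f \<and> integrable \<pi>3 (f :: _ \<Rightarrow> real)"
    and "integrable \<pi> f \<Longrightarrow> (\<integral>z. f z \<partial>\<pi>) = (\<integral>z. f z \<partial>\<pi>1) + (\<integral>z. f z \<partial>\<pi>2) + (\<integral>z. f z \<partial>\<pi>3)"
proof -
  have s12: "sets \<pi>2 = sets \<pi>1" and s3: "sets \<pi>3 = sets (add_measure \<pi>1 \<pi>2)" using s by simp_all
  have sp: "space \<pi>1 = UNIV" "space \<pi>2 = UNIV" "space \<pi>3 = UNIV" "space \<pi> = UNIV"
    using s[THEN space_eq_UNIV_if_borel] by (simp_all add: \<pi>)
  have U: "UNIV \<in> sets \<pi>1" using sets.top[of \<pi>1] sp(1) by simp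
  have e: "emeasure \<pi> UNIV = emeasure \<pi>1 UNIV + emeasure \<pi>2 UNIV + emeasure \<pi>3 UNIV"
    unfolding \<pi> using U by (simp add: emeasure_add_measure[OF s3] emeasure_add_measure[OF s12])
  show "finite_measure \<pi> \<Longrightarrow> finite_measure \<pi>1 \<and> finite_measure \<pi>2 \<and> finite_measure \<pi>3"
    using finite_measure.emeasure_finite[of \<pi> UNIV] unfolding e
    by (auto intro!: finite_measureI simp: sp)
  show i: "integrable \<pi> f \<longleftrightarrow> integrable \<pi>1 f \<and> integrable \<pi>2 f \<and> integrable \<pi>3 f"
    unfolding \<pi> integrable_add_measure_iff[OF s3] integrable_add_measure_iff[OF s12] by auto
  show "(\<integral>z. f z \<partial>\<pi>) = (\<integral>z. f z \<partial>\<pi>1) + (\<integral>z. f z \<partial>\<pi>2) + (\<integral>z. f z \<partial>\<pi>3)" if "integrable \<pi> f"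
    using that unfolding i
    by (simp add: \<pi> integral_add_measure[OF s3] integral_add_measure[OF s12] integrable_add_measure_iff[OF s12])
qed

text \<open>The cost is the supremum, over weights \<open>h\<close> with values in \<open>[-1, 1]\<close>, of
  the integrals of \<open>h (fst z) * (fst z - snd z)\<close>, which are additive in the coupling; hence it is
  subadditive.\<close>

lemma cost_add_measure_le:
  assumes \<pi>: "\<pi> \<in> couplings \<mu> \<nu>" and \<mu>: "\<mu> \<in> fin_meas" and \<nu>: "\<nu> \<in> fin_meas"
    and c: "\<pi>1 \<in> couplings \<eta>1 \<xi>1" "\<pi>2 \<in> couplings \<eta>2 \<xi>2" "\<pi>3 \<in> couplings \<eta>3 \<xi>3"
    and fin: "\<eta>1 \<in> fin_meas" "\<xi>1 \<in> fin_meas" "\<eta>2 \<in> fin_meas" "\<xi>2 \<in> fin_meas" "\<eta>3 \<in> fin_meas" "\<xi>3 \<in> fin_meas"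
    and eq: "\<pi> = add_measure (add_measure \<pi>1 \<pi>2) \<pi>3"
  shows "cost \<mu> \<pi> \<le> cost \<eta>1 \<pi>1 + cost \<eta>2 \<pi>2 + cost \<eta>3 \<pi>3"
proof -
  note cm = cond_mean_fin(1)[OF \<pi> \<mu> \<nu>]
  define h where "h x = (if cond_mean \<mu> \<pi> x \<le> x then 1 else - 1 :: real)" for x
  have h: "h \<in> borel_measurable borel" "\<And>x. \<bar>h x\<bar> \<le> 1"
  proof -
    have "{x. cond_mean \<mu> \<pi> x \<le> x} \<in> sets borel"
      using borel_measurable_le[OF cm, of "\<lambda>x. x"] by simp
    then show "h \<in> borel_measurable borel"
      unfolding h_def[abs_def] by (intro measurable_If) auto
    show "\<bar>h x\<bar> \<le> 1" for x by (simp add: h_def)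
  qed
  note T = integral_shift_test[OF \<pi> \<mu> \<nu> h]
  have "cost \<mu> \<pi> = (\<integral>x. h x * (x - cond_mean \<mu> \<pi> x) \<partial>\<mu>)"
    unfolding cost_cond_mean h_def by (intro Bochner_Integration.integral_cong) auto
  also have "\<dots> = (\<integral>z. h (fst z) * (fst z - snd z) \<partial>\<pi>1) + (\<integral>z. h (fst z) * (fst z - snd z) \<partial>\<pi>2) + (\<integral>z. h (fst z) * (fst z - snd z) \<partial>\<pi>3)"
    unfolding T(3) by (rule add_measure_parts(3)[OF couplingsD(1)[OF c(1)] couplingsD(1)[OF c(2)] couplingsD(1)[OF c(3)] eq T(2)])
  also have "\<dots> \<le> cost \<eta>1 \<pi>1 + cost \<eta>2 \<pi>2 + cost \<eta>3 \<pi>3"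
    by (intro add_mono integral_shift_le_cost[OF c(1) fin(1,2) h]
        integral_shift_le_cost[OF c(2) fin(3,4) h] integral_shift_le_cost[OF c(3) fin(5,6) h])
  finally show ?thesis .
qed

lemma integral_restr:
  fixes f :: "real \<Rightarrow> real"
  assumes \<eta>: "\<eta> \<in> fin_meas" and A: "A \<in> sets borel" and f: "f \<in> borel_measurable borel"
  shows "(\<integral>x. f x \<partial>restr \<eta> A) = (\<integral>x. indicator A x * f x \<partial>\<eta>)"
    "integrable (restr \<eta> A) f \<longleftrightarrow> integrable \<eta> (\<lambda>x. indicator A x * f x)"
proof -
  have m: "A \<in> sets \<eta>" "f \<in> borel_measurable \<eta>"
    using A by (simp_all add: fin_measD(1)[OF \<eta>] measurable_if_sets_borel[OF fin_measD(1)[OF \<eta>] f])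
  show "(\<integral>x. f x \<partial>restr \<eta> A) = (\<integral>x. indicator A x * f x \<partial>\<eta>)"
    unfolding restr_def by (rule integral_density_indicator[OF m])
  show "integrable (restr \<eta> A) f \<longleftrightarrow> integrable \<eta> (\<lambda>x. indicator A x * f x)"
    unfolding restr_def by (rule integrable_density_indicator[OF m])
qed

lemma AE_dirac: "AE y in dirac c a. y = a"
proof (rule AE_I)
  show "{y \<in> space (dirac c a). y \<noteq> a} \<subseteq> - {a}" by auto
  show "emeasure (dirac c a) (- {a}) = 0" by (simp add: dirac_def)
  show "- {a} \<in> sets (dirac c a)" by (simp add: dirac_def)
qed

text \<open>The atom at \<open>a\<close> contributes nothing to the first moment relative to \<open>a\<close>.\<close>

lemma bary_restr_add_dirac:
  assumes \<eta>: "\<eta> \<in> fin_meas" and A: "A \<in> sets borel"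
    and \<xi>: "\<xi> \<in> fin_meas" "\<xi> = add_measure (restr \<eta> A) (dirac c a)"
  shows "bary \<xi> - a * measure \<xi> UNIV = (\<integral>x. indicator A x * (x - a) \<partial>\<eta>)"
proof -
  note f = fin_measD[OF \<xi>(1)]
  have s: "sets (dirac c a) = sets (restr \<eta> A)" using fin_measD(1)[OF \<eta>] by (simp add: dirac_def restr_def)
  have i: "integrable (add_measure (restr \<eta> A) (dirac c a)) (\<lambda>x. x - a)"
    using f(4,5) unfolding \<xi>(2) by simp
  have "(\<integral>x. x - a \<partial>dirac c a) = (\<integral>x. 0 \<partial>dirac c a)"
  proof (rule integral_cong_AE)
    have "sets (dirac c a) = sets borel" by (simp add: dirac_def)
    then show "(\<lambda>x. x - a) \<in> borel_measurable (dirac c a)" by (rule measurable_if_sets_borel) simp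
    show "AE x in dirac c a. x - a = 0" using AE_dirac by eventually_elim simp
  qed simp
  then have "(\<integral>x. x - a \<partial>\<xi>) = (\<integral>x. indicator A x * (x - a) \<partial>\<eta>)"
    using i unfolding \<xi>(2) integrable_add_measure_iff[OF s]
    by (simp add: integral_add_measure[OF s] integral_restr(1)[OF \<eta> A])
  then show ?thesis using f(2,4,5) by (simp add: bary_def mult.commute)
qed

lemma bary_restr:
  assumes \<eta>: "\<eta> \<in> fin_meas" and A: "A \<in> sets borel" and \<xi>: "restr \<eta> A \<in> fin_meas"
  shows "bary (restr \<eta> A) - a * measure (restr \<eta> A) UNIV = (\<integral>x. indicator A x * (x - a) \<partial>\<eta>)"
proof -
  note f = fin_measD[OF \<xi>]
  have "(\<integral>x. x - a \<partial>restr \<eta> A) = (\<integral>x. indicator A x * (x - a) \<partial>\<eta>)"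
    by (rule integral_restr(1)[OF \<eta> A]) simp
  then show ?thesis using f(2,4,5) by (simp add: bary_def mult.commute)
qed

lemma put_fun_eq_indicator: "put_fun \<eta> a = - (\<integral>x. indicator {..<a} x * (x - a) \<partial>\<eta>)"
  and call_fun_eq_indicator: "call_fun \<eta> a = (\<integral>x. indicator {a<..} x * (x - a) \<partial>\<eta>)"
proof -
  have "max (a - x) 0 = - (indicator {..<a} x * (x - a))" for x by (simp add: indicator_def)
  then show "put_fun \<eta> a = - (\<integral>x. indicator {..<a} x * (x - a) \<partial>\<eta>)"
    unfolding put_fun_def by simp
  have "max (x - a) 0 = indicator {a<..} x * (x - a)" for x by (simp add: indicator_def)
  then show "call_fun \<eta> a = (\<integral>x. indicator {a<..} x * (x - a) \<partial>\<eta>)"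
    unfolding call_fun_def by simp
qed

text \<open>Relative to the contact point \<open>a\<close> at which they end, the first moments of
  \<open>eta_m\<close> and \<open>chi_m\<close> are \<open>- put_fun \<mu> a\<close> and \<open>- put_fun
  \<nu> a\<close>; as the masses agree, the left piece costs exactly \<open>p_gap\<close>. In the same way the
  right piece costs \<open>c_gap\<close>, and the martingale piece is free.\<close>

lemma Pi_star_optimal:
  assumes \<mu>: "\<mu> \<in> fin_meas" and \<nu>: "\<nu> \<in> fin_meas" and pc: "0 < p_gap \<mu> \<nu>" "0 < c_gap \<mu> \<nu>"
    and star: "\<pi> \<in> Pi_star \<mu> \<nu>"
  shows "cost \<mu> \<pi> = V \<mu> \<nu>"
    "V \<mu> \<nu> = (bary (chi_m \<mu> \<nu>) - bary (eta_m \<mu> \<nu>)) + (bary (eta_p \<mu> \<nu>) - bary (chi_p \<mu> \<nu>))"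
    "V \<mu> \<nu> = V (eta_m \<mu> \<nu>) (chi_m \<mu> \<nu>) + V (eta_p \<mu> \<nu>) (chi_p \<mu> \<nu>)"
proof -
  obtain \<pi>m \<pi>0 \<pi>p where \<pi>: "\<pi> \<in> couplings \<mu> \<nu>" and m: "\<pi>m \<in> couplings_Sub (eta_m \<mu> \<nu>) (chi_m \<mu> \<nu>)"
    and z: "\<pi>0 \<in> couplings_M (eta_0 \<mu> \<nu>) (chi_0 \<mu> \<nu>)" and p: "\<pi>p \<in> couplings_Sup (eta_p \<mu> \<nu>) (chi_p \<mu> \<nu>)"
    and eq: "\<pi> = add_measure (add_measure \<pi>m \<pi>0) \<pi>p"
    using star unfolding Pi_star_def by blast
  have c: "\<pi>m \<in> couplings (eta_m \<mu> \<nu>) (chi_m \<mu> \<nu>)" "\<pi>0 \<in> couplings (eta_0 \<mu> \<nu>) (chi_0 \<mu> \<nu>)"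
    "\<pi>p \<in> couplings (eta_p \<mu> \<nu>) (chi_p \<mu> \<nu>)"
    using m z p by (auto simp: couplings_Sub_def couplings_M_def couplings_Sup_def)
  note parts = add_measure_parts[OF c[THEN couplingsD(1)] eq]
  note ic = integrable_coupling[OF \<pi> \<mu> \<nu>]
  have fin: "eta_m \<mu> \<nu> \<in> fin_meas" "chi_m \<mu> \<nu> \<in> fin_meas" "eta_0 \<mu> \<nu> \<in> fin_meas" "chi_0 \<mu> \<nu> \<in> fin_meas"
    "eta_p \<mu> \<nu> \<in> fin_meas" "chi_p \<mu> \<nu> \<in> fin_meas"
    using fin_meas_marginals[OF c(1)] fin_meas_marginals[OF c(2)] fin_meas_marginals[OF c(3)]
      parts(1)[OF ic(1)] parts(2)[of fst] parts(2)[of snd] ic(2,3) by blast+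
  have mass: "measure \<mu> UNIV = measure \<nu> UNIV" using measure_coupling[OF \<pi>] by simp
  note contact = contact_points[OF \<mu> \<nu> mass pc]
  have "bary (eta_m \<mu> \<nu>) - xm \<mu> \<nu> * measure (eta_m \<mu> \<nu>) UNIV = - put_fun \<mu> (xm \<mu> \<nu>)"
    using bary_restr[OF \<mu> _ fin(1)[unfolded eta_m_def]] by (simp add: eta_m_def put_fun_eq_indicator)
  moreover have "bary (chi_m \<mu> \<nu>) - xm \<mu> \<nu> * measure (chi_m \<mu> \<nu>) UNIV = - put_fun \<nu> (xm \<mu> \<nu>)"
    using bary_restr_add_dirac[OF \<nu> _ fin(2) chi_m_def] by (simp add: put_fun_eq_indicator)
  ultimately have pm: "bary (chi_m \<mu> \<nu>) - bary (eta_m \<mu> \<nu>) = p_gap \<mu> \<nu>"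
    using contact(1) measure_coupling[OF c(1)] by simp
  have "bary (eta_p \<mu> \<nu>) - xp \<mu> \<nu> * measure (eta_p \<mu> \<nu>) UNIV = call_fun \<mu> (xp \<mu> \<nu>)"
    using bary_restr[OF \<mu> _ fin(5)[unfolded eta_p_def]] by (simp add: eta_p_def call_fun_eq_indicator)
  moreover have "bary (chi_p \<mu> \<nu>) - xp \<mu> \<nu> * measure (chi_p \<mu> \<nu>) UNIV = call_fun \<nu> (xp \<mu> \<nu>)"
    using bary_restr_add_dirac[OF \<nu> _ fin(6) chi_p_def] by (simp add: call_fun_eq_indicator)
  moreover have "call_fun \<mu> (xp \<mu> \<nu>) - call_fun \<nu> (xp \<mu> \<nu>) = c_gap \<mu> \<nu>"
    using contact(2) mass by (simp add: c_gap_eq[OF \<mu> \<nu> mass] call_put_parity \<mu> \<nu>)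
  ultimately have pp: "bary (eta_p \<mu> \<nu>) - bary (chi_p \<mu> \<nu>) = c_gap \<mu> \<nu>"
    using measure_coupling[OF c(3)] by simp
  have "cost \<mu> \<pi> \<le> p_gap \<mu> \<nu> + c_gap \<mu> \<nu>"
    using cost_add_measure_le[OF \<pi> \<mu> \<nu> c fin eq] cost_couplings_Sub(1)[OF m fin(1,2)]
      cost_couplings_M[OF z fin(3,4)] cost_couplings_Sup(1)[OF p fin(5,6)] pm pp by simp
  then have cost: "cost \<mu> \<pi> = p_gap \<mu> \<nu> + c_gap \<mu> \<nu>" using cost_ge[OF \<pi> \<mu> \<nu>] by simp
  have V: "V \<mu> \<nu> = p_gap \<mu> \<nu> + c_gap \<mu> \<nu>" by (rule V_eqI[OF \<pi> cost cost_ge[OF _ \<mu> \<nu>]])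
  show "cost \<mu> \<pi> = V \<mu> \<nu>" using cost V by simp
  show "V \<mu> \<nu> = (bary (chi_m \<mu> \<nu>) - bary (eta_m \<mu> \<nu>)) + (bary (eta_p \<mu> \<nu>) - bary (chi_p \<mu> \<nu>))"
    using V pm pp by simp
  show "V \<mu> \<nu> = V (eta_m \<mu> \<nu>) (chi_m \<mu> \<nu>) + V (eta_p \<mu> \<nu>) (chi_p \<mu> \<nu>)"
    using V pm pp cost_couplings_Sub(2)[OF m fin(1,2)] cost_couplings_Sup(2)[OF p fin(5,6)] by simp
qed

section \<open>Optimal couplings decompose\<close>

text \<open>If the lower bound given by the strike \<open>k\<close> is attained, then equality holds in both
  inequalities behind it. The pointwise one forces the mean to lie between \<open>x\<close> and
  \<open>k\<close>, and the one of Jensen forbids mass to cross \<open>k\<close>.\<close>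

lemma optimal_cond_mean_contact:
  assumes \<pi>: "\<pi> \<in> couplings \<mu> \<nu>" and \<mu>: "\<mu> \<in> fin_meas" and \<nu>: "\<nu> \<in> fin_meas"
    and opt: "(\<integral>x. max (cond_mean \<mu> \<pi> x - x) 0 \<partial>\<mu>) = put_fun \<mu> k - put_fun \<nu> k"
  shows "AE x in \<mu>. (x < k \<longrightarrow> x \<le> cond_mean \<mu> \<pi> x \<and> cond_mean \<mu> \<pi> x \<le> k) \<and>
      (k \<le> x \<longrightarrow> k \<le> cond_mean \<mu> \<pi> x \<and> cond_mean \<mu> \<pi> x \<le> x)"
    and "AE z in \<pi>. (fst z \<le> k \<longrightarrow> snd z \<le> k) \<and> (k \<le> fst z \<longrightarrow> k \<le> snd z)"
proof -
  define m where "m = cond_mean \<mu> \<pi>"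
  note cm = cond_mean_fin[OF \<pi> \<mu> \<nu>, folded m_def] and f = fin_measD[OF \<mu>] and g = fin_measD[OF \<nu>]
  note ic = integrable_coupling[OF \<pi> \<mu> \<nu>]
  note pe = put_cond_mean_eq[OF \<pi> \<mu> \<nu>, of k, folded m_def] and ple = put_cond_mean_le[OF \<pi> \<mu> \<nu>, of k, folded m_def]
  have i: "integrable \<mu> (\<lambda>x. max (k - m x) 0)" "integrable \<mu> (\<lambda>x. max (m x - x) 0)"
    using cm(2) f(4,5) by (auto intro!: integrable_max)
  have up: "(\<integral>x. max (k - x) 0 - max (k - m x) 0 \<partial>\<mu>) = put_fun \<mu> k - (\<integral>x. max (k - m x) 0 \<partial>\<mu>)"
    using i f(6) by (simp add: put_fun_def)
  have le: "(\<integral>x. max (k - x) 0 - max (k - m x) 0 \<partial>\<mu>) \<le> (\<integral>x. max (m x - x) 0 \<partial>\<mu>)"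
    using i f(6) by (intro integral_mono) auto
  have eq: "(\<integral>x. max (k - m x) 0 \<partial>\<mu>) = put_fun \<nu> k"
    using up le ple opt by (simp add: m_def)
  have "AE x in \<mu>. max (k - x) 0 - max (k - m x) 0 = max (m x - x) 0"
    using i f(6) up eq opt by (intro AE_eq_if_integral_le) (auto simp: m_def intro!: AE_I2)
  then have 1: "AE x in \<mu>. (x < k \<longrightarrow> x \<le> m x \<and> m x \<le> k) \<and> (k \<le> x \<longrightarrow> k \<le> m x \<and> m x \<le> x)"
    by eventually_elim (auto simp: max_def split: if_splits)
  then show "AE x in \<mu>. (x < k \<longrightarrow> x \<le> cond_mean \<mu> \<pi> x \<and> cond_mean \<mu> \<pi> x \<le> k) \<and>
      (k \<le> x \<longrightarrow> k \<le> cond_mean \<mu> \<pi> x \<and> cond_mean \<mu> \<pi> x \<le> x)"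
    unfolding m_def .
  have mb: "(\<lambda>y. max (k - y) 0) \<in> borel_measurable borel" by simp
  \<comment> \<open>Equality in the conditional Jensen inequality: \<open>y\<close> lies on the same side of
    \<open>k\<close> as the mean.\<close>
  have "AE z in \<pi>. indicator {x. m x < k} (fst z) * (k - snd z) = max (k - snd z) 0"
  proof (rule AE_eq_if_integral_le[OF pe(1)])
    show "integrable \<pi> (\<lambda>z. max (k - snd z) 0)" using integrable_coupling_snd[OF \<pi> mb] g(6) by simp
    show "AE z in \<pi>. indicator {x. m x < k} (fst z) * (k - snd z) \<le> max (k - snd z) 0"
      by (intro AE_I2) (simp add: indicator_def)
    show "(\<integral>z. max (k - snd z) 0 \<partial>\<pi>) \<le> (\<integral>z. indicator {x. m x < k} (fst z) * (k - snd z) \<partial>\<pi>)"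
      unfolding pe(2)[symmetric] eq using integral_coupling_snd[OF \<pi> mb] by (simp add: put_fun_def)
  qed
  then have 2: "AE z in \<pi>. (m (fst z) < k \<longrightarrow> snd z \<le> k) \<and> (k \<le> m (fst z) \<longrightarrow> k \<le> snd z)"
    by eventually_elim (auto simp: max_def split: if_splits)
  \<comment> \<open>Where the mean equals \<open>k\<close>, the previous step leaves only \<open>y \<ge>
    k\<close>; a variable bounded below by its mean is constant.\<close>
  define h :: "real \<Rightarrow> real" where "h = indicator {x. m x = k}"
  have "{x. m x = k} \<in> sets borel" using borel_measurable_eq[OF cm(1), of "\<lambda>x. k"] by simp
  then have hb: "h \<in> borel_measurable borel" unfolding h_def by simp
  have h1: "\<bar>h x\<bar> \<le> 1" for x by (simp add: h_def indicator_def)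
  have hi: "integrable \<pi> (\<lambda>z. h (fst z) * k)" "integrable \<pi> (\<lambda>z. h (fst z) * snd z)"
    "integrable \<mu> (\<lambda>x. h x * k)" "integrable \<mu> (\<lambda>x. h x * m x)"
  proof -
    interpret \<pi>: finite_measure \<pi> by fact
    have hp: "(\<lambda>z. h (fst z)) \<in> borel_measurable \<pi>"
      by (rule measurable_if_sets_borel[OF couplingsD(1)[OF \<pi>] borel_measurable_fst_real[OF hb]])
    have hm: "h \<in> borel_measurable \<mu>" by (rule measurable_if_sets_borel[OF f(1) hb])
    show "integrable \<pi> (\<lambda>z. h (fst z) * k)" by (rule integrable_bounded_times[OF \<pi>.integrable_const hp h1])
    show "integrable \<pi> (\<lambda>z. h (fst z) * snd z)" by (rule integrable_bounded_times[OF ic(3) hp h1])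
    show "integrable \<mu> (\<lambda>x. h x * k)" by (rule integrable_bounded_times[OF f(5) hm h1])
    show "integrable \<mu> (\<lambda>x. h x * m x)" by (rule integrable_bounded_times[OF cm(2) hm h1])
  qed
  have hk: "(\<lambda>x. h x * k) \<in> borel_measurable borel" using hb by simp
  have "(\<integral>x. h x * m x \<partial>\<mu>) = (\<integral>x. h x * k \<partial>\<mu>)"
    by (intro Bochner_Integration.integral_cong) (auto simp: h_def indicator_def)
  then have hint: "(\<integral>z. h (fst z) * snd z \<partial>\<pi>) \<le> (\<integral>z. h (fst z) * k \<partial>\<pi>)"
    unfolding cm(3)[OF hb h1] integral_coupling_fst[OF \<pi> hk] by simp
  have "AE z in \<pi>. h (fst z) * k = h (fst z) * snd z"
  proof (rule AE_eq_if_integral_le[OF hi(1,2) _ hint])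
    show "AE z in \<pi>. h (fst z) * k \<le> h (fst z) * snd z"
      using 2 by eventually_elim (auto simp: h_def indicator_def)
  qed
  with 2 AE_fst_if_AE[OF \<pi> 1]
  show "AE z in \<pi>. (fst z \<le> k \<longrightarrow> snd z \<le> k) \<and> (k \<le> fst z \<longrightarrow> k \<le> snd z)"
  proof eventually_elim
    case (elim z)
    have 3: "m (fst z) = k \<Longrightarrow> snd z = k" using elim(3) by (simp add: h_def)
    have "m (fst z) \<le> k" if "fst z \<le> k" using elim(2) that by (cases "fst z = k") auto
    moreover have "k \<le> m (fst z)" if "k \<le> fst z" using elim(2) that by auto
    ultimately show ?case using elim(1) 3 by (cases "m (fst z) = k") auto
  qed
qed

lemma restrict_coupling:
  assumes \<pi>: "\<pi> \<in> couplings \<eta> \<xi>" and \<eta>: "\<eta> \<in> fin_meas" and \<xi>: "\<xi> \<in> fin_meas" and A: "A \<in> sets borel"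
  defines "\<rho> \<equiv> density \<pi> (indicator (A \<times> UNIV))"
  shows "\<rho> \<in> couplings (restr \<eta> A) (distr \<rho> borel snd)"
    and "AE x in \<eta>. x \<in> A \<longrightarrow> cond_mean (restr \<eta> A) \<rho> x = cond_mean \<eta> \<pi> x"
proof -
  note c = couplingsD[OF \<pi>] and f = fin_measD[OF \<eta>]
  note ic = integrable_coupling[OF \<pi> \<eta> \<xi>] and cm = cond_mean_fin[OF \<pi> \<eta> \<xi>]
  have AU: "A \<times> UNIV \<in> sets \<pi>" unfolding c(1) using A by (intro strip_in_borel) auto
  have s\<rho>: "sets \<rho> = sets borel" by (simp add: \<rho>_def c(1))
  have fm: "fst \<in> borel_measurable \<rho>" unfolding \<rho>_def using c(3) by simp
  have "distr \<rho> borel fst = restr \<eta> A"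
  proof (rule measure_eqI)
    show "sets (distr \<rho> borel fst) = sets (restr \<eta> A)" by (simp add: restr_def f(1))
    fix B assume "B \<in> sets (distr \<rho> borel fst)"
    then have B: "B \<in> sets borel" by simp
    have BU: "B \<times> UNIV \<in> sets \<pi>" unfolding c(1) using B by (intro strip_in_borel) auto
    have "emeasure (distr \<rho> borel fst) B = emeasure \<rho> (B \<times> UNIV)"
      using emeasure_distr[OF fm B] c(2) by (simp add: \<rho>_def vimage_fst)
    also have "\<dots> = emeasure \<pi> ((A \<inter> B) \<times> UNIV)"
      unfolding \<rho>_def emeasure_restricted[OF AU BU] by (simp add: Times_Int_Times)
    also have "\<dots> = emeasure \<eta> (A \<inter> B)" using A B by (intro emeasure_coupling_Times(1)[OF \<pi>]) auto
    also have "\<dots> = emeasure (restr \<eta> A) B"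
      unfolding restr_def using A B f(1) by (simp add: emeasure_restricted)
    finally show "emeasure (distr \<rho> borel fst) B = emeasure (restr \<eta> A) B" .
  qed
  with s\<rho> show \<rho>: "\<rho> \<in> couplings (restr \<eta> A) (distr \<rho> borel snd)" by (simp add: couplings_def)
  have finr: "finite_measure (restr \<eta> A)"
  proof (rule finite_measureI)
    have "emeasure (restr \<eta> A) UNIV = emeasure \<eta> A"
      unfolding restr_def using A f(1) by (subst emeasure_restricted) auto
    then show "emeasure (restr \<eta> A) (space (restr \<eta> A)) \<noteq> \<infinity>"
      using finite_measure.emeasure_finite[OF f(3)] f(2) by (simp add: restr_def)
  qed
  have ind: "(\<lambda>z. indicator A (fst z) :: real) = indicator (A \<times> UNIV)"
    by (auto simp: fun_eq_iff indicator_def)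
  have h\<pi>: "(\<lambda>z. h (fst z)) \<in> borel_measurable \<pi>" if "h \<in> borel_measurable borel" for h :: "real \<Rightarrow> real"
    by (rule measurable_if_sets_borel[OF c(1) borel_measurable_fst_real[OF that]])
  have sm: "snd \<in> borel_measurable \<pi>" by (rule c(4))
  have Ab: "indicator A \<in> (borel_measurable borel :: (real \<Rightarrow> real) set)" using A by simp
  have ir: "integrable \<rho> snd"
    unfolding \<rho>_def integrable_density_indicator[OF AU sm] ind[symmetric]
    by (rule integrable_bounded_times[OF ic(3) h\<pi>[OF Ab]]) (simp add: indicator_def)
  have "AE x in restr \<eta> A. cond_mean (restr \<eta> A) \<rho> x = cond_mean \<eta> \<pi> x"
  proof (rule cond_mean_unique[OF \<rho> finr ir cm(1)])
    show "integrable (restr \<eta> A) (cond_mean \<eta> \<pi>)"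
      unfolding integral_restr(2)[OF \<eta> A cm(1)]
      by (rule integrable_bounded_times[OF cm(2) measurable_if_sets_borel[OF f(1) Ab]]) (simp add: indicator_def)
    fix h :: "real \<Rightarrow> real" assume h: "h \<in> borel_measurable borel" "\<And>x. \<bar>h x\<bar> \<le> 1"
    have hA: "(\<lambda>x. indicator A x * h x) \<in> borel_measurable borel" using h(1) Ab by simp
    have hA1: "\<bar>indicator A x * h x\<bar> \<le> 1" for x using h(2)[of x] by (simp add: indicator_def)
    have hm: "(\<lambda>x. h x * cond_mean \<eta> \<pi> x) \<in> borel_measurable borel" using h(1) cm(1) by simp
    have hs: "(\<lambda>z. h (fst z) * snd z) \<in> borel_measurable \<pi>" using h\<pi>[OF h(1)] sm by simp
    have "(\<integral>x. h x * cond_mean \<eta> \<pi> x \<partial>restr \<eta> A) = (\<integral>x. (indicator A x * h x) * cond_mean \<eta> \<pi> x \<partial>\<eta>)"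
      unfolding integral_restr(1)[OF \<eta> A hm] by (simp add: mult.assoc)
    also have "\<dots> = (\<integral>z. (indicator A (fst z) * h (fst z)) * snd z \<partial>\<pi>)" by (rule cm(3)[OF hA hA1])
    also have "\<dots> = (\<integral>z. indicator (A \<times> UNIV) z * (h (fst z) * snd z) \<partial>\<pi>)"
      by (intro Bochner_Integration.integral_cong) (auto simp: indicator_def)
    also have "\<dots> = (\<integral>z. h (fst z) * snd z \<partial>\<rho>)"
      unfolding \<rho>_def by (rule integral_density_indicator[OF AU hs, symmetric])
    finally show "(\<integral>x. h x * cond_mean \<eta> \<pi> x \<partial>restr \<eta> A) = (\<integral>z. h (fst z) * snd z \<partial>\<rho>)" .
  qed
  then show "AE x in \<eta>. x \<in> A \<longrightarrow> cond_mean (restr \<eta> A) \<rho> x = cond_mean \<eta> \<pi> x"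
    unfolding restr_def using A f(1) by (subst (asm) AE_density) (auto elim!: eventually_mono)
qed

text \<open>Applied to \<open>L = {..<xm}\<close> and \<open>L = {xp<..}\<close>, this identifies the second
  marginals of the outer pieces of an optimal coupling as \<open>chi_m\<close> and
  \<open>chi_p\<close>.\<close>

lemma second_marginal_of_strip:
  assumes \<pi>: "\<pi> \<in> couplings \<mu> \<nu>" and \<mu>: "\<mu> \<in> fin_meas" and \<nu>: "\<nu> \<in> fin_meas"
    and L: "L \<in> sets borel" "a \<notin> L"
    and ae: "AE z in \<pi>. (fst z \<in> L \<longrightarrow> snd z \<in> insert a L) \<and> (fst z \<notin> L \<longrightarrow> snd z \<notin> L)"
  shows "distr (density \<pi> (indicator (L \<times> UNIV))) borel snd =
    add_measure (restr \<nu> L) (dirac (measure \<mu> L - measure \<nu> L) a)"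
proof (rule measure_eqI)
  note c = couplingsD[OF \<pi>] and f = fin_measD[OF \<mu>] and g = fin_measD[OF \<nu>]
  note fin\<pi> = integrable_coupling(1)[OF \<pi> \<mu> \<nu>]
  interpret \<pi>: finite_measure \<pi> by fact
  interpret \<mu>: finite_measure \<mu> by fact
  interpret \<nu>: finite_measure \<nu> by fact
  have st: "A \<times> B \<in> sets \<pi>" if "A \<in> sets borel" "B \<in> sets borel" for A B :: "real set"
    unfolding c(1) using that by (rule strip_in_borel)
  \<comment> \<open>Off \<open>a\<close>, only points with \<open>x \<in> L\<close> are sent into
    \<open>L\<close>, so the strip carries all of \<open>\<nu>\<close> there; the rest of its mass sits at
    \<open>a\<close>.\<close>
  have split: "emeasure \<pi> (L \<times> B) = emeasure \<nu> (L \<inter> B) + emeasure \<pi> (L \<times> (B \<inter> {a}))" if B: "B \<in> sets borel" for B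
  proof -
    have "emeasure \<pi> (L \<times> B) = emeasure \<pi> (UNIV \<times> (L \<inter> B) \<union> L \<times> (B \<inter> {a}))"
      by (rule emeasure_eq_AE, use ae in eventually_elim) (use B L st in auto)
    also have "\<dots> = emeasure \<pi> (UNIV \<times> (L \<inter> B)) + emeasure \<pi> (L \<times> (B \<inter> {a}))"
      using B L st by (intro plus_emeasure[symmetric]) auto
    also have "emeasure \<pi> (UNIV \<times> (L \<inter> B)) = emeasure \<nu> (L \<inter> B)"
      using B L by (intro emeasure_coupling_Times(2)[OF \<pi>]) auto
    finally show ?thesis .
  qed
  have "emeasure \<mu> L = emeasure \<nu> L + emeasure \<pi> (L \<times> {a})"
    using split[of UNIV] emeasure_coupling_Times(1)[OF \<pi> L(1)] by simp
  then have "measure \<mu> L = measure \<nu> L + measure \<pi> (L \<times> {a})"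
    by (simp add: \<mu>.emeasure_eq_measure \<nu>.emeasure_eq_measure \<pi>.emeasure_eq_measure flip: ennreal_plus)
  then have atom: "emeasure \<pi> (L \<times> {a}) = ennreal (measure \<mu> L - measure \<nu> L)"
    by (simp add: \<pi>.emeasure_eq_measure)
  have s: "sets (dirac (measure \<mu> L - measure \<nu> L) a) = sets (restr \<nu> L)"
    by (simp add: dirac_def restr_def g(1))
  show "sets (distr (density \<pi> (indicator (L \<times> UNIV))) borel snd) =
    sets (add_measure (restr \<nu> L) (dirac (measure \<mu> L - measure \<nu> L) a))" by (simp add: restr_def g(1))
  fix B assume "B \<in> sets (distr (density \<pi> (indicator (L \<times> UNIV))) borel (snd :: real \<times> real \<Rightarrow> real))"
  then have B: "B \<in> sets borel" by simp
  have Bs: "B \<in> sets (restr \<nu> L)" "B \<in> sets \<nu>" "L \<in> sets \<nu>" using B L(1) by (simp_all add: restr_def g(1))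
  have "emeasure (distr (density \<pi> (indicator (L \<times> UNIV))) borel snd) B = emeasure \<pi> (L \<times> B)"
    by (rule finite_measure_slice(2)[OF fin\<pi> c(1) L(1) B])
  also have "\<dots> = emeasure \<nu> (L \<inter> B) + ennreal (measure \<mu> L - measure \<nu> L) * indicator B a"
    unfolding split[OF B] by (cases "a \<in> B") (simp_all add: atom Int_insert_right)
  also have "\<dots> = emeasure (add_measure (restr \<nu> L) (dirac (measure \<mu> L - measure \<nu> L) a)) B"
    unfolding emeasure_add_measure[OF s Bs(1)] using B
    by (simp add: restr_def emeasure_restricted[OF Bs(3,2)] dirac_def)
  finally show "emeasure (distr (density \<pi> (indicator (L \<times> UNIV))) borel snd) B =
    emeasure (add_measure (restr \<nu> L) (dirac (measure \<mu> L - measure \<nu> L) a)) B" .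
qed

lemma diff_measure_cancel:
  assumes fin: "finite_measure L" "finite_measure M" "finite_measure N" "finite_measure P"
    and s: "sets M = sets L" "sets N = sets L" "sets P = sets L"
    and e: "\<And>A. A \<in> sets L \<Longrightarrow> emeasure L A = emeasure M A + emeasure N A + emeasure P A"
  shows "diff_measure (diff_measure L M) P = N"
proof -
  interpret L: finite_measure L by fact
  interpret M: finite_measure M by fact
  interpret P: finite_measure P by fact
  have d1: "emeasure (diff_measure L M) A = emeasure N A + emeasure P A" if A: "A \<in> sets L" for A
  proof -
    have "emeasure (diff_measure L M) A = emeasure L A - emeasure M A"
      using A s e by (intro emeasure_diff_measure fin) (auto simp: add.assoc)
    then show ?thesis using e[OF A] by (simp add: add.assoc)
  qed
  have finD: "finite_measure (diff_measure L M)"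
  proof (rule finite_measureI)
    have "emeasure (diff_measure L M) (space L) \<le> emeasure L (space L)"
      using d1[OF sets.top] e[OF sets.top] by (simp add: add.assoc)
    then show "emeasure (diff_measure L M) (space (diff_measure L M)) \<noteq> \<infinity>"
      using L.emeasure_finite[of "space L"] by (auto simp: top_unique)
  qed
  show ?thesis
  proof (rule measure_eqI)
    show "sets (diff_measure (diff_measure L M) P) = sets N" using s by simp
    fix A assume "A \<in> sets (diff_measure (diff_measure L M) P)"
    then have A: "A \<in> sets L" by simp
    have "emeasure (diff_measure (diff_measure L M) P) A = emeasure (diff_measure L M) A - emeasure P A"
      using A s d1 by (intro emeasure_diff_measure finD fin) auto
    then show "emeasure (diff_measure (diff_measure L M) P) A = emeasure N A"
      using d1[OF A] by (simp add: add.commute[of "emeasure N A"])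
  qed
qed

text \<open>An optimal coupling attains the lower bounds of both strikes \<open>xm\<close> and
  \<open>xp\<close>. Left of \<open>xm\<close> the mean is at least \<open>x\<close>, right of
  \<open>xp\<close> at most \<open>x\<close>, and in between the two conditions force it to be
  \<open>x\<close>. As no mass crosses the contact points, cutting the coupling along them gives the three
  pieces.\<close>

lemma optimal_in_Pi_star:
  assumes \<mu>: "\<mu> \<in> fin_meas" and \<nu>: "\<nu> \<in> fin_meas" and pc: "0 < p_gap \<mu> \<nu>" "0 < c_gap \<mu> \<nu>"
    and \<pi>: "\<pi> \<in> couplings \<mu> \<nu>" and cost: "cost \<mu> \<pi> = p_gap \<mu> \<nu> + c_gap \<mu> \<nu>"
  shows "\<pi> \<in> Pi_star \<mu> \<nu>"
proof -
  note c = couplingsD[OF \<pi>] and f = fin_measD[OF \<mu>] and g = fin_measD[OF \<nu>]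
  note fin\<pi> = integrable_coupling(1)[OF \<pi> \<mu> \<nu>]
  have mass: "measure \<mu> UNIV = measure \<nu> UNIV" using measure_coupling[OF \<pi>] by simp
  define a where "a = xm \<mu> \<nu>"
  define b where "b = xp \<mu> \<nu>"
  note contact = contact_points[OF \<mu> \<nu> mass pc, folded a_def b_def]
  have "(\<integral>x. max (cond_mean \<mu> \<pi> x - x) 0 \<partial>\<mu>) = p_gap \<mu> \<nu>"
    using cost cost_eq[OF \<pi> \<mu> \<nu>] by (simp add: c_gap_eq[OF \<mu> \<nu> mass])
  note at_a = optimal_cond_mean_contact[OF \<pi> \<mu> \<nu> this[folded contact(1)]]
    and at_b = optimal_cond_mean_contact[OF \<pi> \<mu> \<nu> this[folded contact(2)]]
  define part where "part A = density \<pi> (indicator (A \<times> UNIV))" for A :: "real set"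
  define marg where "marg A = distr (part A) borel snd" for A
  note rc = restrict_coupling[OF \<pi> \<mu> \<nu>, folded part_def]
  have rc1: "part A \<in> couplings (restr \<mu> A) (marg A)" if "A \<in> sets borel" for A
    using rc(1)[OF that] by (simp add: marg_def)
  have AEr: "(AE x in restr \<mu> A. P x) \<longleftrightarrow> (AE x in \<mu>. x \<in> A \<longrightarrow> P x)" if "A \<in> sets borel" for A P
    unfolding restr_def using that f(1) by (subst AE_density) auto
  have U: "UNIV = {..<a} \<union> {a..b} \<union> {b<..}" "{..<a} \<inter> {a..b} = {}" "{..<a} \<inter> {b<..} = {}" "{a..b} \<inter> {b<..} = {}"
    using contact(3) by auto
  have m_eq: "marg {..<a} = chi_m \<mu> \<nu>"
    unfolding marg_def part_def chi_m_def atom_masses(1)[OF \<mu> \<nu>]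
    unfolding a_def[symmetric]
  proof (rule second_marginal_of_strip[OF \<pi> \<mu> \<nu>])
    show "AE z in \<pi>. (fst z \<in> {..<a} \<longrightarrow> snd z \<in> insert a {..<a}) \<and> (fst z \<notin> {..<a} \<longrightarrow> snd z \<notin> {..<a})"
      using at_a(2) by eventually_elim auto
  qed auto
  have p_mass: "measure \<nu> {..b} - measure \<mu> {..b} = measure \<mu> {b<..} - measure \<nu> {b<..}"
  proof -
    have "measure \<eta> {..b} = measure \<eta> UNIV - measure \<eta> {b<..}" if "\<eta> \<in> fin_meas" for \<eta>
    proof -
      interpret finite_measure \<eta> using that by (rule fin_measD(3))
      have "{..b} = UNIV - {b<..}" by auto
      then show ?thesis using fin_measD(1,2)[OF that] finite_measure_compl[of "{b<..}"] by simp
    qed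
    then show ?thesis using \<mu> \<nu> mass by simp
  qed
  have p_eq: "marg {b<..} = chi_p \<mu> \<nu>"
    unfolding marg_def part_def chi_p_def atom_masses(2)[OF \<mu> \<nu>]
    unfolding b_def[symmetric] p_mass
  proof (rule second_marginal_of_strip[OF \<pi> \<mu> \<nu>])
    show "AE z in \<pi>. (fst z \<in> {b<..} \<longrightarrow> snd z \<in> insert b {b<..}) \<and> (fst z \<notin> {b<..} \<longrightarrow> snd z \<notin> {b<..})"
      using at_b(2) by eventually_elim auto
  qed auto
  have slice: "emeasure (marg A) B = emeasure \<pi> (A \<times> B)" if "A \<in> sets borel" "B \<in> sets borel" for A B
    unfolding marg_def part_def by (rule finite_measure_slice(2)[OF fin\<pi> c(1) that])
  have finm: "finite_measure (marg A)" if "A \<in> sets borel" for A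
    using finite_measure_slice(1)[OF fin\<pi> c(1) that] unfolding marg_def part_def finite_borel_measure_def by simp
  have add3: "emeasure \<pi> Z = emeasure \<pi> (({..<a} \<times> UNIV) \<inter> Z) + emeasure \<pi> (({a..b} \<times> UNIV) \<inter> Z) + emeasure \<pi> (({b<..} \<times> UNIV) \<inter> Z)"
    if Z: "Z \<in> sets borel" for Z
  proof -
    have s: "({..<a} \<times> UNIV) \<inter> Z \<in> sets \<pi>" "({a..b} \<times> UNIV) \<inter> Z \<in> sets \<pi>" "({b<..} \<times> UNIV) \<inter> Z \<in> sets \<pi>"
      unfolding c(1) using Z by (intro sets.Int strip_in_borel; simp)+
    have "Z = (({..<a} \<times> UNIV) \<inter> Z \<union> ({a..b} \<times> UNIV) \<inter> Z) \<union> ({b<..} \<times> UNIV) \<inter> Z" by auto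
    then have "emeasure \<pi> Z = emeasure \<pi> ((({..<a} \<times> UNIV) \<inter> Z \<union> ({a..b} \<times> UNIV) \<inter> Z) \<union> ({b<..} \<times> UNIV) \<inter> Z)" by simp
    also have "\<dots> = emeasure \<pi> (({..<a} \<times> UNIV) \<inter> Z \<union> ({a..b} \<times> UNIV) \<inter> Z) + emeasure \<pi> (({b<..} \<times> UNIV) \<inter> Z)"
      using s U(3,4) by (intro plus_emeasure[symmetric]) auto
    also have "emeasure \<pi> (({..<a} \<times> UNIV) \<inter> Z \<union> ({a..b} \<times> UNIV) \<inter> Z) = emeasure \<pi> (({..<a} \<times> UNIV) \<inter> Z) + emeasure \<pi> (({a..b} \<times> UNIV) \<inter> Z)"
      using s U(2) by (intro plus_emeasure[symmetric]) auto
    finally show ?thesis .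
  qed
  have z_eq: "chi_0 \<mu> \<nu> = marg {a..b}"
    unfolding chi_0_def m_eq[symmetric] p_eq[symmetric]
  proof (rule diff_measure_cancel)
    show "finite_measure \<nu>" by (rule g(3))
    show "sets (marg {..<a}) = sets \<nu>" "sets (marg {a..b}) = sets \<nu>" "sets (marg {b<..}) = sets \<nu>"
      by (simp_all add: marg_def g(1))
    fix B assume "B \<in> sets \<nu>"
    then have B: "B \<in> sets borel" using g(1) by simp
    have "emeasure \<nu> B = emeasure \<pi> (UNIV \<times> B)" by (rule emeasure_coupling_Times(2)[OF \<pi> B, symmetric])
    also have "\<dots> = emeasure (marg {..<a}) B + emeasure (marg {a..b}) B + emeasure (marg {b<..}) B"
      using B by (subst add3) (simp_all add: strip_in_borel slice Times_Int_Times)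
    finally show "emeasure \<nu> B = emeasure (marg {..<a}) B + emeasure (marg {a..b}) B + emeasure (marg {b<..}) B" .
  qed (simp_all add: finm)
  have m_in: "part {..<a} \<in> couplings_Sub (eta_m \<mu> \<nu>) (chi_m \<mu> \<nu>)"
    unfolding couplings_Sub_def eta_m_def a_def[symmetric] m_eq[symmetric] cond_mean_def[symmetric]
  proof (intro CollectI conjI rc1)
    have "AE x in \<mu>. x \<in> {..<a} \<longrightarrow> x \<le> cond_mean (restr \<mu> {..<a}) (part {..<a}) x"
      using at_a(1) rc(2)[of "{..<a}", simplified] by eventually_elim auto
    then show "AE x in restr \<mu> {..<a}. x \<le> cond_mean (restr \<mu> {..<a}) (part {..<a}) x"
      by (simp only: AEr lessThan_borel)
  qed simp
  have z_in: "part {a..b} \<in> couplings_M (eta_0 \<mu> \<nu>) (chi_0 \<mu> \<nu>)"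
    unfolding couplings_M_def eta_0_def a_def[symmetric] b_def[symmetric] z_eq cond_mean_def[symmetric]
  proof (intro CollectI conjI rc1)
    have "AE x in \<mu>. x \<in> {a..b} \<longrightarrow> cond_mean (restr \<mu> {a..b}) (part {a..b}) x = x"
      using at_a(1) at_b(1) rc(2)[of "{a..b}", simplified]
    proof eventually_elim
      case (elim x)
      have "cond_mean \<mu> \<pi> x = x" if "a \<le> x" "x \<le> b"
      proof (cases "x < b")
        case True
        then show ?thesis using elim(1,2) that by auto
      next
        case False
        then have "x = b" using that by simp
        then show ?thesis using elim(2) by simp
      qed
      then show ?case using elim(3) by simp
    qed
    then show "AE x in restr \<mu> {a..b}. cond_mean (restr \<mu> {a..b}) (part {a..b}) x = x"
      by (simp only: AEr atLeastAtMost_borel)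
  qed simp
  have p_in: "part {b<..} \<in> couplings_Sup (eta_p \<mu> \<nu>) (chi_p \<mu> \<nu>)"
    unfolding couplings_Sup_def eta_p_def b_def[symmetric] p_eq[symmetric] cond_mean_def[symmetric]
  proof (intro CollectI conjI rc1)
    have "AE x in \<mu>. x \<in> {b<..} \<longrightarrow> cond_mean (restr \<mu> {b<..}) (part {b<..}) x \<le> x"
      using at_b(1) rc(2)[of "{b<..}", simplified] by eventually_elim auto
    then show "AE x in restr \<mu> {b<..}. cond_mean (restr \<mu> {b<..}) (part {b<..}) x \<le> x"
      by (simp only: AEr greaterThan_borel)
  qed simp
  have "\<pi> = add_measure (add_measure (part {..<a}) (part {a..b})) (part {b<..})"
  proof (rule measure_eqI)
    show "sets \<pi> = sets (add_measure (add_measure (part {..<a}) (part {a..b})) (part {b<..}))"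
      by (simp add: part_def)
    fix Z assume Z: "Z \<in> sets \<pi>"
    have s: "sets (part A) = sets \<pi>" for A by (simp add: part_def)
    have r: "emeasure (part A) Z = emeasure \<pi> ((A \<times> UNIV) \<inter> Z)" if "A \<in> sets borel" for A
      unfolding part_def using that Z by (intro emeasure_restricted) (auto simp: c(1) strip_in_borel)
    have "emeasure (add_measure (add_measure (part {..<a}) (part {a..b})) (part {b<..})) Z =
      emeasure (part {..<a}) Z + emeasure (part {a..b}) Z + emeasure (part {b<..}) Z"
      using Z by (simp add: emeasure_add_measure s)
    then show "emeasure \<pi> Z = emeasure (add_measure (add_measure (part {..<a}) (part {a..b})) (part {b<..})) Z"
      using add3[of Z] Z c(1) by (simp add: r)
  qed
  then show ?thesis unfolding Pi_star_def using \<pi> m_in z_in p_in by blast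
qed

theorem theorem3p1:
  fixes \<mu> \<nu> :: "real measure"
  assumes "\<mu> \<in> fin_meas" and "\<nu> \<in> fin_meas"
    and "emeasure \<mu> UNIV = emeasure \<nu> UNIV"
    and "min (p_gap \<mu> \<nu>) (c_gap \<mu> \<nu>) > 0"
  shows "(\<forall>\<pi> \<in> Pi_star \<mu> \<nu>.
            V \<mu> \<nu> = (\<integral>x. \<bar>x - (\<integral>y. y \<partial>disint \<mu> \<pi> x)\<bar> \<partial>\<mu>) \<and>
            V \<mu> \<nu> = (bary (chi_m \<mu> \<nu>) - bary (eta_m \<mu> \<nu>)) + (bary (eta_p \<mu> \<nu>) - bary (chi_p \<mu> \<nu>)) \<and>
            V \<mu> \<nu> = V (eta_m \<mu> \<nu>) (chi_m \<mu> \<nu>) + V (eta_p \<mu> \<nu>) (chi_p \<mu> \<nu>)) \<and>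
         (\<forall>\<pi> \<in> couplings \<mu> \<nu>. cost \<mu> \<pi> = V \<mu> \<nu> \<longrightarrow> \<pi> \<in> Pi_star \<mu> \<nu>)"
proof -
  note \<mu> = assms(1) and \<nu> = assms(2)
  have pc: "0 < p_gap \<mu> \<nu>" "0 < c_gap \<mu> \<nu>" using assms(4) by auto
  have mass: "measure \<mu> UNIV = measure \<nu> UNIV" using assms(3) by (simp add: measure_def)
  have pos: "0 < measure \<mu> UNIV"
  proof (rule ccontr)
    assume "\<not> 0 < measure \<mu> UNIV"
    then have "measure \<mu> UNIV = 0" using measure_nonneg[of \<mu> UNIV] by linarith
    then have "emeasure \<mu> (space \<mu>) = 0"
      using fin_measD(2,3)[OF \<mu>] finite_measure.emeasure_eq_measure[OF fin_measD(3)[OF \<mu>]] by simp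
    then have "AE x in \<mu>. False" by (intro AE_I[of _ _ "space \<mu>"]) auto
    then have "put_fun \<mu> k = 0" for k
      unfolding put_fun_def by (intro integral_eq_zero_AE) (auto elim!: eventually_mono)
    then have "p_gap \<mu> \<nu> \<le> 0"
      unfolding p_gap_def using put_fun_nonneg[of \<nu>] by (intro cSUP_least) auto
    then show False using pc(1) by simp
  qed
  have V: "V \<mu> \<nu> = p_gap \<mu> \<nu> + c_gap \<mu> \<nu>"
    using pc by (intro V_eq_gaps \<mu> \<nu> mass pos) auto
  show ?thesis
  proof (intro conjI ballI impI)
    fix \<pi> assume star: "\<pi> \<in> Pi_star \<mu> \<nu>"
    note opt = Pi_star_optimal[OF \<mu> \<nu> pc star]
    show "V \<mu> \<nu> = (\<integral>x. \<bar>x - (\<integral>y. y \<partial>disint \<mu> \<pi> x)\<bar> \<partial>\<mu>)"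
      unfolding opt(1)[symmetric] cost_def ..
    show "V \<mu> \<nu> = (bary (chi_m \<mu> \<nu>) - bary (eta_m \<mu> \<nu>)) + (bary (eta_p \<mu> \<nu>) - bary (chi_p \<mu> \<nu>))"
      by (rule opt(2))
    show "V \<mu> \<nu> = V (eta_m \<mu> \<nu>) (chi_m \<mu> \<nu>) + V (eta_p \<mu> \<nu>) (chi_p \<mu> \<nu>)"
      by (rule opt(3))
  next
    fix \<pi> assume "\<pi> \<in> couplings \<mu> \<nu>" "cost \<mu> \<pi> = V \<mu> \<nu>"
    then show "\<pi> \<in> Pi_star \<mu> \<nu>" unfolding V by (rule optimal_in_Pi_star[OF \<mu> \<nu> pc])
  qed
qed

end
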